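(* Let $k\ge1$ be an integer and set \[ \Lambda_k=j_{1,k}^2,\qquad C_k=\frac{\Lambda_k}{5}+\frac{\Lambda_k^2}{45},\qquad t_k=\min\left\{\frac12,\frac{\pi^2}{2\Lambda_k}\right\}. \] For $t>0$ let $h_k(t)$ be the $k$th eigenvalue, counted with multiplicity, of the form $E_x+tE_y$ on the zero-mean space $\mathcal W$. Then for $0<t\le t_k$, \[ \Lambda_k\left(t-\frac{t^2}{3\left(1-\Lambda_k t/\pi^2\right)}\right)\le h_k(t)\le\Lambda_k\left(t-\frac{t^2}{3}\right)+C_k t^3. \] In particular, $h_k(t)=\Lambda_k t-\Lambda_k t^2/3+O_k(t^3)$ as $t\downarrow0$, with implicit constant allowed to depend on $k$.
   Context: $j_{1,k}$ denotes the $k$th positive zero of the Bessel function $J_1$. Let $\Delta=\{(x,y)\in\mathbb R^2:x>0,\ y>0,\ x+y<1\}$. For real $v\in H^1(\Delta)$ set \[ M(v)=\int_\Delta v^2\,dx\,dy,\qquad E_x(v)=\int_\Delta v_x^2\,dx\,dy,\qquad E_y(v)=\int_\Delta v_y^2\,dx\,dy, \] and let $\mathcal W=\{v\in H^1(\Delta):\int_\Delta v\,dx\,dy=0\}$. The eigenvalues of the form $E_x+tE_y$ on $\mathcal W$ are taken relative to $M$, i.e. \[ h_k(t)=\min_{\substack{\mathcal U\subset\mathcal W\\ \dim\mathcal U=k}}\ \max_{v\in\mathcal U\setminus\{0\}}\frac{E_x(v)+tE_y(v)}{M(v)}, \] where $\mathcal U$ ranges over $k$-dimensional linear subspaces of $\mathcal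 W$. *)

theory Defs
  imports "HOL-Analysis.Analysis" "HOL-Library.Landau_Symbols"
begin

definition bessel_J :: "nat \<Rightarrow> real \<Rightarrow> real" where
  "bessel_J n x = (\<Sum>m. (-1) ^ m / (fact m * fact (m + n)) * (x / 2) ^ (2 * m + n))"

text \<open>The \<open>k\<close>th positive zero, for \<open>k \<ge> 1\<close>: the positive zero \<open>z\<close> such that exactly \<open>k\<close> zeros
  lie in the interval from \<open>0\<close> (excluded) to \<open>z\<close> (included).\<close>

definition bessel_zero :: "nat \<Rightarrow> nat \<Rightarrow> real" where
  "bessel_zero n k = (THE z. z > 0 \<and> bessel_J n z = 0 \<and>
     finite {x. 0 < x \<and> x \<le> z \<and> bessel_J n x = 0} \<and>
     card {x. 0 < x \<and> x \<le> z \<and> bessel_J n x = 0} = k)"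

definition triangle :: "(real \<times> real) set" where
  "triangle = {(x, y). x > 0 \<and> y > 0 \<and> x + y < 1}"

abbreviation triangle_measure :: "(real \<times> real) measure" where
  "triangle_measure \<equiv> restrict_space lborel triangle"

text \<open>Functions are later identified when they agree almost everywhere, so Borel representatives
  suffice: every Lebesgue measurable function agrees almost everywhere with a Borel one.\<close>

definition square_integrable :: "(real \<times> real \<Rightarrow> real) \<Rightarrow> bool" where
  "square_integrable f \<longleftrightarrow> f \<in> borel_measurable triangle_measure \<and>
     integrable triangle_measure (\<lambda>p. (f p)\<^sup>2)"

text \<open>\<open>D i j\<close> is the partial derivative of \<open>\<phi>\<close> taken \<open>i\<close> times in \<open>x\<close> and \<open>j\<close> times in \<open>y\<close>. All of
  these being Frechet differentiable everywhere means that \<open>\<phi>\<close> is infinitely differentiable.\<close>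

definition smooth2 :: "(real \<times> real \<Rightarrow> real) \<Rightarrow> bool" where
  "smooth2 \<phi> \<longleftrightarrow> (\<exists>D :: nat \<Rightarrow> nat \<Rightarrow> real \<times> real \<Rightarrow> real. D 0 0 = \<phi> \<and>
     (\<forall>i j p. (D i j has_derivative
        (\<lambda>h. D (Suc i) j p * fst h + D i (Suc j) p * snd h)) (at p)))"

definition test_function :: "(real \<times> real \<Rightarrow> real) \<Rightarrow> bool" where
  "test_function \<phi> \<longleftrightarrow> smooth2 \<phi> \<and> compact (closure {p. \<phi> p \<noteq> 0}) \<and>
     closure {p. \<phi> p \<noteq> 0} \<subseteq> triangle"

definition weak_deriv ::
    "real \<times> real \<Rightarrow> (real \<times> real \<Rightarrow> real) \<Rightarrow> (real \<times> real \<Rightarrow> real) \<Rightarrow> bool" where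
  "weak_deriv e f g \<longleftrightarrow> square_integrable g \<and> (\<forall>\<phi>. test_function \<phi> \<longrightarrow>
     (LINT p|triangle_measure. f p * frechet_derivative \<phi> (at p) e) =
     - (LINT p|triangle_measure. g p * \<phi> p))"

definition sobolev :: "(real \<times> real \<Rightarrow> real) \<Rightarrow> bool" where
  "sobolev f \<longleftrightarrow> square_integrable f \<and> (\<exists>g. weak_deriv (1, 0) f g) \<and> (\<exists>g. weak_deriv (0, 1) f g)"

lemma sets_triangle [measurable]: "triangle \<in> sets borel"
proof -
  have "triangle = {p. 0 < fst p} \<inter> {p. 0 < snd p} \<inter> {p. fst p + snd p < 1}"
    by (auto simp: triangle_def)
  moreover have "open ({p. 0 < fst p} \<inter> {p. 0 < snd p} \<inter> {p::real\<times>real. fst p + snd p < 1})"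
    by (intro open_Int open_Collect_less continuous_intros)
  ultimately show ?thesis by simp
qed

lemma bounded_triangle: "bounded triangle"
proof -
  have "triangle \<subseteq> cbox (0, 0) (1, 1)"
    by (auto simp: triangle_def cbox_Pair_eq)
  then show ?thesis using bounded_cbox bounded_subset by blast
qed

lemma square_integrable_mult:
  assumes "square_integrable f" "square_integrable g"
  shows "integrable triangle_measure (\<lambda>p. f p * g p)"
proof (rule Bochner_Integration.integrable_bound)
  show "integrable triangle_measure (\<lambda>p. (f p)\<^sup>2 + (g p)\<^sup>2)"
    using assms by (auto simp: square_integrable_def)
  show "(\<lambda>p. f p * g p) \<in> borel_measurable triangle_measure"
    using assms by (auto simp: square_integrable_def)
  have "\<bar>a * b\<bar> \<le> \<bar>a\<^sup>2 + b\<^sup>2\<bar>" for a b :: real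
  proof -
    have "2 * (\<bar>a\<bar> * \<bar>b\<bar>) \<le> a\<^sup>2 + b\<^sup>2"
      using sum_squares_bound[of "\<bar>a\<bar>" "\<bar>b\<bar>"] by (simp add: mult.assoc)
    moreover have "0 \<le> \<bar>a\<bar> * \<bar>b\<bar>" by simp
    ultimately show ?thesis unfolding abs_mult by linarith
  qed
  then show "AE p in triangle_measure. norm (f p * g p) \<le> norm ((f p)\<^sup>2 + (g p)\<^sup>2)"
    by simp
qed

lemma square_integrable_continuous:
  fixes f :: "real \<times> real \<Rightarrow> real"
  assumes "continuous_on UNIV f"
  shows "square_integrable f"
proof -
  have m [measurable]: "f \<in> borel_measurable borel"
    using assms by (rule borel_measurable_continuous_onI)
  have "set_integrable lborel (closure triangle) (\<lambda>p. (f p)\<^sup>2)"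
    unfolding set_integrable_def
    by (rule borel_integrable_compact)
       (use bounded_triangle assms in \<open>auto intro!: continuous_intros intro: continuous_on_subset\<close>)
  then have "set_integrable lborel triangle (\<lambda>p. (f p)\<^sup>2)"
    by (rule set_integrable_subset) (auto intro: closure_subset[THEN subsetD])
  then show ?thesis
    by (auto simp: square_integrable_def integrable_restrict_space set_integrable_def
        intro!: measurable_restrict_space1)
qed

lemma square_integrable_add:
  assumes "square_integrable f" "square_integrable g"
  shows "square_integrable (\<lambda>p. f p + g p)"
proof -
  have "integrable triangle_measure (\<lambda>p. (f p)\<^sup>2 + (g p)\<^sup>2 + 2 * (f p * g p))"
    using assms square_integrable_mult[OF assms] unfolding square_integrable_def
    by (intro Bochner_Integration.integrable_add integrable_mult_right) auto
  then have "integrable triangle_measure (\<lambda>p. (f p + g p)\<^sup>2)"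
    by (simp only: power2_sum mult.assoc)
  then show ?thesis using assms by (auto simp: square_integrable_def intro: borel_measurable_add)
qed

lemma square_integrable_scale: "square_integrable f \<Longrightarrow> square_integrable (\<lambda>p. c * f p)"
  by (auto simp: square_integrable_def power_mult_distrib)

lemma square_integrable_test_function:
  assumes "test_function \<phi>"
  shows "square_integrable \<phi>" "square_integrable (\<lambda>p. frechet_derivative \<phi> (at p) e)"
proof -
  obtain D :: "nat \<Rightarrow> nat \<Rightarrow> real \<times> real \<Rightarrow> real" where D0: "D 0 0 = \<phi>" and
    D: "\<And>i j p. (D i j has_derivative
        (\<lambda>h. D (Suc i) j p * fst h + D i (Suc j) p * snd h)) (at p)"
    using assms by (auto simp: test_function_def smooth2_def)
  have c: "continuous_on UNIV (D i j)" for i j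
    by (intro continuous_at_imp_continuous_on ballI) (rule has_derivative_continuous[OF D])
  have "frechet_derivative \<phi> (at p) = (\<lambda>h. D 1 0 p * fst h + D 0 1 p * snd h)" for p
    using frechet_derivative_at[OF D[of 0 0 p]] by (simp add: D0)
  moreover have "continuous_on UNIV (\<lambda>p. D 1 0 p * fst e + D 0 1 p * snd e)"
    by (intro continuous_intros c)
  ultimately show "square_integrable (\<lambda>p. frechet_derivative \<phi> (at p) e)"
    by (simp add: square_integrable_continuous)
  show "square_integrable \<phi>" using c[of 0 0] by (simp add: D0 square_integrable_continuous)
qed

lemma weak_deriv_add:
  assumes "square_integrable f" "square_integrable f'" "weak_deriv e f g" "weak_deriv e f' g'"
  shows "weak_deriv e (\<lambda>p. f p + f' p) (\<lambda>p. g p + g' p)"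
  unfolding weak_deriv_def
proof (intro conjI allI impI)
  show "square_integrable (\<lambda>p. g p + g' p)"
    using assms by (simp add: weak_deriv_def square_integrable_add)
  fix \<phi> assume \<phi>: "test_function \<phi>"
  note test = square_integrable_mult[OF _ square_integrable_test_function(1)[OF \<phi>]]
    square_integrable_mult[OF _ square_integrable_test_function(2)[OF \<phi>]]
  show "(LINT p|triangle_measure. (f p + f' p) * frechet_derivative \<phi> (at p) e) =
      - (LINT p|triangle_measure. (g p + g' p) * \<phi> p)"
    using assms \<phi> unfolding distrib_right weak_deriv_def
    by (simp add: test)
qed

lemma weak_deriv_scale:
  assumes "weak_deriv e f g"
  shows "weak_deriv e (\<lambda>p. c * f p) (\<lambda>p. c * g p)"
  using assms by (auto simp: weak_deriv_def square_integrable_scale mult.assoc)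

lemma weak_deriv_cong_AE:
  assumes "sobolev f" "sobolev f'" "AE p in triangle_measure. f p = f' p"
  shows "weak_deriv e f = weak_deriv e f'"
proof -
  have "(LINT p|triangle_measure. f p * frechet_derivative \<phi> (at p) e) =
        (LINT p|triangle_measure. f' p * frechet_derivative \<phi> (at p) e)"
    if "test_function \<phi>" for \<phi>
    using assms square_integrable_test_function(2)[OF that, of e]
    by (intro integral_cong_AE borel_measurable_times)
       (auto simp: sobolev_def square_integrable_def)
  then show ?thesis by (auto simp: weak_deriv_def fun_eq_iff)
qed

lemma sobolev_add: "sobolev f \<Longrightarrow> sobolev g \<Longrightarrow> sobolev (\<lambda>p. f p + g p)"
  unfolding sobolev_def by (blast intro: square_integrable_add weak_deriv_add)

lemma sobolev_scale: "sobolev f \<Longrightarrow> sobolev (\<lambda>p. c * f p)"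
  unfolding sobolev_def by (blast intro: square_integrable_scale weak_deriv_scale)

lemma sobolev_uminus: "sobolev f \<Longrightarrow> sobolev (\<lambda>p. - f p)"
  using sobolev_scale[of f "-1"] by simp

lemma sobolev_diff: "sobolev f \<Longrightarrow> sobolev g \<Longrightarrow> sobolev (\<lambda>p. f p - g p)"
  using sobolev_add[of f "\<lambda>p. - g p"] sobolev_uminus[of g] by simp

lemma sobolev_zero: "sobolev (\<lambda>p. 0)"
proof -
  have "square_integrable (\<lambda>p. 0)" by (simp add: square_integrable_def)
  then have "weak_deriv e (\<lambda>p. 0) (\<lambda>p. 0)" for e by (simp add: weak_deriv_def)
  with \<open>square_integrable (\<lambda>p. 0)\<close> show ?thesis by (auto simp: sobolev_def)
qed

definition ae_eq :: "(real \<times> real \<Rightarrow> real) \<Rightarrow> (real \<times> real \<Rightarrow> real) \<Rightarrow> bool" where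
  "ae_eq f g \<longleftrightarrow> sobolev f \<and> sobolev g \<and> (AE p in triangle_measure. f p = g p)"

quotient_type H1 = "real \<times> real \<Rightarrow> real" / partial: ae_eq
proof (rule part_equivpI)
  show "\<exists>f. ae_eq f f" using sobolev_zero by (auto simp: ae_eq_def)
  show "symp ae_eq" by (auto simp: symp_def ae_eq_def)
  show "transp ae_eq"
    unfolding transp_def ae_eq_def
  proof (intro allI impI conjI; elim conjE)
    fix f g h :: "real \<times> real \<Rightarrow> real"
    assume "AE p in triangle_measure. f p = g p" "AE p in triangle_measure. g p = h p"
    then show "AE p in triangle_measure. f p = h p" by eventually_elim simp
  qed
qed

instantiation H1 :: real_vector
begin

lift_definition zero_H1 :: H1 is "\<lambda>p. 0"
  by (simp add: ae_eq_def sobolev_zero)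

lift_definition plus_H1 :: "H1 \<Rightarrow> H1 \<Rightarrow> H1" is "\<lambda>f g p. f p + g p"
  by (auto simp: ae_eq_def sobolev_add)

lift_definition uminus_H1 :: "H1 \<Rightarrow> H1" is "\<lambda>f p. - f p"
  by (auto simp: ae_eq_def sobolev_uminus)

lift_definition minus_H1 :: "H1 \<Rightarrow> H1 \<Rightarrow> H1" is "\<lambda>f g p. f p - g p"
  by (auto simp: ae_eq_def sobolev_diff)

lift_definition scaleR_H1 :: "real \<Rightarrow> H1 \<Rightarrow> H1" is "\<lambda>c f p. c * f p"
  by (auto simp: ae_eq_def sobolev_scale)

instance
proof
  fix a b :: real and x y z :: H1
  show "x + y + z = x + (y + z)"
    by transfer (auto simp: ae_eq_def sobolev_add add.assoc)
  show "x + y = y + x"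
    by transfer (auto simp: ae_eq_def sobolev_add add.commute)
  show "0 + x = x"
    by transfer (auto simp: ae_eq_def)
  show "- x + x = 0"
    by transfer (auto simp: ae_eq_def sobolev_zero)
  show "x - y = x + - y"
    by transfer (auto simp: ae_eq_def sobolev_diff)
  show "a *\<^sub>R (x + y) = a *\<^sub>R x + a *\<^sub>R y"
    by transfer (auto simp: ae_eq_def sobolev_add sobolev_scale distrib_left)
  show "(a + b) *\<^sub>R x = a *\<^sub>R x + b *\<^sub>R x"
    by transfer (auto simp: ae_eq_def sobolev_add sobolev_scale distrib_right)
  show "a *\<^sub>R b *\<^sub>R x = (a * b) *\<^sub>R x"
    by transfer (auto simp: ae_eq_def sobolev_scale mult.assoc)
  show "1 *\<^sub>R x = x"
    by transfer (auto simp: ae_eq_def)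
qed

end

lift_definition total :: "H1 \<Rightarrow> real" is "\<lambda>f. LINT p|triangle_measure. f p"
  by (auto simp: ae_eq_def sobolev_def square_integrable_def intro!: integral_cong_AE)

lift_definition mass :: "H1 \<Rightarrow> real" is "\<lambda>f. LINT p|triangle_measure. (f p)\<^sup>2"
  by (auto simp: ae_eq_def sobolev_def square_integrable_def intro!: integral_cong_AE)

text \<open>The weak derivative is unique up to null sets, so the integral does not depend on the choice.\<close>

lift_definition energy :: "real \<times> real \<Rightarrow> H1 \<Rightarrow> real" is
  "\<lambda>e f. LINT p|triangle_measure. ((SOME g. weak_deriv e f g) p)\<^sup>2"
  unfolding ae_eq_def by (metis weak_deriv_cong_AE)

abbreviation energy_x :: "H1 \<Rightarrow> real" where "energy_x \<equiv> energy (1, 0)"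
abbreviation energy_y :: "H1 \<Rightarrow> real" where "energy_y \<equiv> energy (0, 1)"

definition zero_mean :: "H1 set" where
  "zero_mean = {v. total v = 0}"

definition rayleigh :: "real \<Rightarrow> H1 \<Rightarrow> real" where
  "rayleigh t v = (energy_x v + t * energy_y v) / mass v"

text \<open>Min-max value. For \<open>k \<ge> 1\<close>, \<open>dim U = k\<close> forces \<open>U\<close> to be finite-dimensional, since \<open>dim\<close> is
  \<open>0\<close> on infinite-dimensional subspaces; and for \<open>t \<ge> 0\<close> minimum and maximum are rendered as
  infimum and supremum of nonempty sets that are bounded below and above, respectively.\<close>

definition eigval :: "nat \<Rightarrow> real \<Rightarrow> real" where
  "eigval k t = (INF U \<in> {U. subspace U \<and> U \<subseteq> zero_mean \<and> dim U = k}.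
     SUP v \<in> U - {0}. rayleigh t v)"

definition Lam :: "nat \<Rightarrow> real" where
  "Lam k = (bessel_zero 1 k)\<^sup>2"

definition Cst :: "nat \<Rightarrow> real" where
  "Cst k = Lam k / 5 + (Lam k)\<^sup>2 / 45"

definition t_bound :: "nat \<Rightarrow> real" where
  "t_bound k = min (1 / 2) (pi\<^sup>2 / (2 * Lam k))"

end

theory Submission
  imports Defs
begin

text \<open>On the triangle use the distance \<open>s = 1 - y\<close> to the vertex \<open>(0, 1)\<close> and the slope
  \<open>u = x / s\<close>: the slices \<open>s = const\<close> are the horizontal segments of length \<open>s\<close>, the area
  element is \<open>s ds du\<close> on the unit square, and a function of \<open>s\<close> alone sees the radial
  Laplacian of the disc. For small \<open>t\<close> a function of small energy is nearly constant on
  slices, so that the problem reduces to \<open>\<integral>s g\<^sup>2\<close> against \<open>\<integral>s a\<^sup>2\<close> for the slice mean \<open>a\<close> and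
  its derivative \<open>g\<close>, whose eigenvalues (under a Neumann condition at \<open>s = 1\<close>) are \<open>0\<close> and the
  numbers \<open>j\<^sup>2\<close> with eigenfunctions \<open>J\<^sub>0 (j s)\<close>, \<open>j\<close> a zero of \<open>J\<^sub>1\<close>. The two bounds make this
  quantitative; below, \<open>\<Lambda> = j\<^sub>1\<^sub>,\<^sub>k\<^sup>2\<close>.

  \<^bold>\<open>Lower bound.\<close> Let \<open>P\<close>, \<open>Q\<close> be the two weak derivatives of \<open>v\<close>. Along the rays through the
  vertex the derivative of \<open>v\<close> is \<open>u P - Q\<close>, so the slice mean has derivative
  \<open>g = \<integral>(u P - Q) du\<close> (\<open>slice_mean_primitive\<close>; rays are tangent to the two sides that bound
  the slices, hence no traces occur). Write \<open>\<gamma> = \<integral>u P du\<close>. On a slice of length at most \<open>1\<close>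
  the Poincare inequality gives \<open>\<pi>\<^sup>2 Var v \<le> \<integral>P\<^sup>2\<close>, Cauchy-Schwarz gives \<open>3 \<gamma>\<^sup>2 \<le> \<integral>P\<^sup>2\<close> because
  \<open>\<integral>u\<^sup>2 = 1/3\<close>, and \<open>(g - \<gamma>)\<^sup>2 \<le> \<integral>Q\<^sup>2\<close>. A fraction \<open>\<mu> = \<Lambda> t / \<pi>\<^sup>2\<close> of \<open>\<integral>P\<^sup>2\<close> pays for the variance
  of \<open>v\<close> in the slice; minimizing \<open>3 (1 - \<mu>) \<gamma>\<^sup>2 + t (g - \<gamma>)\<^sup>2\<close> over \<open>\<gamma>\<close> leaves at least
  \<open>(t - t\<^sup>2 / (3 (1 - \<mu>))) g\<^sup>2\<close> (\<open>slice_pointwise_bound\<close>). It remains to know \<open>\<Lambda> \<integral>s a\<^sup>2 \<le> \<integral>s g\<^sup>2\<close>.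
  Between consecutive zeros of \<open>J\<^sub>0 (j s)\<close>, \<open>j = j\<^sub>1\<^sub>,\<^sub>k\<close>, this is Picone's inequality, provided
  that \<open>a\<close> vanishes at these zeros (\<open>radial_nodal\<close>). By Rolle there are at most \<open>k\<close> of them
  (\<open>card_nodes\<close>), and the span of a \<open>k\<close>-dimensional \<open>U\<close> and the constants has dimension
  \<open>k + 1\<close>; so it contains some \<open>w = v + c \<noteq> 0\<close> with \<open>v \<in> U\<close> to which the estimate applies.
  Adding the constant does not change the energy and only increases the mass of the mean-zero
  \<open>v\<close>, so \<open>v\<close> satisfies the bound (\<open>minmax_lower_bound\<close>). No spectral theory is involved, only
  the min-max formula.

  \<^bold>\<open>Upper bound.\<close> Take \<open>v = U(s) + t (x\<^sup>2/2 - s\<^sup>2/6) U'(s)/s\<close> with \<open>U\<close> in the span of the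
  functions \<open>J\<^sub>0 (z s)\<close>, \<open>z \<le> j\<^sub>1\<^sub>,\<^sub>k\<close> a zero of \<open>J\<^sub>1\<close>. The second term is the shear that attains
  the optimum in the slice-wise estimate to first order. With \<open>D = \<integral>s U'\<^sup>2\<close> the two energies
  add up to \<open>(t - t\<^sup>2/3 + t\<^sup>3/9) D + t\<^sup>3/45 E\<close>, where \<open>E = \<integral>s\<^sup>7 ((U'/s)'/s)\<^sup>2\<close>. Orthogonality
  bounds \<open>D\<close> by \<open>\<Lambda> \<integral>s U\<^sup>2\<close>, and Bessel's equation bounds \<open>E\<close> by \<open>\<Lambda>\<^sup>2 \<integral>s U\<^sup>2 + 4 D\<close>. Since
  \<open>1/9 + 4/45 = 1/5\<close>, this is the constant \<open>\<Lambda>/5 + \<Lambda>\<^sup>2/45\<close> (\<open>trial_energy_bound\<close>).\<close>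

section \<open>Bessel functions and their zeros\<close>

text \<open>The entire function with \<open>J\<^sub>n(x) = (x/2)\<^sup>n h\<^sub>n(x\<^sup>2/4)\<close>. Removing the power of \<open>x\<close> makes
  differentiation an index shift and keeps everything smooth at the vertex \<open>s = 0\<close>.\<close>

definition bessel_h :: "nat \<Rightarrow> real \<Rightarrow> real" where
  "bessel_h n y = (\<Sum>m. (-1) ^ m / (fact m * fact (m + n)) * y ^ m)"

lemma bessel_h_sums:
  "(\<lambda>m. (-1) ^ m / (fact m * fact (m + n)) * y ^ m) sums bessel_h n y"
  for y :: real
proof -
  have "summable (\<lambda>m. (-1) ^ m / (fact m * fact (m + n)) * y ^ m)"
  proof (rule summable_comparison_test')
    show "summable (\<lambda>m. inverse (fact m) * \<bar>y\<bar> ^ m)" by (rule summable_exp)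
    show "norm ((-1) ^ m / (fact m * fact (m + n)) * y ^ m) \<le> inverse (fact m) * \<bar>y\<bar> ^ m" for m
    proof -
      have "(1::real) \<le> fact (m + n)" by (rule fact_ge_1)
      then have "inverse (fact m * fact (m + n)) \<le> inverse (fact m :: real)"
        by (intro le_imp_inverse_le) (auto simp: mult_le_cancel_left1)
      then have "inverse (fact m * fact (m + n)) * \<bar>y\<bar> ^ m \<le> inverse (fact m) * \<bar>y\<bar> ^ m"
        by (rule mult_right_mono) simp
      then show ?thesis by (simp add: abs_mult power_abs divide_inverse)
    qed
  qed
  then show ?thesis unfolding bessel_h_def by (rule summable_sums)
qed

lemma bessel_h_deriv: "(bessel_h n has_real_derivative - bessel_h (Suc n) y) (at y)"
proof -
  let ?c = "\<lambda>m. (-1) ^ m / (fact m * fact (m + n)) :: real"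
  have "((\<lambda>y. \<Sum>m. ?c m * y ^ m) has_real_derivative (\<Sum>m. diffs ?c m * y ^ m)) (at y)"
    by (rule termdiffs_strong_converges_everywhere) (use bessel_h_sums in \<open>auto simp: sums_iff\<close>)
  moreover have "diffs ?c m = - ((-1) ^ m / (fact m * fact (m + Suc n)))" for m
    by (simp add: diffs_def divide_simps del: of_nat_Suc)
  then have "(\<Sum>m. diffs ?c m * y ^ m) = - bessel_h (Suc n) y"
    using bessel_h_sums[of "Suc n" y] by (simp add: sums_iff suminf_minus)
  ultimately show ?thesis by (simp add: bessel_h_def[abs_def])
qed

text \<open>This is Bessel's differential equation for \<open>J\<^sub>0\<close>, read off from the coefficients.\<close>

lemma bessel_h_rec: "bessel_h 0 y = bessel_h 1 y - y * bessel_h 2 y"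
proof -
  let ?c = "\<lambda>n m. (-1) ^ m / (fact m * fact (m + n)) :: real"
  have "(\<lambda>m. y * (?c 2 m * y ^ m)) sums (y * bessel_h 2 y)"
    by (intro sums_mult bessel_h_sums)
  then have "(\<lambda>m. (\<lambda>m. case m of 0 \<Rightarrow> 0 | Suc m \<Rightarrow> y * (?c 2 m * y ^ m)) (Suc m)) sums (y * bessel_h 2 y)"
    by simp
  from sums_Suc[OF this]
  have "(\<lambda>m. case m of 0 \<Rightarrow> 0 | Suc m \<Rightarrow> y * (?c 2 m * y ^ m)) sums (y * bessel_h 2 y)"
    by simp
  then have "(\<lambda>m. ?c 1 m * y ^ m - (case m of 0 \<Rightarrow> 0 | Suc m \<Rightarrow> y * (?c 2 m * y ^ m)))
     sums (bessel_h 1 y - y * bessel_h 2 y)"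
    by (intro sums_diff bessel_h_sums)
  moreover have "?c 1 m * y ^ m - (case m of 0 \<Rightarrow> 0 | Suc m \<Rightarrow> y * (?c 2 m * y ^ m)) = ?c 0 m * y ^ m" for m
  proof (cases m)
    case (Suc j)
    have "?c 1 (Suc j) + ?c 2 j * (-1) * (-1) * -1 = ?c 0 (Suc j)"
    proof -
      define F where "F = (fact j :: real)"
      define r where "r = real j"
      have F: "fact (Suc j) = (r + 1) * F" "fact (Suc j + 1) = (r + 2) * ((r + 1) * F)"
        "fact (j + 2) = (r + 2) * ((r + 1) * F)" "fact j = F" "F \<noteq> 0" "r + 1 \<noteq> 0" "r + 2 \<noteq> 0"
        by (simp_all add: F_def r_def algebra_simps)
      show ?thesis unfolding add_0_right F using F(5-7) by (simp add: divide_simps) (simp add: algebra_simps)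
    qed
    then have "(?c 1 (Suc j) - ?c 2 j) * y ^ Suc j = ?c 0 (Suc j) * y ^ Suc j" by simp
    then show ?thesis by (simp only: Suc nat.case) (simp add: algebra_simps)
  qed simp
  ultimately show ?thesis using bessel_h_sums[of 0 y] by (simp add: sums_iff)
qed

lemma bessel_h_0: "bessel_h n 0 = 1 / fact n"
  unfolding bessel_h_def by (subst suminf_finite[of "{0}"]) auto

lemma bessel_J_h: "bessel_J n x = (x / 2) ^ n * bessel_h n (x\<^sup>2 / 4)"
proof -
  have "(\<lambda>m. (x / 2) ^ n * ((-1) ^ m / (fact m * fact (m + n)) * (x\<^sup>2 / 4) ^ m))
     sums ((x / 2) ^ n * bessel_h n (x\<^sup>2 / 4))"
    by (intro sums_mult bessel_h_sums)
  moreover have "(x / 2) ^ n * ((-1) ^ m / (fact m * fact (m + n)) * (x\<^sup>2 / 4) ^ m) =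
      (-1) ^ m / (fact m * fact (m + n)) * (x / 2) ^ (2 * m + n)" for m
    by (simp add: power_add power_mult power_divide power_mult_distrib divide_simps)
  ultimately have "(\<lambda>m. (-1) ^ m / (fact m * fact (m + n)) * (x / 2) ^ (2 * m + n))
     sums ((x / 2) ^ n * bessel_h n (x\<^sup>2 / 4))" by (simp only:)
  then show ?thesis unfolding bessel_J_def sums_iff by simp
qed

text \<open>\<open>rad z s = J\<^sub>0(z s)\<close>. The functions \<open>rad1\<close> and \<open>rad2\<close> are its first and second iterated
  derivatives with respect to \<open>s\<^sup>2/2\<close>, that is, under \<open>(1/s) d/ds\<close>; in this form they have no
  singularity at \<open>0\<close>.\<close>

definition rad :: "real \<Rightarrow> real \<Rightarrow> real" where "rad z s = bessel_h 0 (z\<^sup>2 * s\<^sup>2 / 4)"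
definition rad1 :: "real \<Rightarrow> real \<Rightarrow> real" where "rad1 z s = - (z\<^sup>2 / 2) * bessel_h 1 (z\<^sup>2 * s\<^sup>2 / 4)"
definition rad2 :: "real \<Rightarrow> real \<Rightarrow> real" where "rad2 z s = z ^ 4 / 4 * bessel_h 2 (z\<^sup>2 * s\<^sup>2 / 4)"

lemma rad_deriv: "(rad z has_real_derivative s * rad1 z s) (at s)"
proof -
  have "((\<lambda>s. z\<^sup>2 * s\<^sup>2 / 4) has_real_derivative z\<^sup>2 * s / 2) (at s)"
    by (auto intro!: derivative_eq_intros)
  from DERIV_chain2[OF bessel_h_deriv this, of 0] show ?thesis
    unfolding rad_def[abs_def] rad1_def by (simp add: mult_ac)
qed

lemma rad1_deriv: "(rad1 z has_real_derivative s * rad2 z s) (at s)"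
proof -
  have "((\<lambda>s. z\<^sup>2 * s\<^sup>2 / 4) has_real_derivative z\<^sup>2 * s / 2) (at s)"
    by (auto intro!: derivative_eq_intros)
  from DERIV_cmult[OF DERIV_chain2[OF bessel_h_deriv this, of 1], of "- (z\<^sup>2 / 2)"] show ?thesis
    unfolding rad1_def[abs_def] rad2_def
    by (simp add: numeral_2_eq_2[symmetric] power4_eq_xxxx power2_eq_square mult_ac)
qed

lemma rad2_continuous: "continuous_on S (rad2 z)"
proof -
  have "((\<lambda>s. z\<^sup>2 * s\<^sup>2 / 4) has_real_derivative z\<^sup>2 * s / 2) (at s)" for s
    by (auto intro!: derivative_eq_intros)
  from DERIV_isCont[OF DERIV_chain2[OF bessel_h_deriv this]]
  have "continuous_on S (\<lambda>s. bessel_h 2 (z\<^sup>2 * s\<^sup>2 / 4))"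
    by (auto intro!: continuous_at_imp_continuous_on)
  then show ?thesis unfolding rad2_def[abs_def] by (rule continuous_on_mult_left)
qed

lemma rad_continuous: "continuous_on S (rad z)" and rad1_continuous: "continuous_on S (rad1 z)"
  by (meson DERIV_isCont continuous_at_imp_continuous_on rad_deriv rad1_deriv)+

lemma rad_ode: "2 * rad1 z s + s\<^sup>2 * rad2 z s = - z\<^sup>2 * rad z s"
  unfolding rad_def rad1_def rad2_def bessel_h_rec[of "z\<^sup>2 * s\<^sup>2 / 4"]
  by (simp add: algebra_simps power2_eq_square power4_eq_xxxx)

lemma rad_0 [simp]: "rad z 0 = 1" and rad1_0 [simp]: "rad1 z 0 = - (z\<^sup>2 / 2)"
  by (auto simp: rad_def rad1_def bessel_h_0)

lemma bessel_J_rad: "bessel_J 0 (z * s) = rad z s" "z * bessel_J 1 (z * s) = - s * rad1 z s"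
  by (auto simp: rad_def rad1_def bessel_J_h power2_eq_square mult_ac)

text \<open>The equation \<open>(s u')' = - z\<^sup>2 s u\<close> in divergence form; the factor \<open>s * rad1 z s\<close> is
  \<open>u'\<close>.\<close>

lemma flux_deriv: "((\<lambda>s. s * (s * rad1 z s)) has_real_derivative - z\<^sup>2 * (s * rad z s)) (at s)"
proof -
  have "((\<lambda>s. s * (s * rad1 z s)) has_real_derivative s * (2 * rad1 z s + s\<^sup>2 * rad2 z s)) (at s)"
    by (rule derivative_eq_intros rad1_deriv refl)+ (simp add: algebra_simps power2_eq_square)
  then show ?thesis unfolding rad_ode by (simp add: mult_ac)
qed

text \<open>The quantity \<open>z\<^sup>2 (s u)\<^sup>2 + (s u')\<^sup>2\<close> has the nonnegative derivative \<open>2 z\<^sup>2 s u\<^sup>2\<close> on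
  \<open>s > 0\<close>. Were \<open>u\<close> and \<open>u'\<close> to vanish together at \<open>s\<close>, it would vanish on all of \<open>(0, s]\<close>,
  contradicting \<open>u(0) = 1\<close>.\<close>

lemma rad_zero_simple:
  assumes "s > 0" "rad z s = 0"
  shows "rad1 z s \<noteq> 0"
proof
  assume z1: "rad1 z s = 0"
  let ?E = "\<lambda>s. z\<^sup>2 * (s * rad z s)\<^sup>2 + (s * (s * rad1 z s))\<^sup>2"
  have E: "(?E has_real_derivative 2 * z\<^sup>2 * s * (rad z s)\<^sup>2) (at s)" for s
    by (rule derivative_eq_intros rad_deriv flux_deriv refl)+ (simp add: algebra_simps power2_eq_square)
  have "?E y \<le> 0" if "0 < y" "y \<le> s" for y
  proof -
    have "?E y \<le> ?E s"
      by (rule DERIV_nonneg_imp_nondecreasing[OF that(2)]) (use E that in \<open>force intro!: exI mult_nonneg_nonneg\<close>)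
    then show ?thesis using assms z1 by simp
  qed
  moreover have "z \<noteq> 0" using assms by (auto simp: rad_def bessel_h_0)
  ultimately have 0: "rad z y = 0" if y: "0 < y" "y \<le> s" for y
  proof -
    have "0 \<le> z\<^sup>2 * (y * rad z y)\<^sup>2" "0 \<le> (y * (y * rad1 z y))\<^sup>2" by simp_all
    then have "z\<^sup>2 * (y * rad z y)\<^sup>2 = 0" using \<open>\<And>y. 0 < y \<Longrightarrow> y \<le> s \<Longrightarrow> ?E y \<le> 0\<close>[OF y] by linarith
    then show ?thesis using y \<open>z \<noteq> 0\<close> by simp
  qed
  have "(rad z \<longlongrightarrow> rad z 0) (at_right 0)"
    using DERIV_isCont[OF rad_deriv, of 0 z] by (simp add: isCont_def filterlim_at_split)
  moreover have "eventually (\<lambda>y. rad z y = 0) (at_right 0)"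
    unfolding eventually_at_right_field using assms 0 by (intro exI[of _ s]) auto
  then have "(rad z \<longlongrightarrow> 0) (at_right 0)" by (rule tendsto_eventually)
  ultimately show False using tendsto_unique trivial_limit_at_right_real by fastforce
qed

text \<open>Near the vertex \<open>u > 0 > u'\<close>. This sign makes the boundary term of Picone's inequality
  at a small inner radius harmless.\<close>

lemma rad_near_0:
  assumes "z \<noteq> 0"
  shows "\<exists>d>0. \<forall>s. 0 < s \<and> s < d \<longrightarrow> rad z s > 0 \<and> rad1 z s < 0"
proof -
  have "(rad z \<longlongrightarrow> 1) (at_right 0)" "(rad1 z \<longlongrightarrow> - (z\<^sup>2 / 2)) (at_right 0)"
    using DERIV_isCont[OF rad_deriv, of 0 z] DERIV_isCont[OF rad1_deriv, of 0 z]
    by (simp_all add: isCont_def filterlim_at_split)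
  then have "eventually (\<lambda>s. 0 < rad z s \<and> rad1 z s < 0) (at_right 0)"
    using assms by (intro eventually_conj order_tendstoD[where y = 1] order_tendstoD) auto
  then show ?thesis by (auto simp: eventually_at_right_field)
qed

definition J1_zeros :: "real \<Rightarrow> real set" where
  "J1_zeros R = {x. 0 < x \<and> x \<le> R \<and> bessel_J 1 x = 0}"

lemma J0_deriv: "(bessel_J 0 has_real_derivative - bessel_J 1 x) (at x)"
  using rad_deriv[of 1 x] bessel_J_rad[of 1] by (simp add: ext[of "bessel_J 0" "rad 1"])

lemma J1_eq: "bessel_J 1 x = - x * rad1 1 x"
  using bessel_J_rad(2)[of 1 x] by simp

lemma J1_deriv: "(bessel_J 1 has_real_derivative - rad1 1 x - x\<^sup>2 * rad2 1 x) (at x)"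
  unfolding J1_eq[abs_def]
  by (rule derivative_eq_intros rad1_deriv refl)+ (simp add: algebra_simps power2_eq_square)

text \<open>An accumulation point \<open>l\<close> of zeros is a zero of \<open>J\<^sub>1\<close> and of its derivative. For \<open>l > 0\<close>
  the Bessel equation then forces a double zero of \<open>J\<^sub>0\<close>; for \<open>l = 0\<close> the derivative is \<open>1/2\<close>.\<close>

lemma finite_J1_zeros: "finite (J1_zeros R)"
proof (rule ccontr)
  assume inf: "infinite (J1_zeros R)"
  have sub: "J1_zeros R \<subseteq> {0..R}" by (auto simp: J1_zeros_def)
  then obtain l where l: "l \<in> {0..R}" "l islimpt (J1_zeros R)"
    using inf compact_Icc compact_eq_Bolzano_Weierstrass by (metis)
  let ?d = "- rad1 1 l - l\<^sup>2 * rad2 1 l"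
  have fr: "frequently (\<lambda>x. bessel_J 1 x = 0) (at l)"
    using l(2) by (auto simp: islimpt_conv_frequently_at J1_zeros_def elim!: frequently_elim1)
  have lim1: "(bessel_J 1 \<longlongrightarrow> bessel_J 1 l) (at l)"
    using DERIV_isCont[OF J1_deriv] unfolding isCont_def .
  have J1: "bessel_J 1 l = 0"
    using lim1 fr tendsto_imp_eventually_ne[of "bessel_J 1" _ "at l" 0] unfolding frequently_def by blast
  have "((\<lambda>x. (bessel_J 1 x - bessel_J 1 l) / (x - l)) \<longlongrightarrow> ?d) (at l)"
    using J1_deriv[of l] unfolding has_field_derivative_iff .
  moreover have "frequently (\<lambda>x. (bessel_J 1 x - bessel_J 1 l) / (x - l) = 0) (at l)"
    using fr by (rule frequently_elim1) (simp only: J1 diff_self div_0)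
  ultimately have d: "?d = 0"
    using tendsto_imp_eventually_ne[of _ _ "at l" 0] unfolding frequently_def by blast
  show False
  proof (cases "l = 0")
    case True then show False using d by simp
  next
    case False
    then have "l > 0" using l by auto
    then have "rad1 1 l = 0" using J1[unfolded J1_eq] by simp
    moreover from this d have "l\<^sup>2 * rad2 1 l = 0" by simp
    with \<open>rad1 1 l = 0\<close> have "rad 1 l = 0" using rad_ode[of 1 l] by (simp only:) simp
    ultimately show False using rad_zero_simple[of l 1] \<open>l > 0\<close> by simp
  qed
qed

text \<open>The algebra behind the derivative of the Wronskian in the next proof, with \<open>r\<^sup>2 = x\<close>,
  \<open>J = J\<^sub>0(x)\<close>, \<open>j = J\<^sub>1(x)\<close>, and \<open>C\<close>, \<open>S\<close> the cosine and sine of \<open>x - a\<close>.\<close>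

lemma sturm_identity:
  fixes r :: real
  assumes "r > 0"
  shows "((inverse r * J / 2 - j * r) * C - S * (r * J)
      - (((- (j * (2 * r)) - J * inverse r) / (4 * (r * r)) - (inverse r * j / 2 + (J - j / (r * r)) * r)) * S
        + C * (J / (2 * r) - r * j))) * e
    = e * J * S / (4 * (r * r) * r)"
  using assms by (simp add: field_simps)

text \<open>Sturm comparison: \<open>w = sqrt x J\<^sub>0(x)\<close> solves \<open>w'' + (1 + 1/(4 x\<^sup>2)) w = 0\<close>, so it
  oscillates at least as fast as \<open>sin (x - a)\<close>. If \<open>J\<^sub>0\<close> kept its sign \<open>e\<close> on \<open>[a, a + \<pi>]\<close>,
  then the Wronskian \<open>e (w cos - w' sin)\<close> would be nondecreasing there, while its end values
  are \<open>e w(a) > 0\<close> and \<open>- e w(a + \<pi>) < 0\<close>.\<close>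

lemma J0_zero_in_interval:
  assumes a: "a > 0"
  shows "\<exists>x\<in>{a..a+pi}. bessel_J 0 x = 0"
proof (rule ccontr)
  assume no: "\<not> ?thesis"
  have cont: "continuous_on {a..a+pi} (bessel_J 0)"
    by (meson DERIV_isCont J0_deriv continuous_at_imp_continuous_on)
  define e where "e = sgn (bessel_J 0 a)"
  have pos: "e * bessel_J 0 x > 0" if x: "x \<in> {a..a+pi}" for x
  proof (rule ccontr)
    assume "\<not> ?thesis"
    moreover have "bessel_J 0 a \<noteq> 0" using no by auto
    then have "e * bessel_J 0 a > 0" unfolding e_def by (cases "bessel_J 0 a > 0") auto
    moreover have "continuous_on {a..x} (\<lambda>x. e * bessel_J 0 x)"
      using x by (intro continuous_intros continuous_on_subset[OF cont]) auto
    ultimately obtain y where "y \<in> {a..x}" "e * bessel_J 0 y = 0"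
      using IVT2'[of "\<lambda>x. e * bessel_J 0 x" x 0 a] x by auto
    then show False using no x \<open>e * bessel_J 0 a > 0\<close> by auto
  qed
  let ?F = "\<lambda>x. e * (sqrt x * bessel_J 0 x * cos (x - a) - (bessel_J 0 x / (2 * sqrt x) - sqrt x * bessel_J 1 x) * sin (x - a))"
  have D: "(?F has_real_derivative e * bessel_J 0 x * sin (x - a) / (4 * x * sqrt x)) (at x)" if "x > 0" for x
  proof -
    define r where "r = sqrt x"
    have r: "r > 0" "x = r * r" using that by (auto simp: r_def)
    have J1': "- rad1 1 x - x\<^sup>2 * rad2 1 x = bessel_J 0 x - bessel_J 1 x / x"
      using rad_ode[of 1 x] bessel_J_rad(1)[of 1 x] J1_eq[of x] that by simp
    have "(bessel_J 1 has_real_derivative bessel_J 0 x - bessel_J 1 x / x) (at x)"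
      using J1_deriv[of x] unfolding J1' .
    note d = this J0_deriv
    show ?thesis using that
      apply (auto intro!: derivative_eq_intros d[unfolded One_nat_def])
      apply (simp add: r_def[symmetric])
      using r(1) unfolding r(2) by (intro sturm_identity)
  qed
  have "?F a \<le> ?F (a + pi)"
  proof (rule DERIV_nonneg_imp_nondecreasing[where f = ?F])
    fix x assume x: "a \<le> x" "x \<le> a + pi"
    then have "0 \<le> e * bessel_J 0 x * sin (x - a) / (4 * x * sqrt x)"
      using pos[of x] a by (intro divide_nonneg_nonneg mult_nonneg_nonneg[OF less_imp_le] sin_ge_zero) auto
    then show "\<exists>y. (?F has_real_derivative y) (at x) \<and> 0 \<le> y" using D[of x] x a by auto
  qed simp
  then have "e * (sqrt a * bessel_J 0 a) \<le> - (e * (sqrt (a + pi) * bessel_J 0 (a + pi)))" by simp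
  moreover have "0 < sqrt a * (e * bessel_J 0 a)" "0 < sqrt (a + pi) * (e * bessel_J 0 (a + pi))"
    using pos[of a] pos[of "a + pi"] a pi_gt_zero by (auto intro!: mult_pos_pos add_pos_pos)
  ultimately show False by (simp add: mult_ac)
qed

text \<open>Rolle, since \<open>J\<^sub>0' = - J\<^sub>1\<close>.\<close>

lemma J1_zero_between:
  assumes "p < q" "bessel_J 0 p = 0" "bessel_J 0 q = 0"
  shows "\<exists>x. p < x \<and> x < q \<and> bessel_J 1 x = 0"
proof -
  have D: "(bessel_J 0 has_derivative (\<lambda>h. - bessel_J 1 x * h)) (at x)" for x
    using J0_deriv[of x] unfolding has_field_derivative_def .
  have "\<exists>x>p. x < q \<and> (\<lambda>h. - bessel_J 1 x * h) = (\<lambda>v. 0)"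
    by (rule Rolle_deriv[of p q "bessel_J 0"])
       (use assms D in \<open>auto intro!: continuous_at_imp_continuous_on intro: has_derivative_continuous simp del: One_nat_def\<close>)
  then show ?thesis by (metis mult_1_right neg_equal_0_iff_equal)
qed

lemma J1_zero_beyond: "\<exists>x>a. bessel_J 1 x = 0"
proof -
  define b where "b = \<bar>a\<bar> + 1"
  have "b > 0" by (simp add: b_def)
  obtain p where p: "p \<in> {b..b+pi}" "bessel_J 0 p = 0" using J0_zero_in_interval[of b] unfolding b_def by fastforce
  obtain q where q: "q \<in> {b+pi+1..b+pi+1+pi}" "bessel_J 0 q = 0"
    using J0_zero_in_interval[of "b+pi+1"] pi_gt_zero p(1) \<open>b > 0\<close> by auto
  obtain x where "p < x" "bessel_J 1 x = 0" using J1_zero_between[of p q] p q by auto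
  then show ?thesis using p by (intro exI[of _ x]) (auto simp: b_def)
qed

text \<open>The zeros are unbounded and finitely many up to any bound, so each one has a successor.\<close>

lemma J1_zeros_exists:
  assumes "k \<ge> 1"
  shows "\<exists>z>0. bessel_J 1 z = 0 \<and> card (J1_zeros z) = k"
proof -
  have next_zero: "\<exists>z>y. bessel_J 1 z = 0 \<and> J1_zeros z = insert z (J1_zeros y)" if "y \<ge> 0" for y
  proof -
    obtain x where x: "x > y" "bessel_J 1 x = 0" using J1_zero_beyond by blast
    define S where "S = {w \<in> J1_zeros x. w > y}"
    have "finite S" using finite_J1_zeros[of x] by (simp add: S_def)
    moreover have "x \<in> S" using x that by (auto simp: S_def J1_zeros_def)
    ultimately have S: "finite S" "x \<in> S" by auto
    have m: "Min S \<in> S" using S by (intro Min_in) auto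
    have "w > y \<Longrightarrow> w \<in> J1_zeros (Min S) \<Longrightarrow> w = Min S" for w
      using Min_le[OF S(1), of w] m by (fastforce simp: S_def J1_zeros_def)
    then have "J1_zeros (Min S) = insert (Min S) (J1_zeros y)"
      using m by (fastforce simp: S_def J1_zeros_def)
    then show ?thesis using m by (intro exI[of _ "Min S"]) (auto simp: S_def J1_zeros_def)
  qed
  have empty: "J1_zeros 0 = {}" by (auto simp: J1_zeros_def)
  show ?thesis using assms
  proof (induction k rule: nat_induct_at_least)
    case base
    then show ?case using next_zero[of 0] empty by fastforce
  next
    case (Suc k)
    then obtain y where y: "y > 0" "card (J1_zeros y) = k" by auto
    then obtain z where z: "z > y" "bessel_J 1 z = 0" "J1_zeros z = insert z (J1_zeros y)"
      using next_zero[of y] by auto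
    have "z \<notin> J1_zeros y" using z by (auto simp: J1_zeros_def)
    then show ?case using y z finite_J1_zeros by (intro exI[of _ z]) auto
  qed
qed

lemma bessel_zero_1:
  assumes "k \<ge> 1"
  shows "bessel_zero 1 k > 0" "bessel_J 1 (bessel_zero 1 k) = 0" "card (J1_zeros (bessel_zero 1 k)) = k"
proof -
  let ?P = "\<lambda>z. z > 0 \<and> bessel_J 1 z = 0 \<and> card (J1_zeros z) = k"
  have uniq: "z = z'" if "?P z" "?P z'" "z \<le> z'" for z z'
  proof (rule ccontr)
    assume "z \<noteq> z'"
    then have "z' \<notin> J1_zeros z" "z' \<in> J1_zeros z'" "J1_zeros z \<subseteq> J1_zeros z'"
      using that by (auto simp: J1_zeros_def)
    then have "J1_zeros z \<subset> J1_zeros z'" by blast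
    then show False using psubset_card_mono[OF finite_J1_zeros] that by (metis less_irrefl)
  qed
  have "\<exists>!z. ?P z"
  proof -
    obtain z where "?P z" using J1_zeros_exists[OF assms] by blast
    then show ?thesis using uniq by (intro ex1I[of _ z]) (auto, metis linear)
  qed
  moreover have "bessel_zero 1 k = (THE z. ?P z)"
    using finite_J1_zeros unfolding bessel_zero_def J1_zeros_def by simp
  ultimately have "?P (bessel_zero 1 k)" using theI'[of ?P] by simp
  then show "bessel_zero 1 k > 0" "bessel_J 1 (bessel_zero 1 k) = 0" "card (J1_zeros (bessel_zero 1 k)) = k"
    by auto
qed

text \<open>For the \<open>k\<close>th eigenfunction these are the points where the slice mean has to vanish.\<close>

definition nodes :: "real \<Rightarrow> real set" where
  "nodes z = {s. 0 < s \<and> s < 1 \<and> rad z s = 0}"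

text \<open>To a node \<open>s\<close> assign a zero of \<open>J\<^sub>1\<close> between \<open>z s\<close> and the next node (or the zero \<open>z\<close>
  itself after the last node). This map is strictly increasing. Finite subsets \<open>F\<close> are treated
  first because finiteness of the node set is a consequence.\<close>

lemma card_nodes:
  assumes z: "z > 0" "bessel_J 1 z = 0"
  shows "finite (nodes z)" "card (nodes z) \<le> card (J1_zeros z)"
proof -
  have le: "card F \<le> card (J1_zeros z)" if F: "finite F" "F \<subseteq> nodes z" for F
  proof (rule card_inj_on_le)
    let ?P = "\<lambda>s y. y \<in> J1_zeros z \<and> z * s < y \<and> (\<forall>s'\<in>F. s < s' \<longrightarrow> y < z * s')"
    have ex: "\<exists>y. ?P s y" if s: "s \<in> F" for s
    proof (cases "{s'\<in>F. s < s'} = {}")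
      case True
      then show ?thesis using z s F by (intro exI[of _ z]) (auto simp: J1_zeros_def nodes_def)
    next
      case False
      let ?m = "Min {s'\<in>F. s < s'}"
      have m: "?m \<in> {s'\<in>F. s < s'}" using False F by (intro Min_in) auto
      have 0: "bessel_J 0 (z * s) = 0" "bessel_J 0 (z * ?m) = 0"
        using s m F by (auto simp: bessel_J_rad nodes_def)
      obtain y where y: "z * s < y" "y < z * ?m" "bessel_J 1 y = 0"
        using J1_zero_between[OF _ 0] m z by auto
      have "y < z * s'" if "s' \<in> F" "s < s'" for s'
      proof -
        have "?m \<le> s'" using that F by (intro Min_le) auto
        then have "z * ?m \<le> z * s'" using z by simp
        then show ?thesis using y by linarith
      qed
      moreover have "0 < s" "?m < 1" using s m F by (auto simp: nodes_def)
      moreover have "0 < z * s" using \<open>0 < s\<close> z by simp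
      moreover have "z * ?m < z" using \<open>?m < 1\<close> z by simp
      ultimately show ?thesis using y by (intro exI[of _ y]) (auto simp: J1_zeros_def)
    qed
    define f where "f s = (SOME y. ?P s y)" for s
    have f: "?P s (f s)" if "s \<in> F" for s unfolding f_def using ex[OF that] by (rule someI_ex)
    show "f ` F \<subseteq> J1_zeros z" using f by auto
    have "f s < f s'" if "s \<in> F" "s' \<in> F" "s < s'" for s s'
      using f[OF that(1)] f[OF that(2)] that by force
    then show "inj_on f F" by (metis inj_onI less_irrefl linorder_neqE_linordered_idom)
  qed (rule finite_J1_zeros)
  show fin: "finite (nodes z)"
  proof (rule ccontr)
    assume "infinite (nodes z)"
    then obtain F where "finite F" "card F = Suc (card (J1_zeros z))" "F \<subseteq> nodes z"
      using infinite_arbitrarily_large by blast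
    then show False using le[of F] by simp
  qed
  show "card (nodes z) \<le> card (J1_zeros z)" using le[OF fin] by simp
qed

section \<open>Indefinite integrals\<close>

text \<open>Absolute continuity in integrated form: \<open>F\<close> is an indefinite integral of \<open>f\<close>. Functions
  of one variable with a weak derivative are of this kind and in general no better, so the
  classical rules are needed in this form.\<close>

definition primitive :: "real \<Rightarrow> real \<Rightarrow> (real \<Rightarrow> real) \<Rightarrow> (real \<Rightarrow> real) \<Rightarrow> bool" where
  "primitive a b F f \<longleftrightarrow> set_integrable lborel {a..b} f \<and>
     (\<forall>x\<in>{a..b}. F x - F a = (LINT t:{a..x}|lborel. f t))"

lemma primitive_integrable: "primitive a b F f \<Longrightarrow> a \<le> x \<Longrightarrow> y \<le> b \<Longrightarrow> set_integrable lborel {x..y} f"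
  unfolding primitive_def by (rule set_integrable_subset[of _ "{a..b}"]) auto

lemma primitive_increment:
  assumes "primitive a b F f" "a \<le> x" "x \<le> y" "y \<le> b"
  shows "F y - F x = (LINT t:{x..y}|lborel. f t)"
proof -
  have "(LINT t:{a..y}|lborel. f t) = (LINT t:{a..x}|lborel. f t) + (LINT t:{x..y}|lborel. f t)"
  proof -
    have i: "f integrable_on {a..y}"
      using primitive_integrable[OF assms(1), of a y] assms set_borel_integral_eq_integral(1) by auto
    show ?thesis
      using primitive_integrable[OF assms(1)] assms
      by (simp add: set_borel_integral_eq_integral(2) Henstock_Kurzweil_Integration.integral_combine[OF _ _ i])
  qed
  moreover have "F y - F a = (LINT t:{a..y}|lborel. f t)" "F x - F a = (LINT t:{a..x}|lborel. f t)"
    using assms unfolding primitive_def by auto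
  ultimately show ?thesis by linarith
qed

lemma primitive_subinterval:
  assumes "primitive a b F f" "a \<le> x" "y \<le> b"
  shows "primitive x y F f"
  unfolding primitive_def
  using primitive_integrable[OF assms] primitive_increment[OF assms(1), of x] assms by fastforce

lemma primitive_continuous:
  assumes "primitive a b F f"
  shows "continuous_on {a..b} F"
proof -
  have "continuous_on {a..b} (\<lambda>x. F a + integral {a..x} f)"
    by (intro continuous_intros indefinite_integral_continuous_1)
       (use assms set_borel_integral_eq_integral(1) in \<open>auto simp: primitive_def\<close>)
  moreover have "F a + integral {a..x} f = F x" if "x \<in> {a..b}" for x
  proof -
    have "F x - F a = (LINT t:{a..x}|lborel. f t)" using primitive_increment[OF assms, of a x] that by simp
    moreover have "(LINT t:{a..x}|lborel. f t) = integral {a..x} f"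
      using primitive_integrable[OF assms, of a x] that by (intro set_borel_integral_eq_integral(2)) auto
    ultimately show ?thesis by linarith
  qed
  ultimately show ?thesis by (rule continuous_on_eq)
qed

lemma primitive_C1:
  assumes "\<And>x. x \<in> {a..b} \<Longrightarrow> (F has_real_derivative f x) (at x)" "continuous_on {a..b} f"
  shows "primitive a b F f"
  unfolding primitive_def
proof (intro conjI ballI)
  show i: "set_integrable lborel {a..b} f"
    by (rule borel_integrable_atLeastAtMost') (use assms in auto)
  fix x assume x: "x \<in> {a..b}"
  have "(LINT t:{a..x}|lborel. f t) = F x - F a"
    unfolding set_lebesgue_integral_def
    by (subst integral_FTC_Icc[of a x F f])
       (use x assms in \<open>auto intro: continuous_on_subset has_field_derivative_at_within simp: has_real_derivative_iff_has_vector_derivative[symmetric]\<close>)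
  then show "F x - F a = (LINT t:{a..x}|lborel. f t)" by simp
qed

lemma set_integrable_mult_continuous:
  fixes f g :: "real \<Rightarrow> real"
  assumes f: "set_integrable lborel {a..b} f" and g: "continuous_on {a..b} g"
  shows "set_integrable lborel {a..b} (\<lambda>x. f x * g x)"
proof -
  have "compact (g ` {a..b})" using g by (intro compact_continuous_image) auto
  then obtain B where B: "\<And>x. x \<in> {a..b} \<Longrightarrow> norm (g x) \<le> B"
    using compact_imp_bounded bounded_iff by (metis imageI)
  have "integrable lborel (\<lambda>x. (indicator {a..b} x *\<^sub>R g x) * (indicator {a..b} x *\<^sub>R f x))"
  proof (rule Bochner_Integration.integrable_bound)
    show "integrable lborel (\<lambda>x. B * (indicator {a..b} x *\<^sub>R f x))"
      using f unfolding set_integrable_def by (rule integrable_mult_right)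
    have "(\<lambda>x. indicator {a..b} x *\<^sub>R g x) \<in> borel_measurable borel"
      by (intro borel_measurable_continuous_on_indicator g) auto
    then show "(\<lambda>x. (indicator {a..b} x *\<^sub>R g x) * (indicator {a..b} x *\<^sub>R f x)) \<in> borel_measurable lborel"
      using f unfolding set_integrable_def by (intro borel_measurable_times) auto
    show "AE x in lborel. norm ((indicator {a..b} x *\<^sub>R g x) * (indicator {a..b} x *\<^sub>R f x)) \<le> norm (B * (indicator {a..b} x *\<^sub>R f x))"
    proof (rule AE_I2)
      fix x show "norm ((indicator {a..b} x *\<^sub>R g x) * (indicator {a..b} x *\<^sub>R f x)) \<le> norm (B * (indicator {a..b} x *\<^sub>R f x))"
        using B[of x] abs_ge_self[of B] by (auto simp: indicator_def abs_mult intro!: mult_right_mono)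
    qed
  qed
  then show ?thesis unfolding set_integrable_def
    by (rule Bochner_Integration.integrable_cong[THEN iffD1, rotated 2]) (auto simp: indicator_def)
qed

text \<open>Product rule for indefinite integrals. The product \<open>(F x - F a) (G x - G a)\<close> is the
  integral of \<open>f(s) g(u)\<close> over a square; Fubini on the two triangles \<open>u \<le> s\<close> and \<open>s < u\<close> gives
  the two terms.\<close>

lemma primitive_mult:
  assumes F: "primitive a b F f" and G: "primitive a b G g"
  shows "primitive a b (\<lambda>x. F x * G x) (\<lambda>x. f x * G x + F x * g x)"
  unfolding primitive_def
proof (intro conjI ballI)
  have cF: "continuous_on {a..b} F" and cG: "continuous_on {a..b} G"
    using F G by (auto intro: primitive_continuous)
  have i1: "set_integrable lborel {a..b} (\<lambda>x. f x * G x)"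
    using F cG by (intro set_integrable_mult_continuous) (auto simp: primitive_def)
  have "set_integrable lborel {a..b} (\<lambda>x. g x * F x)"
    using G cF by (intro set_integrable_mult_continuous) (auto simp: primitive_def)
  then have i2: "set_integrable lborel {a..b} (\<lambda>x. F x * g x)" by (simp add: mult.commute)
  show "set_integrable lborel {a..b} (\<lambda>x. f x * G x + F x * g x)"
    by (rule set_integral_add) (rule i1 i2)+
  fix x assume x: "x \<in> {a..b}"
  define f' where "f' t = indicator {a..x} t * f t" for t
  define g' where "g' t = indicator {a..x} t * g t" for t
  have f': "integrable lborel f'" and g': "integrable lborel g'"
    using primitive_integrable[OF F, of a x] primitive_integrable[OF G, of a x] x
    by (auto simp: set_integrable_def f'_def[abs_def] g'_def[abs_def])
  note [measurable] = borel_measurable_integrable[OF f'] borel_measurable_integrable[OF g']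
  have Fx: "(LINT u|lborel. indicator {..t} u * f' u) = F t - F a" if "t \<in> {a..x}" for t
  proof -
    have "(LINT u:{a..t}|lborel. f u) = (LINT u|lborel. indicator {..t} u * f' u)"
      unfolding set_lebesgue_integral_def
      by (rule Bochner_Integration.integral_cong) (use that in \<open>auto simp: f'_def indicator_def\<close>)
    then show ?thesis using primitive_increment[OF F, of a t] that x by simp
  qed
  have Gx: "(LINT u|lborel. indicator {..t} u * g' u) = G t - G a" if "t \<in> {a..x}" for t
  proof -
    have "(LINT u:{a..t}|lborel. g u) = (LINT u|lborel. indicator {..t} u * g' u)"
      unfolding set_lebesgue_integral_def
      by (rule Bochner_Integration.integral_cong) (use that in \<open>auto simp: g'_def indicator_def\<close>)
    then show ?thesis using primitive_increment[OF G, of a t] that x by simp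
  qed
  have prod: "integrable (lborel \<Otimes>\<^sub>M lborel) (\<lambda>(s, u). f' s * g' u)"
  proof (rule lborel_pair.Fubini_integrable)
    show "integrable lborel (\<lambda>s. LINT u|lborel. norm (case (s, u) of (s, u) \<Rightarrow> f' s * g' u))"
      using f' g' by (simp add: abs_mult)
    show "AE s in lborel. integrable lborel (\<lambda>u. case (s, u) of (s, u) \<Rightarrow> f' s * g' u)"
      using g' by simp
  qed measurable
  have m1: "integrable (lborel \<Otimes>\<^sub>M lborel) (\<lambda>(s, u). f' s * (indicator {..s} u * g' u))"
    by (rule Bochner_Integration.integrable_bound[OF prod])
       (measurable, auto simp: indicator_def abs_mult)
  have m2: "integrable (lborel \<Otimes>\<^sub>M lborel) (\<lambda>(s, u). (indicator {..<u} s * f' s) * g' u)"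
    by (rule Bochner_Integration.integrable_bound[OF prod])
       (measurable, auto simp: indicator_def abs_mult)
  have lt: "(LINT s|lborel. indicator {..<u} s * f' s) = (LINT s|lborel. indicator {..u} s * f' s)" for u
    by (rule integral_cong_AE) (use AE_lborel_singleton[of u] in \<open>auto simp: indicator_def\<close>)
  have "(LINT s|lborel. f' s) * (LINT u|lborel. g' u) = (LINT s|lborel. LINT u|lborel. f' s * g' u)" by simp
  also have "\<dots> = (LINT p|(lborel \<Otimes>\<^sub>M lborel). (case p of (s, u) \<Rightarrow> f' s * g' u))"
    by (rule lborel_pair.integral_fst[OF prod])
  also have "\<dots> = (LINT p|(lborel \<Otimes>\<^sub>M lborel). (case p of (s, u) \<Rightarrow> f' s * (indicator {..s} u * g' u)) +
      (case p of (s, u) \<Rightarrow> (indicator {..<u} s * f' s) * g' u))"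
    by (rule Bochner_Integration.integral_cong) (auto simp: indicator_def)
  also have "\<dots> = (LINT p|(lborel \<Otimes>\<^sub>M lborel). (case p of (s, u) \<Rightarrow> f' s * (indicator {..s} u * g' u))) +
      (LINT p|(lborel \<Otimes>\<^sub>M lborel). (case p of (s, u) \<Rightarrow> (indicator {..<u} s * f' s) * g' u))"
    by (rule Bochner_Integration.integral_add[OF m1 m2])
  also have "(LINT p|(lborel \<Otimes>\<^sub>M lborel). (case p of (s, u) \<Rightarrow> f' s * (indicator {..s} u * g' u))) =
      (LINT s|lborel. f' s * (LINT u|lborel. indicator {..s} u * g' u))"
    by (subst lborel_pair.integral_fst[OF m1, symmetric]) simp
  also have "\<dots> = (LINT t:{a..x}|lborel. f t * G t - f t * G a)"
    unfolding set_lebesgue_integral_def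
    by (rule Bochner_Integration.integral_cong) (auto simp: Gx f'_def right_diff_distrib split: split_indicator)
  also have "(LINT p|(lborel \<Otimes>\<^sub>M lborel). (case p of (s, u) \<Rightarrow> (indicator {..<u} s * f' s) * g' u)) =
      (LINT u|lborel. (LINT s|lborel. indicator {..u} s * f' s) * g' u)"
    by (subst lborel_pair.integral_snd[OF m2, symmetric]) (simp add: lt)
  also have "\<dots> =
      (LINT t:{a..x}|lborel. F t * g t - F a * g t)"
    unfolding set_lebesgue_integral_def
    by (rule Bochner_Integration.integral_cong) (auto simp: Fx g'_def left_diff_distrib split: split_indicator)
  also have "(LINT t:{a..x}|lborel. f t * G t - f t * G a) = (LINT t:{a..x}|lborel. f t * G t) - (F x - F a) * G a"
    using primitive_increment[OF F, of a x] x primitive_integrable[OF F, of a x]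
      set_integrable_subset[OF i1, of "{a..x}"]
    by (subst set_integral_diff) (auto)
  also have "(LINT t:{a..x}|lborel. F t * g t - F a * g t) = (LINT t:{a..x}|lborel. F t * g t) - F a * (G x - G a)"
    using primitive_increment[OF G, of a x] x primitive_integrable[OF G, of a x]
      set_integrable_subset[OF i2, of "{a..x}"]
    by (subst set_integral_diff) (auto)
  also have "(LINT s|lborel. f' s) = F x - F a"
    using primitive_increment[OF F, of a x] x by (simp add: f'_def set_lebesgue_integral_def)
  also have "(LINT s|lborel. g' s) = G x - G a"
    using primitive_increment[OF G, of a x] x by (simp add: g'_def set_lebesgue_integral_def)
  finally have "F x * G x - F a * G a = (LINT t:{a..x}|lborel. f t * G t) + (LINT t:{a..x}|lborel. F t * g t)"
    by (simp add: algebra_simps)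
  also have "\<dots> = (LINT t:{a..x}|lborel. f t * G t + F t * g t)"
    using set_integrable_subset[OF i1, of "{a..x}"] set_integrable_subset[OF i2, of "{a..x}"] x
    by (subst set_integral_add) auto
  finally show "F x * G x - F a * G a = (LINT t:{a..x}|lborel. f t * G t + F t * g t)" by simp
qed

lemma set_integral_split:
  fixes f :: "real \<Rightarrow> real"
  assumes "set_integrable lborel {a..c} f" "a \<le> b" "b \<le> c"
  shows "(LINT t:{a..c}|lborel. f t) = (LINT t:{a..b}|lborel. f t) + (LINT t:{b..c}|lborel. f t)"
proof -
  have "(LINT t:{a..a}|lborel. f t) = 0" unfolding set_lebesgue_integral_def
    by (rule integral_eq_zero_AE, rule AE_mp[OF AE_lborel_singleton[of a]]) (auto simp: indicator_def)
  then have "primitive a c (\<lambda>x. LINT t:{a..x}|lborel. f t) f"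
    using assms unfolding primitive_def by simp
  from primitive_increment[OF this, of b c] assms show ?thesis by simp
qed

lemma primitive_Cauchy_Schwarz:
  assumes F: "primitive a b F f" and f2: "set_integrable lborel {a..b} (\<lambda>x. (f x)\<^sup>2)"
    and "a \<le> x" "x \<le> y" "y \<le> b"
  shows "(F y - F x)\<^sup>2 \<le> (y - x) * (LINT t:{x..y}|lborel. (f t)\<^sup>2)"
proof (cases "x = y")
  case False
  define m where "m = (F y - F x) / (y - x)"
  have i: "set_integrable lborel {x..y} f" "set_integrable lborel {x..y} (\<lambda>x. (f x)\<^sup>2)"
    using primitive_integrable[OF F] set_integrable_subset[OF f2] assms by auto
  have "0 \<le> (LINT t:{x..y}|lborel. (f t - m)\<^sup>2)"
    by (simp add: set_lebesgue_integral_def)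
  also have "\<dots> = (LINT t:{x..y}|lborel. (f t)\<^sup>2 - 2 * m * f t + m\<^sup>2)"
    by (simp add: power2_diff algebra_simps)
  also have "\<dots> = (LINT t:{x..y}|lborel. (f t)\<^sup>2) - 2 * m * (F y - F x) + m\<^sup>2 * (y - x)"
  proof -
    have c: "set_integrable lborel {x..y} (\<lambda>t. m\<^sup>2)"
      by (intro borel_integrable_atLeastAtMost' continuous_intros)
    have "set_integrable lborel {x..y} (\<lambda>t. 2 * m * f t)" using i(1) by simp
    moreover have "(LINT t:{x..y}|lborel. m\<^sup>2) = m\<^sup>2 * (y - x)"
      using assms by (simp add: set_lebesgue_integral_def)
    ultimately show ?thesis
      using i(2) c primitive_increment[OF F assms(3-5)]
      by (simp add: set_integral_add set_integral_diff)
  qed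
  finally have "0 \<le> (LINT t:{x..y}|lborel. (f t)\<^sup>2) - 2 * m * (F y - F x) + m\<^sup>2 * (y - x)" .
  moreover have h: "y - x > 0" using False assms by simp
  moreover have "F y - F x = m * (y - x)" using h by (simp add: m_def)
  moreover from this have "(F y - F x)\<^sup>2 = (y - x) * (m\<^sup>2 * (y - x))" by (simp add: power2_eq_square)
  ultimately have "m\<^sup>2 * (y - x) \<le> (LINT t:{x..y}|lborel. (f t)\<^sup>2)"
    by (simp add: power2_eq_square)
  from mult_left_mono[OF this, of "y - x"] h show ?thesis
    using \<open>(F y - F x)\<^sup>2 = (y - x) * (m\<^sup>2 * (y - x))\<close> by simp
qed (simp add: assms)

section \<open>Picone inequality up to the nodes\<close>

text \<open>With \<open>r = p u'/u\<close> the Riccati equation \<open>r' = - l p - r\<^sup>2/p\<close> holds, and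
  \<open>p g\<^sup>2 - l p A\<^sup>2 - (r A\<^sup>2)' = p (g - (u'/u) A)\<^sup>2 \<ge> 0\<close>. Integrate; the product rule for
  indefinite integrals provides \<open>(r A\<^sup>2)'\<close>.\<close>

lemma picone_regular:
  assumes xy: "x \<le> y"
    and p: "continuous_on {x..y} p" "\<And>s. s \<in> {x..y} \<Longrightarrow> p s > 0"
    and u: "\<And>s. s \<in> {x..y} \<Longrightarrow> (u has_real_derivative du s) (at s)"
      "\<And>s. s \<in> {x..y} \<Longrightarrow> ((\<lambda>s. p s * du s) has_real_derivative - l * p s * u s) (at s)"
      "continuous_on {x..y} du" "\<And>s. s \<in> {x..y} \<Longrightarrow> u s \<noteq> 0"
    and A: "primitive x y A g" and g2: "set_integrable lborel {x..y} (\<lambda>s. p s * (g s)\<^sup>2)"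
  shows "p y * du y / u y * (A y)\<^sup>2 - p x * du x / u x * (A x)\<^sup>2
    \<le> (LINT s:{x..y}|lborel. p s * (g s)\<^sup>2 - l * (p s * (A s)\<^sup>2))"
proof -
  define r where "r s = p s * du s / u s" for s
  define r' where "r' s = - l * p s - p s * (du s)\<^sup>2 / (u s)\<^sup>2" for s
  have cu: "continuous_on {x..y} u"
    by (intro continuous_at_imp_continuous_on ballI DERIV_isCont[OF u(1)])
  have r: "primitive x y r r'"
  proof (rule primitive_C1)
    show "(r has_real_derivative r' s) (at s)" if "s \<in> {x..y}" for s
      unfolding r_def[abs_def]
      by (rule DERIV_cong[OF DERIV_divide[OF u(2)[OF that] u(1)[OF that] u(4)[OF that]]])
         (use u(4)[OF that] in \<open>simp add: r'_def field_simps power2_eq_square\<close>)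
    show "continuous_on {x..y} r'"
      unfolding r'_def[abs_def] by (intro continuous_intros p u(3) cu) (use u(4) in auto)
  qed
  have cA: "continuous_on {x..y} A" using A by (rule primitive_continuous)
  let ?w = "\<lambda>s. r' s * (A s * A s) + r s * (g s * A s + A s * g s)"
  have P: "primitive x y (\<lambda>s. r s * (A s * A s)) ?w"
    by (intro primitive_mult r A)
  have "(LINT s:{x..y}|lborel. ?w s) \<le> (LINT s:{x..y}|lborel. p s * (g s)\<^sup>2 - l * (p s * (A s)\<^sup>2))"
  proof (rule set_integral_mono)
    show "set_integrable lborel {x..y} ?w" using P by (simp add: primitive_def)
    have "set_integrable lborel {x..y} (\<lambda>s. l * (p s * (A s)\<^sup>2))"
      by (intro borel_integrable_atLeastAtMost' continuous_intros p cA)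
    then show "set_integrable lborel {x..y} (\<lambda>s. p s * (g s)\<^sup>2 - l * (p s * (A s)\<^sup>2))"
      by (rule set_integral_diff(1)[OF g2])
    fix s assume s: "s \<in> {x..y}"
    have "p s * (g s)\<^sup>2 - l * (p s * (A s)\<^sup>2) - ?w s = p s * (g s - du s / u s * A s)\<^sup>2"
      using u(4)[OF s] by (simp add: r_def r'_def power2_eq_square) (simp add: field_simps)
    moreover have "0 \<le> p s * (g s - du s / u s * A s)\<^sup>2" using p(2)[OF s] by simp
    ultimately show "?w s \<le> p s * (g s)\<^sup>2 - l * (p s * (A s)\<^sup>2)" by linarith
  qed
  then show ?thesis
    using primitive_increment[OF P, of x y] xy by (simp add: r_def power2_eq_square)
qed

text \<open>At a simple zero \<open>c\<close> of \<open>u\<close> the factor \<open>u'/u\<close> blows up like \<open>1/(x - c)\<close>, while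
  Cauchy-Schwarz gives \<open>A(x)\<^sup>2 \<le> |x - c| |\<integral>\<^sub>c\<^sup>x g\<^sup>2|\<close>, and the last integral tends to \<open>0\<close>.\<close>

lemma node_boundary_term:
  assumes F: "F = at_right c \<or> F = at_left c" and nb: "eventually (\<lambda>x. x \<in> {a..b}) F" and c: "c \<in> {a..b}"
    and p: "continuous_on {a..b} p" and du: "continuous_on {a..b} du"
    and u: "(u has_real_derivative du c) (at c)" "u c = 0" "du c \<noteq> 0"
    and A: "primitive a b A g" "A c = 0" and g2: "set_integrable lborel {a..b} (\<lambda>x. (g x)\<^sup>2)"
  shows "((\<lambda>x. p x * du x / u x * (A x)\<^sup>2) \<longlongrightarrow> 0) F"
proof -
  have le: "F \<le> at c within {a..b}"
  proof -
    have ne: "eventually (\<lambda>x. x \<noteq> c) F" using F by (auto simp: eventually_at_filter)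
    have "F \<le> nhds c" using F by (auto simp: at_within_def)
    moreover have "eventually (\<lambda>x. x \<in> {a..b} - {c}) F" using nb ne by eventually_elim simp
    ultimately show ?thesis by (simp add: at_within_def le_principal)
  qed
  have le': "F \<le> at c" by (rule order_trans[OF le]) (simp add: at_le)
  define G where "G x = (LINT t:{a..x}|lborel. (g t)\<^sup>2)" for x
  have "(LINT t:{a..a}|lborel. (g t)\<^sup>2) = 0" unfolding set_lebesgue_integral_def
    by (rule integral_eq_zero_AE, rule AE_mp[OF AE_lborel_singleton[of a]]) (auto simp: indicator_def)
  then have G: "primitive a b G (\<lambda>t. (g t)\<^sup>2)"
    using g2 unfolding primitive_def G_def by simp
  have Gc: "(G \<longlongrightarrow> G c) F"
    using primitive_continuous[OF G] c le by (auto simp: continuous_on_def intro: tendsto_mono)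
  have pdu: "((\<lambda>x. p x * du x) \<longlongrightarrow> p c * du c) F"
    using continuous_on_mult[OF p du] c le by (auto simp: continuous_on_def intro: tendsto_mono)
  have "((\<lambda>x. (u x - u c) / (x - c)) \<longlongrightarrow> du c) F"
    using u(1) le' unfolding has_field_derivative_iff by (rule tendsto_mono[rotated])
  from tendsto_inverse[OF this u(3)]
  have q: "((\<lambda>x. (x - c) / u x) \<longlongrightarrow> inverse (du c)) F" using u(2) by simp
  have A2: "((\<lambda>x. (A x)\<^sup>2 / (x - c)) \<longlongrightarrow> 0) F"
  proof (rule Lim_null_comparison)
    show "((\<lambda>x. \<bar>G x - G c\<bar>) \<longlongrightarrow> 0) F"
      using tendsto_rabs[OF tendsto_diff[OF Gc tendsto_const[of "G c"]]] by simp
    have ne: "eventually (\<lambda>x. x \<noteq> c) F"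
      using le' by (rule filter_leD) (simp add: eventually_at_filter)
    show "eventually (\<lambda>x. norm ((A x)\<^sup>2 / (x - c)) \<le> \<bar>G x - G c\<bar>) F"
      using nb ne
    proof eventually_elim
      case (elim x)
      have "(A x)\<^sup>2 \<le> \<bar>x - c\<bar> * \<bar>G x - G c\<bar>"
      proof (cases "c \<le> x")
        case True
        then show ?thesis
          using primitive_Cauchy_Schwarz[OF A(1) g2, of c x] primitive_increment[OF G, of c x] elim c A(2)
          by (simp) (smt (verit) mult_left_mono)
      next
        case False
        then show ?thesis
          using primitive_Cauchy_Schwarz[OF A(1) g2, of x c] primitive_increment[OF G, of x c] elim c A(2)
          by (simp) (smt (verit) mult_left_mono)
      qed
      then show ?case using elim by (simp add: divide_le_eq mult.commute)
    qed
  qed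
  have "((\<lambda>x. (p x * du x) * ((x - c) / u x) * ((A x)\<^sup>2 / (x - c))) \<longlongrightarrow> (p c * du c) * inverse (du c) * 0) F"
    by (intro tendsto_mult pdu q A2)
  moreover have "eventually (\<lambda>x. (p x * du x) * ((x - c) / u x) * ((A x)\<^sup>2 / (x - c)) = p x * du x / u x * (A x)\<^sup>2) F"
    using le' by (rule filter_leD) (auto simp: eventually_at_filter)
  ultimately have "((\<lambda>x. p x * du x / u x * (A x)\<^sup>2) \<longlongrightarrow> (p c * du c) * inverse (du c) * 0) F"
    by (rule Lim_transform_eventually)
  then show ?thesis by simp
qed

text \<open>Apply \<open>picone_regular\<close> on \<open>[x, y]\<close> inside \<open>(a, b)\<close> and let \<open>x\<close>, \<open>y\<close> tend to the end
  points. Each boundary term either tends to \<open>0\<close> (at a node where \<open>A\<close> vanishes) or has the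
  favorable sign.\<close>

lemma picone_nodal:
  assumes ab: "a < b"
    and p: "continuous_on {a..b} p" "\<And>s. s \<in> {a..b} \<Longrightarrow> p s > 0"
    and u: "\<And>s. s \<in> {a..b} \<Longrightarrow> (u has_real_derivative du s) (at s)"
      "\<And>s. s \<in> {a..b} \<Longrightarrow> ((\<lambda>s. p s * du s) has_real_derivative - l * p s * u s) (at s)"
      "continuous_on {a..b} du" "\<And>s. a < s \<Longrightarrow> s < b \<Longrightarrow> u s \<noteq> 0"
    and A: "primitive a b A g" and g2: "set_integrable lborel {a..b} (\<lambda>s. (g s)\<^sup>2)"
    and left: "u a = 0 \<and> du a \<noteq> 0 \<and> A a = 0 \<or> u a \<noteq> 0 \<and> du a / u a \<le> 0"
    and right: "u b = 0 \<and> du b \<noteq> 0 \<and> A b = 0 \<or> u b \<noteq> 0 \<and> du b / u b \<ge> 0"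
  shows "0 \<le> (LINT s:{a..b}|lborel. p s * (g s)\<^sup>2 - l * (p s * (A s)\<^sup>2))"
proof -
  define R where "R x = p x * du x / u x * (A x)\<^sup>2" for x
  define W where "W s = p s * (g s)\<^sup>2 - l * (p s * (A s)\<^sup>2)" for s
  define \<Phi> where "\<Phi> x = (LINT s:{a..x}|lborel. W s)" for x
  have cu: "continuous_on {a..b} u"
    by (intro continuous_at_imp_continuous_on ballI DERIV_isCont[OF u(1)])
  have cA: "continuous_on {a..b} A" using A by (rule primitive_continuous)
  have pg2: "set_integrable lborel {a..b} (\<lambda>s. p s * (g s)\<^sup>2)"
    using set_integrable_mult_continuous[OF g2 p(1)] by (simp add: mult.commute)
  have "set_integrable lborel {a..b} (\<lambda>s. l * (p s * (A s)\<^sup>2))"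
    by (intro borel_integrable_atLeastAtMost' continuous_intros p cA)
  then have W: "set_integrable lborel {a..b} W"
    unfolding W_def by (rule set_integral_diff(1)[OF pg2])
  have \<Phi>a: "\<Phi> a = 0" unfolding set_lebesgue_integral_def \<Phi>_def
    by (rule integral_eq_zero_AE, rule AE_mp[OF AE_lborel_singleton[of a]]) (auto simp: indicator_def)
  then have P: "primitive a b \<Phi> W" using W unfolding primitive_def \<Phi>_def by simp
  have inc: "R y - R x \<le> \<Phi> y - \<Phi> x" if "a < x" "x < y" "y < b" for x y
  proof -
    have sub: "{x..y} \<subseteq> {a..b}" using that by auto
    have "R y - R x \<le> (LINT s:{x..y}|lborel. W s)"
      unfolding R_def W_def
      by (rule picone_regular[where u = u and du = du and p = p])
         (use that sub p u A primitive_subinterval[OF A, of x y] in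
           \<open>auto intro: continuous_on_subset[OF _ sub] set_integrable_subset[OF pg2]\<close>)
    then show ?thesis using primitive_increment[OF P, of x y] that by simp
  qed
  have nr: "eventually (\<lambda>x. a < x \<and> x < b) (at_right a)" and nl: "eventually (\<lambda>x. a < x \<and> x < b) (at_left b)"
    using ab by (auto simp: eventually_at_right_field eventually_at_left_field)
  have ar: "at a within {a..b} = at_right a" and al: "at b within {a..b} = at_left b"
    using ab by (auto simp: at_within_Icc_at_right at_within_Icc_at_left)
  have Rl: "\<exists>L\<le>0. (R \<longlongrightarrow> L) (at_right a)"
  proof (cases "u a = 0")
    case True
    have "(R \<longlongrightarrow> 0) (at_right a)" unfolding R_def[abs_def]
      by (rule node_boundary_term[where a = a and b = b and g = g])
         (use True left p u A g2 ab nr in \<open>auto elim: eventually_mono\<close>)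
    then show ?thesis by auto
  next
    case False
    have "(R \<longlongrightarrow> R a) (at_right a)" unfolding R_def[abs_def] ar[symmetric]
      by (intro tendsto_intros) (use False p(1) u(3) cu cA ab in \<open>auto simp: continuous_on_def\<close>)
    moreover have "R a \<le> 0"
    proof -
      have "p a * (du a / u a) \<le> 0" using False left p(2)[of a] ab by (intro mult_nonneg_nonpos) auto
      from mult_nonpos_nonneg[OF this, of "(A a)\<^sup>2"] show ?thesis by (simp add: R_def)
    qed
    ultimately show ?thesis by auto
  qed
  have Rr: "\<exists>L\<ge>0. (R \<longlongrightarrow> L) (at_left b)"
  proof (cases "u b = 0")
    case True
    have "(R \<longlongrightarrow> 0) (at_left b)" unfolding R_def[abs_def]
      by (rule node_boundary_term[where a = a and b = b and g = g])
         (use True right p u A g2 ab nl in \<open>auto elim: eventually_mono\<close>)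
    then show ?thesis by auto
  next
    case False
    have "(R \<longlongrightarrow> R b) (at_left b)" unfolding R_def[abs_def] al[symmetric]
      by (intro tendsto_intros) (use False p(1) u(3) cu cA ab in \<open>auto simp: continuous_on_def\<close>)
    moreover have "R b \<ge> 0"
    proof -
      have "0 \<le> p b * (du b / u b)" using False right p(2)[of b] ab by (intro mult_nonneg_nonneg) auto
      from mult_nonneg_nonneg[OF this, of "(A b)\<^sup>2"] show ?thesis by (simp add: R_def)
    qed
    ultimately show ?thesis by auto
  qed
  obtain L0 L1 where L: "L0 \<le> 0" "(R \<longlongrightarrow> L0) (at_right a)" "L1 \<ge> 0" "(R \<longlongrightarrow> L1) (at_left b)"
    using Rl Rr by auto
  have cont: "continuous_on {a..b} \<Phi>" using P by (rule primitive_continuous)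
  have \<Phi>l: "(\<Phi> \<longlongrightarrow> \<Phi> a) (at_right a)" "(\<Phi> \<longlongrightarrow> \<Phi> b) (at_left b)"
    using cont ab unfolding ar[symmetric] al[symmetric] by (auto simp: continuous_on_def)
  have step: "R y - L0 \<le> \<Phi> y - \<Phi> a" if y: "a < y" "y < b" for y
  proof (rule tendsto_le)
    show "((\<lambda>x. \<Phi> y - \<Phi> x) \<longlongrightarrow> \<Phi> y - \<Phi> a) (at_right a)" "((\<lambda>x. R y - R x) \<longlongrightarrow> R y - L0) (at_right a)"
      by (intro tendsto_intros \<Phi>l L)+
    have "eventually (\<lambda>x. a < x \<and> x < y) (at_right a)" using y by (auto simp: eventually_at_right_field)
    then show "eventually (\<lambda>x. R y - R x \<le> \<Phi> y - \<Phi> x) (at_right a)"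
      by eventually_elim (use inc y in auto)
  qed simp
  have "L1 - L0 \<le> \<Phi> b - \<Phi> a"
  proof (rule tendsto_le)
    show "((\<lambda>y. \<Phi> y - \<Phi> a) \<longlongrightarrow> \<Phi> b - \<Phi> a) (at_left b)" "((\<lambda>y. R y - L0) \<longlongrightarrow> L1 - L0) (at_left b)"
      by (intro tendsto_intros \<Phi>l L)+
    show "eventually (\<lambda>y. R y - L0 \<le> \<Phi> y - \<Phi> a) (at_left b)"
      using nl by eventually_elim (use step in auto)
  qed simp
  then show ?thesis using L \<Phi>a by (simp add: \<Phi>_def W_def)
qed

text \<open>Picone with \<open>u = cos (\<pi> s)\<close> on each half of the interval, whose common end point is the
  only zero of \<open>u\<close>. Subtracting the value of \<open>A\<close> at that point, rather than its mean, makes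
  the boundary term vanish.\<close>

lemma poincare_interval:
  assumes A: "primitive 0 1 A g" and g2: "set_integrable lborel {0..1} (\<lambda>s. (g s)\<^sup>2)"
  shows "pi\<^sup>2 * (LINT s:{0..1}|lborel. (A s - A (1/2))\<^sup>2) \<le> (LINT s:{0..1}|lborel. (g s)\<^sup>2)"
proof -
  define B where "B s = A s - A (1/2)" for s
  have B: "primitive 0 1 B g" using A by (simp add: primitive_def B_def)
  define u where "u s = cos (pi * s)" for s
  define du where "du s = - pi * sin (pi * s)" for s
  have u: "(u has_real_derivative du s) (at s)" "(du has_real_derivative - pi\<^sup>2 * u s) (at s)" for s
    unfolding u_def du_def by (auto intro!: derivative_eq_intros simp: power2_eq_square)
  have cdu: "continuous_on S du" for S unfolding du_def by (intro continuous_intros)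
  have pos: "u s > 0" if "0 < s" "s < 1/2" for s
    unfolding u_def by (rule cos_gt_zero) (use that in auto)
  have neg: "u s < 0" if "1/2 < s" "s < 1" for s
  proof -
    have "0 < cos (pi * (1 - s))" by (rule cos_gt_zero) (use that in auto)
    also have "cos (pi * (1 - s)) = - u s" by (simp add: u_def right_diff_distrib)
    finally show ?thesis by simp
  qed
  have Bh: "B (1/2) = 0" by (simp add: B_def)
  have uv: "u 0 = 1" "u 1 = -1" "u (1/2) = 0" "du 0 = 0" "du 1 = 0" "du (1/2) = - pi"
    by (simp_all add: u_def du_def)
  have "0 \<le> (LINT s:{0..1/2}|lborel. 1 * (g s)\<^sup>2 - pi\<^sup>2 * (1 * (B s)\<^sup>2))"
    by (rule picone_nodal[where u = u and du = du])
       (use u pos uv Bh primitive_subinterval[OF B, of 0 "1/2"] set_integrable_subset[OF g2, of "{0..1/2}"] cdu in force)+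
  moreover have "0 \<le> (LINT s:{1/2..1}|lborel. 1 * (g s)\<^sup>2 - pi\<^sup>2 * (1 * (B s)\<^sup>2))"
    by (rule picone_nodal[where u = u and du = du])
       (use u neg uv Bh primitive_subinterval[OF B, of "1/2" 1] set_integrable_subset[OF g2, of "{1/2..1}"] cdu in force)+
  moreover have B2: "set_integrable lborel {0..1} (\<lambda>s. pi\<^sup>2 * (B s)\<^sup>2)"
    by (intro borel_integrable_atLeastAtMost' continuous_intros primitive_continuous[OF B])
  moreover have "(LINT s:{0..1}|lborel. (g s)\<^sup>2 - pi\<^sup>2 * (B s)\<^sup>2) =
      (LINT s:{0..1/2}|lborel. (g s)\<^sup>2 - pi\<^sup>2 * (B s)\<^sup>2) + (LINT s:{1/2..1}|lborel. (g s)\<^sup>2 - pi\<^sup>2 * (B s)\<^sup>2)"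
    by (rule set_integral_split) (use set_integral_diff(1)[OF g2 B2] in auto)
  ultimately have "0 \<le> (LINT s:{0..1}|lborel. (g s)\<^sup>2 - pi\<^sup>2 * (B s)\<^sup>2)" by simp
  then show ?thesis using g2 B2 by (simp add: set_integral_diff B_def)
qed

text \<open>The nodes cut \<open>[d, 1]\<close> into intervals on which \<open>u = J\<^sub>0(z s)\<close> has no zero; on each of
  them Picone applies with weight \<open>p = s\<close>. At \<open>s = 1\<close> the boundary term is \<open>0\<close> because
  \<open>u'(1) = 0\<close>, and at \<open>s = d\<close> it has the right sign once \<open>d\<close> is so small that \<open>u > 0 > u'\<close>
  there.\<close>

lemma radial_nodal:
  assumes z: "z > 0" "rad1 z 1 = 0"
    and A: "\<And>d. 0 < d \<Longrightarrow> d < 1 \<Longrightarrow> primitive d 1 A g"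
    and g2: "\<And>d. 0 < d \<Longrightarrow> d < 1 \<Longrightarrow> set_integrable lborel {d..1} (\<lambda>s. (g s)\<^sup>2)"
    and nodes: "\<And>s. s \<in> nodes z \<Longrightarrow> A s = 0"
    and fin: "finite (nodes z)"
  shows "\<exists>e>0. \<forall>d. 0 < d \<and> d < e \<longrightarrow> 0 \<le> (LINT s:{d..1}|lborel. s * (g s)\<^sup>2 - z\<^sup>2 * (s * (A s)\<^sup>2))"
proof -
  obtain e where e: "e > 0" "\<And>s. 0 < s \<Longrightarrow> s < e \<Longrightarrow> rad z s > 0 \<and> rad1 z s < 0"
    using rad_near_0[of z] z by auto
  have u1: "rad z 1 \<noteq> 0" using rad_zero_simple[of 1 z] z by auto
  let ?W = "\<lambda>s. s * (g s)\<^sup>2 - z\<^sup>2 * (s * (A s)\<^sup>2)"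
  have main: "0 \<le> (LINT s:{d..1}|lborel. ?W s)" if d: "0 < d" "d < e" "d < 1" for d
  proof -
    note Ad = A[OF d(1,3)] and g2d = g2[OF d(1,3)]
    have W: "set_integrable lborel {d..1} ?W"
    proof (rule set_integral_diff(1))
      show "set_integrable lborel {d..1} (\<lambda>s. s * (g s)\<^sup>2)"
        using set_integrable_mult_continuous[OF g2d continuous_on_id] by (simp add: mult.commute)
      show "set_integrable lborel {d..1} (\<lambda>s. z\<^sup>2 * (s * (A s)\<^sup>2))"
        by (intro borel_integrable_atLeastAtMost' continuous_intros primitive_continuous[OF Ad])
    qed
    have piece: "0 \<le> (LINT s:{a..b}|lborel. ?W s)"
      if ab: "d \<le> a" "a < b" "b \<le> 1" and no: "\<And>s. a < s \<Longrightarrow> s < b \<Longrightarrow> rad z s \<noteq> 0"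
        and l: "a = d \<or> a \<in> nodes z" and r: "b = 1 \<or> b \<in> nodes z" for a b
    proof (rule picone_nodal[where u = "rad z" and du = "\<lambda>s. s * rad1 z s"])
      show "primitive a b A g" "set_integrable lborel {a..b} (\<lambda>s. (g s)\<^sup>2)"
        using primitive_subinterval[OF Ad, of a b] set_integrable_subset[OF g2d, of "{a..b}"] ab by auto
      show "rad z a = 0 \<and> a * rad1 z a \<noteq> 0 \<and> A a = 0 \<or> rad z a \<noteq> 0 \<and> a * rad1 z a / rad z a \<le> 0"
        using l
      proof
        assume "a = d" then show ?thesis using e(2)[of d] d by (auto intro!: divide_nonpos_pos mult_nonneg_nonpos)
      next
        assume a: "a \<in> nodes z" then show ?thesis using rad_zero_simple[of a z] nodes[OF a] by (auto simp: nodes_def)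
      qed
      show "rad z b = 0 \<and> b * rad1 z b \<noteq> 0 \<and> A b = 0 \<or> rad z b \<noteq> 0 \<and> b * rad1 z b / rad z b \<ge> 0"
        using r
      proof
        assume "b = 1" then show ?thesis using u1 z by simp
      next
        assume b: "b \<in> nodes z" then show ?thesis using rad_zero_simple[of b z] nodes[OF b] by (auto simp: nodes_def)
      qed
      show "((\<lambda>s. s * (s * rad1 z s)) has_real_derivative - z\<^sup>2 * s * rad z s) (at s)" for s
        using flux_deriv[of z s] by (simp add: mult.assoc)
    qed (use ab d no rad_deriv in \<open>auto intro!: continuous_intros rad1_continuous\<close>)
    have ind: "0 \<le> (LINT s:{d..b}|lborel. ?W s)" if "d < b" "b = 1 \<or> b \<in> nodes z" for b
      using that
    proof (induction "card {s \<in> nodes z. d < s \<and> s < b}" arbitrary: b rule: less_induct)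
      case less
      have b1: "b \<le> 1" using less.prems by (auto simp: nodes_def)
      let ?N = "{s \<in> nodes z. d < s \<and> s < b}"
      have finN: "finite ?N" using fin by simp
      show ?case
      proof (cases "?N = {}")
        case True
        show ?thesis
          by (rule piece) (use True less.prems b1 d in \<open>auto simp: nodes_def\<close>)
      next
        case False
        define c where "c = Max ?N"
        have c: "c \<in> ?N" unfolding c_def using finN False by (rule Max_in)
        have "{s \<in> nodes z. d < s \<and> s < c} \<subset> ?N" using c by auto
        then have "0 \<le> (LINT s:{d..c}|lborel. ?W s)"
          using c by (intro less.hyps psubset_card_mono[OF finN]) auto
        moreover have "0 \<le> (LINT s:{c..b}|lborel. ?W s)"
        proof (rule piece)
          show "rad z s \<noteq> 0" if "c < s" "s < b" for s
          proof
            assume "rad z s = 0"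
            then have "s \<in> ?N" using that c b1 d by (auto simp: nodes_def)
            then have "s \<le> c" unfolding c_def using finN by (intro Max_ge)
            then show False using that by simp
          qed
        qed (use c less.prems b1 in auto)
        moreover have "(LINT s:{d..b}|lborel. ?W s) = (LINT s:{d..c}|lborel. ?W s) + (LINT s:{c..b}|lborel. ?W s)"
          by (rule set_integral_split) (use c b1 in \<open>auto intro: set_integrable_subset[OF W]\<close>)
        ultimately show ?thesis by simp
      qed
    qed
    show ?thesis using ind[of 1] d by simp
  qed
  show ?thesis using e(1) main by (intro exI[of _ "min e 1"]) auto
qed

section \<open>Smooth functions of one variable\<close>

text \<open>A smooth function is carried around together with the sequence of its derivatives: \<open>X n\<close>
  is the \<open>n\<close>th derivative of \<open>X 0\<close>.\<close>

definition smooth_seq :: "(nat \<Rightarrow> real \<Rightarrow> real) \<Rightarrow> bool" where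
  "smooth_seq X \<longleftrightarrow> (\<forall>n x. (X n has_real_derivative X (Suc n) x) (at x))"

text \<open>For functions whose higher derivatives have no handy form, such as products, it suffices
  to exhibit a class that is closed under differentiation.\<close>

lemma smooth_seqI:
  assumes "\<And>f. f \<in> S \<Longrightarrow> \<exists>f'\<in>S. \<forall>x. (f has_real_derivative f' x) (at x)" "f \<in> S"
  shows "\<exists>X. X 0 = f \<and> smooth_seq X"
proof -
  obtain d where d: "\<And>f. f \<in> S \<Longrightarrow> d f \<in> S \<and> (\<forall>x. (f has_real_derivative d f x) (at x))"
    using assms(1) by metis
  have "(d ^^ n) f \<in> S" for n by (induction n) (use d assms(2) in auto)
  then have "smooth_seq (\<lambda>n. (d ^^ n) f)" using d by (simp add: smooth_seq_def)
  then show ?thesis by (intro exI[of _ "\<lambda>n. (d ^^ n) f"]) simp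
qed

inductive_set products :: "(nat \<Rightarrow> real \<Rightarrow> real) \<Rightarrow> (nat \<Rightarrow> real \<Rightarrow> real) \<Rightarrow> (real \<Rightarrow> real) set"
  for X Y where
  base: "(\<lambda>x. X i x * Y j x) \<in> products X Y"
| add: "f \<in> products X Y \<Longrightarrow> g \<in> products X Y \<Longrightarrow> (\<lambda>x. f x + g x) \<in> products X Y"

lemma smooth_seq_mult:
  assumes "smooth_seq X" "smooth_seq Y"
  shows "\<exists>Z. Z 0 = (\<lambda>x. X 0 x * Y 0 x) \<and> smooth_seq Z"
proof (rule smooth_seqI)
  show "(\<lambda>x. X 0 x * Y 0 x) \<in> products X Y" by (rule products.base)
  fix f assume "f \<in> products X Y"
  then show "\<exists>f'\<in>products X Y. \<forall>x. (f has_real_derivative f' x) (at x)"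
  proof induction
    case (base i j)
    have "((\<lambda>x. X i x * Y j x) has_real_derivative X (Suc i) x * Y j x + X i x * Y (Suc j) x) (at x)" for x
      using assms unfolding smooth_seq_def by (auto intro!: derivative_eq_intros)
    then show ?case by (intro bexI[of _ "\<lambda>x. X (Suc i) x * Y j x + X i x * Y (Suc j) x"])
      (auto intro: products.intros)
  next
    case (add f g)
    then obtain f' g' where "f' \<in> products X Y" "g' \<in> products X Y"
      "\<forall>x. (f has_real_derivative f' x) (at x)" "\<forall>x. (g has_real_derivative g' x) (at x)" by blast
    then show ?case by (intro bexI[of _ "\<lambda>x. f' x + g' x"]) (auto intro: products.add DERIV_add)
  qed
qed

lemma smooth_seq_affine:
  assumes "smooth_seq X"
  shows "smooth_seq (\<lambda>n x. k ^ n * X n (k * x + d))"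
  unfolding smooth_seq_def
proof (intro allI)
  fix n x
  have "((\<lambda>x. k * x + d) has_real_derivative k) (at x)" by (auto intro!: derivative_eq_intros)
  moreover have "(X n has_real_derivative X (Suc n) (k * x + d)) (at (k * x + d))"
    using assms by (auto simp: smooth_seq_def)
  ultimately have "((\<lambda>x. X n (k * x + d)) has_real_derivative X (Suc n) (k * x + d) * k) (at x)"
    by (rule DERIV_chain2[rotated])
  from DERIV_cmult[OF this, of "k ^ n"]
  show "((\<lambda>x. k ^ n * X n (k * x + d)) has_real_derivative k ^ Suc n * X (Suc n) (k * x + d)) (at x)"
    by (simp add: mult_ac)
qed

lemma smooth_seq_diff:
  assumes "smooth_seq X" "smooth_seq Y"
  shows "smooth_seq (\<lambda>n x. X n x - c * Y n x)"
  using assms unfolding smooth_seq_def by (auto intro!: derivative_eq_intros)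

text \<open>The polynomials in \<open>d\<^sup>n/dx\<^sup>n exp (- 1/x) = q\<^sub>n(1/x) exp (- 1/x)\<close>: the chain rule gives
  \<open>q\<^sub>n\<^sub>+\<^sub>1(y) = y\<^sup>2 (q\<^sub>n(y) - q\<^sub>n'(y))\<close>.\<close>

definition flat_poly :: "nat \<Rightarrow> real poly" where
  "flat_poly n = ((\<lambda>p. [:0, 0, 1:] * (p - pderiv p)) ^^ n) 1"

definition flat :: "nat \<Rightarrow> real \<Rightarrow> real" where
  "flat n x = (if x > 0 then poly (flat_poly n) (1 / x) * exp (- (1 / x)) else 0)"

lemma poly_times_exp_tendsto_0: "((\<lambda>y. y ^ k * poly p y * exp (- y)) \<longlongrightarrow> (0::real)) at_top"
proof (induction p arbitrary: k)
  case (pCons a p)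
  have "((\<lambda>y::real. a * (y ^ k / exp y) + y ^ Suc k * poly p y * exp (- y)) \<longlongrightarrow> a * 0 + 0) at_top"
    by (intro tendsto_intros pCons.IH tendsto_power_div_exp_0)
  then show ?case by (simp add: algebra_simps exp_minus divide_inverse)
qed simp

lemma smooth_seq_flat: "smooth_seq flat"
  unfolding smooth_seq_def
proof (intro allI)
  fix n and x :: real
  show "(flat n has_real_derivative flat (Suc n) x) (at x)"
  proof (cases x "0::real" rule: linorder_cases)
    case less
    have "((\<lambda>x. 0) has_real_derivative 0) (at x)" by simp
    then have "(flat n has_real_derivative 0) (at x)"
      by (rule DERIV_cong_ev[THEN iffD1, rotated 3])
         (use less eventually_nhds_in_open[of "{..<0}" x] in \<open>auto simp: flat_def elim!: eventually_mono\<close>)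
    then show ?thesis using less by (simp add: flat_def)
  next
    case greater
    let ?p = "flat_poly n"
    have inv: "((\<lambda>x. 1 / x) has_real_derivative - (1 / x ^ 2)) (at x)"
      using greater by (auto intro!: derivative_eq_intros simp: power2_eq_square)
    have e: "((\<lambda>x. exp (- (1 / x))) has_real_derivative exp (- (1 / x)) * (1 / x ^ 2)) (at x)"
      using DERIV_chain2[OF DERIV_exp DERIV_minus[OF inv]] by simp
    have "((\<lambda>x. poly ?p (1 / x) * exp (- (1 / x))) has_real_derivative
        poly (pderiv ?p) (1 / x) * (- (1 / x ^ 2)) * exp (- (1 / x)) + exp (- (1 / x)) * (1 / x ^ 2) * poly ?p (1 / x)) (at x)"
      by (rule DERIV_mult[OF DERIV_chain2[OF poly_DERIV inv] e])
    also have "poly (pderiv ?p) (1 / x) * (- (1 / x ^ 2)) * exp (- (1 / x)) + exp (- (1 / x)) * (1 / x ^ 2) * poly ?p (1 / x) = flat (Suc n) x"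
      using greater by (simp add: flat_def flat_poly_def power2_eq_square divide_simps) (simp add: algebra_simps)
    finally show ?thesis
      by (rule DERIV_cong_ev[THEN iffD1, rotated 3])
         (use greater eventually_nhds_in_open[of "{0<..}" x] in \<open>auto simp: flat_def elim!: eventually_mono\<close>)
  next
    case equal
    have "((\<lambda>h. flat n h / h) \<longlongrightarrow> 0) (at_left 0)"
      by (rule tendsto_eventually) (auto simp: eventually_at_filter flat_def)
    moreover have "((\<lambda>h. flat n h / h) \<longlongrightarrow> 0) (at_right 0)"
    proof -
      have "((\<lambda>h::real. inverse h ^ 1 * poly (flat_poly n) (inverse h) * exp (- (inverse h))) \<longlongrightarrow> 0) (at_right 0)"
        by (rule filterlim_compose[OF poly_times_exp_tendsto_0 filterlim_inverse_at_top_right])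
      then show ?thesis
        by (rule Lim_transform_eventually)
           (auto simp: eventually_at_filter flat_def divide_inverse mult_ac)
    qed
    ultimately have "((\<lambda>h. flat n h / h) \<longlongrightarrow> 0) (at 0)" by (simp add: filterlim_split_at)
    then show ?thesis using equal by (simp add: DERIV_def flat_def)
  qed
qed

text \<open>Increasing \<open>N\<close> steepens both flanks, so for fixed end points the bumps converge
  boundedly to the indicator of \<open>(a, b)\<close>; a sequence of test functions then replaces
  mollification.\<close>

definition bump :: "real \<Rightarrow> real \<Rightarrow> nat \<Rightarrow> real \<Rightarrow> real" where
  "bump a b N x = flat 0 (real (Suc N) * (x - a)) * flat 0 (real (Suc N) * (b - x))"

lemma flat_0: "flat 0 x = (if x > 0 then exp (- (1 / x)) else 0)"
  by (simp add: flat_def flat_poly_def)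

lemma smooth_bump: "\<exists>X. X 0 = bump a b N \<and> smooth_seq X"
proof -
  let ?k = "real (Suc N)"
  from smooth_seq_mult[OF smooth_seq_affine[OF smooth_seq_flat, of ?k "- ?k * a"] smooth_seq_affine[OF smooth_seq_flat, of "- ?k" "?k * b"]]
  show ?thesis unfolding bump_def[abs_def] by (simp add: algebra_simps)
qed

lemma bump_continuous: "continuous_on S (bump a b N)"
proof -
  obtain X where "X 0 = bump a b N" "smooth_seq X" using smooth_bump by blast
  then show ?thesis unfolding smooth_seq_def by (metis DERIV_isCont continuous_at_imp_continuous_on)
qed

lemma bump_measurable [measurable]: "bump a b N \<in> borel_measurable borel"
  using bump_continuous by (rule borel_measurable_continuous_onI)

lemma bump_range: "0 \<le> bump a b N x" "bump a b N x \<le> 1"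
  unfolding bump_def flat_0 by (auto intro!: mult_le_one simp del: of_nat_Suc)

lemma bump_outside: "x \<notin> {a<..<b} \<Longrightarrow> bump a b N x = 0"
  unfolding bump_def flat_0 by (auto simp: zero_less_mult_iff simp del: of_nat_Suc)

lemma bump_inside: "x \<in> {a<..<b} \<Longrightarrow> bump a b N x > 0"
  unfolding bump_def flat_0 by (auto simp: zero_less_mult_iff simp del: of_nat_Suc)

lemma bump_tendsto: "(\<lambda>N. bump a b N x) \<longlonglongrightarrow> indicator {a<..<b} x"
proof (cases "x \<in> {a<..<b}")
  case True
  have lim: "(\<lambda>N. flat 0 (real (Suc N) * d)) \<longlonglongrightarrow> 1" if d: "d > 0" for d
  proof -
    have "(\<lambda>N. exp (- (1 / real (Suc N) * (1 / d)))) \<longlonglongrightarrow> exp (- (0 * (1 / d)))"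
      by (intro tendsto_intros LIMSEQ_Suc lim_1_over_n)
    then show ?thesis using d by (simp add: flat_0 zero_less_mult_iff del: of_nat_Suc)
  qed
  have "(\<lambda>N. bump a b N x) \<longlonglongrightarrow> 1 * 1"
    unfolding bump_def by (intro tendsto_mult lim) (use True in auto)
  then show ?thesis using True by simp
qed (simp add: bump_outside)

section \<open>Weak derivatives on the unit interval\<close>

definition locally_integrable :: "(real \<Rightarrow> real) \<Rightarrow> bool" where
  "locally_integrable f \<longleftrightarrow> (\<forall>a b. 0 < a \<longrightarrow> a < b \<longrightarrow> b < 1 \<longrightarrow> set_integrable lborel {a..b} f)"

text \<open>The measures with densities \<open>f\<^sup>+\<close> and \<open>f\<^sup>-\<close> agree on all half lines, hence coincide.\<close>

lemma AE_zero_if_interval_integrals_zero: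
  fixes f :: "real \<Rightarrow> real"
  assumes f: "integrable lborel f" and 0: "\<And>x. (LINT t:{x<..}|lborel. f t) = 0"
  shows "AE x in lborel. f x = 0"
proof -
  have [measurable]: "f \<in> borel_measurable borel" using f by auto
  define P where "P = density lborel (\<lambda>x. ennreal (f x))"
  define Q where "Q = density lborel (\<lambda>x. ennreal (- f x))"
  have eP: "emeasure P {x<..} = ennreal (LINT t:{x<..}|lborel. max 0 (f t))" for x
  proof -
    have "emeasure P {x<..} = (\<integral>\<^sup>+t. ennreal (indicator {x<..} t * max 0 (f t)) \<partial>lborel)"
      unfolding P_def by (subst emeasure_density) (auto intro!: nn_integral_cong simp: indicator_def max_def ennreal_neg)
    also have "\<dots> = ennreal (LINT t|lborel. indicator {x<..} t * max 0 (f t))"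
      by (rule nn_integral_eq_integral) (use f in \<open>auto intro!: integrable_mult_indicator[where 'b=real, simplified] \<close>)
    finally show ?thesis by (simp add: set_lebesgue_integral_def)
  qed
  have eQ: "emeasure Q {x<..} = ennreal (LINT t:{x<..}|lborel. max 0 (- f t))" for x
  proof -
    have "emeasure Q {x<..} = (\<integral>\<^sup>+t. ennreal (indicator {x<..} t * max 0 (- f t)) \<partial>lborel)"
      unfolding Q_def by (subst emeasure_density) (auto intro!: nn_integral_cong simp: indicator_def max_def ennreal_neg)
    also have "\<dots> = ennreal (LINT t|lborel. indicator {x<..} t * max 0 (- f t))"
      by (rule nn_integral_eq_integral) (use f in \<open>auto intro!: integrable_mult_indicator[where 'b=real, simplified]\<close>)
    finally show ?thesis by (simp add: set_lebesgue_integral_def)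
  qed
  have eq: "(LINT t:{x<..}|lborel. max 0 (f t)) = (LINT t:{x<..}|lborel. max 0 (- f t))" for x
  proof -
    have i: "set_integrable lborel {x<..} (\<lambda>t. max 0 (f t))" "set_integrable lborel {x<..} (\<lambda>t. max 0 (- f t))"
      unfolding set_integrable_def using f by (auto intro!: integrable_mult_indicator[where 'b=real, simplified])
    have "(LINT t:{x<..}|lborel. max 0 (f t)) - (LINT t:{x<..}|lborel. max 0 (- f t)) = (LINT t:{x<..}|lborel. max 0 (f t) - max 0 (- f t))"
      by (rule set_integral_diff(2)[OF i, symmetric])
    also have "\<dots> = (LINT t:{x<..}|lborel. f t)"
      by (rule arg_cong[where f = "set_lebesgue_integral lborel _"]) (auto simp: max_def)
    finally show ?thesis using 0 by simp
  qed
  \<comment> \<open>Finite measures on the line are determined by their values on upper half lines.\<close>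
  have "P = Q"
    by (rule measure_eqI_lessThan) (auto simp: eP eQ eq, auto simp: P_def Q_def)
  then have "AE x in lborel. ennreal (f x) = ennreal (- f x)"
    unfolding P_def Q_def by (subst (asm) sigma_finite_measure.density_unique_iff[OF sigma_finite_lborel]) auto
  then show ?thesis
  proof eventually_elim
    case (elim x)
    then show ?case by (metis ennreal_neg ennreal_eq_0_iff linear neg_0_le_iff_le neg_le_0_iff_le order_antisym)
  qed
qed

text \<open>Letting \<open>N\<close> tend to infinity, the integral of \<open>f\<close> over every rational interval vanishes,
  hence over all intervals by continuity. Rational end points keep the family of test
  functions countable; when \<open>f\<close> depends on a parameter, one null set of parameters can be
  discarded for the whole family.\<close>

lemma fundamental_lemma:
  assumes f: "locally_integrable f"
    and 0: "\<And>a b N. a \<in> \<rat> \<Longrightarrow> b \<in> \<rat> \<Longrightarrow> 0 < a \<Longrightarrow> a < b \<Longrightarrow> b < 1 \<Longrightarrow> (LINT x|lborel. f x * bump a b N x) = 0"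
  shows "AE x in lborel. 0 < x \<and> x < 1 \<longrightarrow> f x = 0"
proof -
  have rat: "(LINT t:{a..b}|lborel. f t) = 0" if ab: "a \<in> \<rat>" "b \<in> \<rat>" "0 < a" "a < b" "b < 1" for a b
  proof -
    have fi: "integrable lborel (\<lambda>x. indicator {a..b} x *\<^sub>R f x)"
      using f ab unfolding locally_integrable_def set_integrable_def by blast
    note [measurable] = borel_measurable_integrable[OF fi]
    have "(\<lambda>N. LINT x|lborel. (indicator {a..b} x *\<^sub>R f x) * bump a b N x) \<longlonglongrightarrow>
        (LINT x|lborel. (indicator {a..b} x *\<^sub>R f x) * indicator {a<..<b} x)"
    proof (rule integral_dominated_convergence)
      show "integrable lborel (\<lambda>x. norm (indicator {a..b} x *\<^sub>R f x))" using fi by (rule integrable_norm)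
      show "AE x in lborel. (\<lambda>N. (indicator {a..b} x *\<^sub>R f x) * bump a b N x) \<longlonglongrightarrow> (indicator {a..b} x *\<^sub>R f x) * indicator {a<..<b} x"
        by (intro AE_I2 tendsto_mult tendsto_const bump_tendsto)
      show "AE x in lborel. norm ((indicator {a..b} x *\<^sub>R f x) * bump a b N x) \<le> norm (indicator {a..b} x *\<^sub>R f x)" for N
        using bump_range[of a b N] by (intro AE_I2) (simp add: abs_mult mult_left_le)
    qed measurable
    moreover have "(indicator {a..b} x *\<^sub>R f x) * bump a b N x = f x * bump a b N x" for x N
      using bump_outside[of x a b N] by (cases "x \<in> {a<..<b}") (auto simp: indicator_def)
    ultimately have "(\<lambda>N. 0) \<longlonglongrightarrow> (LINT x|lborel. (indicator {a..b} x *\<^sub>R f x) * indicator {a<..<b} x)"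
      by (simp only: 0[OF ab])
    then have "(LINT x|lborel. (indicator {a..b} x *\<^sub>R f x) * indicator {a<..<b} x) = 0"
      by (simp add: LIMSEQ_const_iff)
    also have "(LINT x|lborel. (indicator {a..b} x *\<^sub>R f x) * indicator {a<..<b} x) = (LINT t:{a..b}|lborel. f t)"
      unfolding set_lebesgue_integral_def
      by (rule integral_cong_AE) (use AE_lborel_singleton[of a] AE_lborel_singleton[of b] fi in \<open>auto split: split_indicator\<close>)
    finally show ?thesis .
  qed
  have piece: "AE x in lborel. indicator {a..b} x * f x = 0" if ab: "a \<in> \<rat>" "b \<in> \<rat>" "0 < a" "a < b" "b < 1" for a b
  proof (rule AE_zero_if_interval_integrals_zero)
    have fi: "set_integrable lborel {a..b} f"
      using f ab unfolding locally_integrable_def by blast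
    then show "integrable lborel (\<lambda>x. indicator {a..b} x * f x)" by (simp add: set_integrable_def)
    define F where "F x = (LINT t:{a..x}|lborel. f t)" for x
    have Fa: "F a = 0" unfolding set_lebesgue_integral_def F_def
      by (rule integral_eq_zero_AE, rule AE_mp[OF AE_lborel_singleton[of a]]) (auto simp: indicator_def)
    then have P: "primitive a b F f" using fi unfolding primitive_def F_def by simp
    have F0: "F x = 0" if "x \<in> {a..b}" for x
    proof (rule continuous_constant_on_closure[of "\<rat> \<inter> {a<..<b}" F])
      have cl: "closure (\<rat> \<inter> {a<..<b}) = {a..b}"
        using closure_open_Int_superset[of "{a<..<b}" "\<rat>"] ab Rats_closure_real
        by (simp add: Int_commute closure_greaterThanLessThan)
      show "continuous_on (closure (\<rat> \<inter> {a<..<b})) F" unfolding cl by (rule primitive_continuous[OF P])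
      show "x \<in> closure (\<rat> \<inter> {a<..<b})" using that cl by simp
      show "F y = 0" if "y \<in> \<rat> \<inter> {a<..<b}" for y unfolding F_def by (rule rat) (use that ab in auto)
    qed
    show "(LINT t:{x<..}|lborel. indicator {a..b} t * f t) = 0" for x
    proof -
      consider "x < a" | "x \<in> {a..b}" | "x > b" by force
      then show ?thesis
      proof cases
        case 1
        then have "(LINT t:{x<..}|lborel. indicator {a..b} t * f t) = F b"
          unfolding set_lebesgue_integral_def F_def
          by (intro Bochner_Integration.integral_cong) (auto simp: indicator_def)
        then show ?thesis using F0[of b] ab by simp
      next
        case 2
        have "(LINT t:{x<..}|lborel. indicator {a..b} t * f t) = (LINT t:{x..b}|lborel. f t)"
          unfolding set_lebesgue_integral_def
        proof (rule integral_cong_AE)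
          show "(\<lambda>t. indicator {x<..} t *\<^sub>R (indicator {a..b} t * f t)) \<in> borel_measurable lborel"
            using fi unfolding set_integrable_def by (intro borel_measurable_scaleR) auto
          show "(\<lambda>t. indicator {x..b} t *\<^sub>R f t) \<in> borel_measurable lborel"
            using set_integrable_subset[OF fi, of "{x..b}"] 2 unfolding set_integrable_def by auto
        qed (use 2 AE_lborel_singleton[of x] in \<open>auto simp: indicator_def\<close>)
        also have "\<dots> = F b - F x" using primitive_increment[OF P, of x b] 2 by simp
        finally show ?thesis using F0[of b] F0[of x] 2 ab by simp
      next
        case 3
        then have "indicator {x<..} t *\<^sub>R (indicator {a..b} t * f t) = 0" for t by (auto simp: indicator_def)
        then show ?thesis unfolding set_lebesgue_integral_def by (simp only: integral_zero)
      qed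
    qed
  qed
  \<comment> \<open>The offset 3 keeps the two rational end points in order for every \<open>n\<close>.\<close>
  have "AE x in lborel. \<forall>n::nat. indicator {1 / real (n + 3) .. 1 - 1 / real (n + 3)} x * f x = 0"
    by (subst AE_all_countable) (intro allI piece, auto simp: field_simps)
  then show ?thesis
  proof eventually_elim
    case (elim x)
    show ?case
    proof
      assume x: "0 < x \<and> x < 1"
      then have "0 < min x (1 - x)" by simp
      then obtain n where n: "inverse (real (Suc n)) < min x (1 - x)" using reals_Archimedean by blast
      have "1 / real (n + 3) \<le> inverse (real (Suc n))" by (simp add: divide_simps)
      then have "x \<in> {1 / real (n + 3) .. 1 - 1 / real (n + 3)}" using n by auto
      then show "f x = 0" using elim[rule_format, of n] by simp
    qed
  qed
qed

definition test_seq :: "(nat \<Rightarrow> real \<Rightarrow> real) \<Rightarrow> bool" where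
  "test_seq X \<longleftrightarrow> smooth_seq X \<and> (\<exists>a b. 0 < a \<and> a < b \<and> b < 1 \<and> (\<forall>n x. x \<notin> {a..b} \<longrightarrow> X n x = 0))"

lemma test_seqI:
  assumes X: "smooth_seq X" and ab: "0 < a" "a < b" "b < 1" and 0: "\<And>x. x \<notin> {a..b} \<Longrightarrow> X 0 x = 0"
  shows "test_seq X"
proof -
  have "\<forall>x. x \<notin> {a..b} \<longrightarrow> X n x = 0" for n
  proof (induction n)
    case (Suc n)
    show ?case
    proof (intro allI impI)
      fix x assume x: "x \<notin> {a..b}"
      have "eventually (\<lambda>y. y \<in> - {a..b}) (nhds x)"
        using x by (intro eventually_nhds_in_open) auto
      then have "eventually (\<lambda>y. X n y = 0) (nhds x)" using Suc by (auto elim!: eventually_mono)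
      then have "(X n has_real_derivative 0) (at x)"
        using DERIV_cong_ev[of x x "X n" "\<lambda>_. 0" 0 0] by simp
      moreover have "(X n has_real_derivative X (Suc n) x) (at x)" using X by (simp add: smooth_seq_def)
      ultimately show "X (Suc n) x = 0" by (rule DERIV_unique[symmetric])
    qed
  qed (use 0 in auto)
  then show ?thesis using X ab unfolding test_seq_def by blast
qed

lemma test_seq_continuous:
  assumes "test_seq X"
  shows "continuous_on S (X n)"
  using assms unfolding test_seq_def smooth_seq_def by (metis DERIV_isCont continuous_at_imp_continuous_on)

lemma test_seq_measurable [measurable (raw)]: "test_seq X \<Longrightarrow> X n \<in> borel_measurable borel"
  by (rule borel_measurable_continuous_onI[OF test_seq_continuous])

lemma locally_integrable_mult:
  assumes f: "locally_integrable f" and ab: "0 < a" "a < b" "b < 1"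
    and g: "continuous_on UNIV g" "\<And>x. x \<notin> {a..b} \<Longrightarrow> g x = (0::real)"
  shows "integrable lborel (\<lambda>x. f x * g x)"
    and "(LINT x|lborel. f x * g x) = (LINT x:{a..b}|lborel. f x * g x)"
proof -
  have "set_integrable lborel {a..b} (\<lambda>x. f x * g x)"
    using f ab g(1) by (intro set_integrable_mult_continuous) (auto simp: locally_integrable_def intro: continuous_on_subset)
  moreover have eq: "indicator {a..b} x *\<^sub>R (f x * g x) = f x * g x" for x
    using g(2)[of x] by (auto simp: indicator_def)
  ultimately show "integrable lborel (\<lambda>x. f x * g x)" unfolding set_integrable_def eq by simp
  show "(LINT x|lborel. f x * g x) = (LINT x:{a..b}|lborel. f x * g x)"
    unfolding set_lebesgue_integral_def eq ..
qed

lemma locally_integrable_test: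
  assumes "locally_integrable f" "test_seq X"
  shows "integrable lborel (\<lambda>x. f x * X n x)"
  using assms locally_integrable_mult(1)[OF assms(1)] test_seq_continuous[OF assms(2), of UNIV n]
  unfolding test_seq_def by blast

lemma bump_test_seq:
  assumes "0 < a" "a < b" "b < 1"
  shows "\<exists>X. test_seq X \<and> X 0 = bump a b N"
proof -
  obtain X where "X 0 = bump a b N" "smooth_seq X" using smooth_bump by blast
  then show ?thesis using test_seqI[of X a b] bump_outside[of _ a b N] assms by force
qed

text \<open>Zero mean is what makes the antiderivative vanish to the right of the support.\<close>

lemma test_seq_antiderivative:
  assumes X: "test_seq X" and 0: "(LINT x|lborel. X 0 x) = 0"
  shows "\<exists>Y. test_seq Y \<and> (\<forall>n. Y (Suc n) = X n)"
proof -
  obtain a b where ab: "0 < a" "a < b" "b < 1" and out: "\<And>n x. x \<notin> {a..b} \<Longrightarrow> X n x = 0"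
    using X unfolding test_seq_def by blast
  have cont: "continuous_on S (X 0)" for S using test_seq_continuous[OF X] .
  define R where "R x = integral {0..x} (X 0)" for x
  have R0: "R x = 0" if "x < a" for x
    unfolding R_def by (subst integral_cong[where g = "\<lambda>_. 0"]) (use that out[of _ 0] in auto)
  have R: "(R has_real_derivative X 0 x) (at x)" for x
  proof (cases "x < a")
    case True
    have "eventually (\<lambda>y. y \<in> {..<a}) (nhds x)" using True by (intro eventually_nhds_in_open) auto
    then have "eventually (\<lambda>y. R y = 0) (nhds x)" by eventually_elim (use R0 in auto)
    then have "(R has_real_derivative 0) (at x)" using DERIV_cong_ev[of x x R "\<lambda>_. 0" 0 0] by simp
    then show ?thesis using out[of x 0] True by simp
  next
    case False
    then have "(R has_real_derivative X 0 x) (at x within {0..x+1})"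
      unfolding R_def using integral_has_real_derivative[OF cont, of x 0 "x + 1"] ab by auto
    moreover have "x \<in> interior {0..x+1}" using False ab by auto
    then have "at x within {0..x+1} = at x" by (rule at_within_interior)
    ultimately show ?thesis by (simp only:)
  qed
  define Y where "Y n = (case n of 0 \<Rightarrow> R | Suc m \<Rightarrow> X m)" for n
  have sY: "smooth_seq Y" unfolding smooth_seq_def
  proof (intro allI)
    fix n x show "(Y n has_real_derivative Y (Suc n) x) (at x)"
      using R X by (cases n) (auto simp: Y_def test_seq_def smooth_seq_def)
  qed
  have "test_seq Y"
  proof (rule test_seqI[OF sY ab])
    fix x assume x: "x \<notin> {a..b}"
    show "Y 0 x = 0"
    proof (cases "x < a")
      case False
      then have xb: "b < x" using x by auto
      have "X 0 t = indicator {0..x} t *\<^sub>R X 0 t" for t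
        by (cases "t \<in> {a..b}") (use out[of t 0] xb ab in \<open>auto simp: indicator_def\<close>)
      then have "(LINT x|lborel. X 0 x) = (LINT t:{0..x}|lborel. X 0 t)"
        unfolding set_lebesgue_integral_def by (rule Bochner_Integration.integral_cong[OF refl])
      also have "\<dots> = R x" unfolding R_def
        by (intro set_borel_integral_eq_integral(2) borel_integrable_atLeastAtMost' cont)
      finally show ?thesis using 0 by (simp add: Y_def)
    qed (simp add: Y_def R0)
  qed
  then show ?thesis by (intro exI[of _ Y]) (simp add: Y_def)
qed

definition unit_bump :: "real \<Rightarrow> real" where "unit_bump = bump (1/4) (1/2) 0"

lemma bump_integrable: "integrable lborel (bump a b N)"
proof -
  have "set_integrable lborel {a..b} (bump a b N)"
    by (intro borel_integrable_atLeastAtMost' bump_continuous)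
  moreover have eq: "indicator {a..b} x *\<^sub>R bump a b N x = bump a b N x" for x
    using bump_outside[of x a b N] by (cases "x \<in> {a<..<b}") (auto simp: indicator_def)
  ultimately show ?thesis unfolding set_integrable_def eq by simp
qed

lemma unit_bump_integral: "(LINT x|lborel. unit_bump x) > 0"
proof -
  have "(LINT x|lborel. unit_bump x) \<noteq> 0"
  proof
    assume "(LINT x|lborel. unit_bump x) = 0"
    then have "AE x in lborel. unit_bump x = 0"
      by (subst (asm) integral_nonneg_eq_0_iff_AE) (auto simp: unit_bump_def bump_integrable bump_range)
    then have "AE x in lborel. x \<notin> {1/4<..<1/2::real}"
      by eventually_elim (use bump_inside[of _ "1/4" "1/2" 0] in \<open>force simp: unit_bump_def\<close>)
    then have "{1/4<..<1/2::real} \<in> null_sets lborel" by (subst AE_iff_null_sets) auto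
    then show False by (auto simp: null_sets_def)
  qed
  moreover have "0 \<le> (LINT x|lborel. unit_bump x)"
    by (rule integral_nonneg_AE) (auto simp: unit_bump_def bump_range)
  ultimately show ?thesis by simp
qed

definition bump_ratio :: "real \<Rightarrow> real \<Rightarrow> nat \<Rightarrow> real" where
  "bump_ratio a b N = (LINT x|lborel. bump a b N x) / (LINT x|lborel. unit_bump x)"

text \<open>A test function whose derivative is a bump minus the multiple of a reference bump that
  has the same integral. With rational end points these form a countable family, which
  suffices to identify a weak derivative.\<close>

definition dipole :: "real \<Rightarrow> real \<Rightarrow> nat \<Rightarrow> nat \<Rightarrow> real \<Rightarrow> real" where
  "dipole a b N = (SOME Y. test_seq Y \<and> Y 1 = (\<lambda>x. bump a b N x - bump_ratio a b N * unit_bump x))"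

lemma dipole:
  assumes ab: "0 < a" "a < b" "b < 1"
  shows "test_seq (dipole a b N)" "dipole a b N 1 = (\<lambda>x. bump a b N x - bump_ratio a b N * unit_bump x)"
proof -
  have "\<exists>Y. test_seq Y \<and> Y 1 = (\<lambda>x. bump a b N x - bump_ratio a b N * unit_bump x)"
  proof -
    obtain X where X: "X 0 = bump a b N" "smooth_seq X" using smooth_bump by blast
    obtain U where U: "U 0 = unit_bump" "smooth_seq U" unfolding unit_bump_def using smooth_bump by blast
    let ?Z = "\<lambda>n x. X n x - bump_ratio a b N * U n x"
    have "test_seq ?Z"
    proof (rule test_seqI)
      show "smooth_seq ?Z" using X U by (intro smooth_seq_diff)
      fix x assume "x \<notin> {min a (1/4) .. max b (1/2)}"
      then have "x \<notin> {a<..<b}" "x \<notin> {1/4<..<1/2}" by auto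
      then show "?Z 0 x = 0" using X U bump_outside by (simp add: unit_bump_def)
    qed (use ab in auto)
    moreover have "(LINT x|lborel. ?Z 0 x) = 0"
      using X U unit_bump_integral bump_integrable by (simp add: bump_ratio_def unit_bump_def)
    ultimately obtain Y where "test_seq Y" "\<forall>n. Y (Suc n) = ?Z n" using test_seq_antiderivative by blast
    then show ?thesis using X U by (intro exI[of _ Y]) auto
  qed
  from someI_ex[OF this]
  show "test_seq (dipole a b N)" "dipole a b N 1 = (\<lambda>x. bump a b N x - bump_ratio a b N * unit_bump x)"
    by (simp_all add: dipole_def)
qed

text \<open>The base point is the midpoint because \<open>g\<close> need not be integrable up to either end
  point.\<close>

definition antideriv :: "(real \<Rightarrow> real) \<Rightarrow> real \<Rightarrow> real" where
  "antideriv g x = (if 1/2 \<le> x then LINT t:{1/2..x}|lborel. g t else - (LINT t:{x..1/2}|lborel. g t))"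

lemma primitive_antideriv:
  assumes g: "set_integrable lborel {a..b} g" and ab: "a \<le> 1/2" "1/2 \<le> b"
  shows "primitive a b (antideriv g) g"
  unfolding primitive_def
proof (intro conjI ballI g)
  fix x assume x: "x \<in> {a..b}"
  have a: "antideriv g a = - (LINT t:{a..1/2}|lborel. g t)"
  proof (cases "a = 1/2")
    case True
    have "(LINT t:{a..a}|lborel. g t) = 0" unfolding set_lebesgue_integral_def
      by (rule integral_eq_zero_AE, rule AE_mp[OF AE_lborel_singleton[of a]]) (auto simp: indicator_def)
    then show ?thesis by (simp add: antideriv_def True)
  qed (use ab in \<open>simp add: antideriv_def\<close>)
  show "antideriv g x - antideriv g a = (LINT t:{a..x}|lborel. g t)"
  proof (cases "1/2 \<le> x")
    case True
    have "(LINT t:{a..x}|lborel. g t) = (LINT t:{a..1/2}|lborel. g t) + (LINT t:{1/2..x}|lborel. g t)"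
      by (rule set_integral_split) (use True ab x set_integrable_subset[OF g, of "{a..x}"] in auto)
    then show ?thesis unfolding a using True by (simp add: antideriv_def)
  next
    case False
    have "(LINT t:{a..1/2}|lborel. g t) = (LINT t:{a..x}|lborel. g t) + (LINT t:{x..1/2}|lborel. g t)"
      by (rule set_integral_split) (use False ab x set_integrable_subset[OF g, of "{a..1/2}"] in auto)
    then show ?thesis unfolding a using False by (simp add: antideriv_def)
  qed
qed

text \<open>The difference \<open>h = f - G\<close> with an indefinite integral \<open>G\<close> of \<open>g\<close> is orthogonal to every
  derivative of a dipole, so \<open>\<integral>h b = c \<integral>b\<close> for every rational bump \<open>b\<close>, with the same \<open>c\<close>; the
  fundamental lemma applies to \<open>h - c\<close>.\<close>

lemma du_bois_reymond:
  assumes f: "locally_integrable f" and g: "locally_integrable g"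
    and weak: "\<And>a b N. a \<in> \<rat> \<Longrightarrow> b \<in> \<rat> \<Longrightarrow> 0 < a \<Longrightarrow> a < b \<Longrightarrow> b < 1 \<Longrightarrow>
      (LINT x|lborel. f x * dipole a b N 1 x) = - (LINT x|lborel. g x * dipole a b N 0 x)"
  shows "\<exists>c. AE x in lborel. 0 < x \<and> x < 1 \<longrightarrow> f x = c + antideriv g x"
proof -
  define G where "G = antideriv g"
  have G: "primitive a b G g" if "0 < a" "a < 1/2" "1/2 < b" "b < 1" for a b
    unfolding G_def by (rule primitive_antideriv) (use g that in \<open>auto simp: locally_integrable_def\<close>)
  have Gli: "locally_integrable G"
    unfolding locally_integrable_def
  proof (intro allI impI)
    fix a b :: real assume ab: "0 < a" "a < b" "b < 1"
    have "primitive (min a (1/4)) (max b (3/4)) G g" by (rule G) (use ab in auto)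
    then have "continuous_on {a..b} G"
      by (rule continuous_on_subset[OF primitive_continuous]) auto
    then show "set_integrable lborel {a..b} G" by (rule borel_integrable_atLeastAtMost')
  qed
  define h where "h x = f x - G x" for x
  have h: "locally_integrable h"
    using f Gli unfolding locally_integrable_def h_def by (auto intro: set_integral_diff(1))
  have orth: "(LINT x|lborel. h x * dipole a b N 1 x) = 0" if ab: "a \<in> \<rat>" "b \<in> \<rat>" "0 < a" "a < b" "b < 1" for a b N
  proof -
    let ?Y = "dipole a b N"
    have Y: "test_seq ?Y" using dipole(1)[OF ab(3-5)] .
    obtain p q where pq: "0 < p" "p < q" "q < 1" and out: "\<And>n x. x \<notin> {p..q} \<Longrightarrow> ?Y n x = 0"
      using Y unfolding test_seq_def by blast
    \<comment> \<open>An interval that contains the support in its interior and the base point \<open>1/2\<close> of \<open>G\<close>.\<close>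
    define p' where "p' = min (p / 2) (1/4)"
    define q' where "q' = max ((q + 1) / 2) (3/4)"
    have pq': "0 < p'" "p' < p" "q < q'" "q' < 1" "p' < 1/2" "1/2 < q'" "p' < q'" using pq by (auto simp: p'_def q'_def min_def max_def)
    have out': "x \<notin> {p'..q'} \<Longrightarrow> ?Y n x = 0" for n x using out[of x n] pq' by auto
    have "primitive p' q' (?Y 0) (?Y 1)"
      by (rule primitive_C1) (use Y test_seq_continuous[OF Y, of _ 1] in \<open>auto simp: test_seq_def smooth_seq_def\<close>)
    from primitive_mult[OF G[OF pq'(1,5,6,4)] this]
    have P: "primitive p' q' (\<lambda>x. G x * ?Y 0 x) (\<lambda>x. g x * ?Y 0 x + G x * ?Y 1 x)" .
    have "0 = G q' * ?Y 0 q' - G p' * ?Y 0 p'" using out[of q' 0] out[of p' 0] pq' by simp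
    also have "\<dots> = (LINT x:{p'..q'}|lborel. g x * ?Y 0 x + G x * ?Y 1 x)"
      using primitive_increment[OF P, of p' q'] pq' by simp
    also have "\<dots> = (LINT x:{p'..q'}|lborel. g x * ?Y 0 x) + (LINT x:{p'..q'}|lborel. G x * ?Y 1 x)"
      using g Gli pq' test_seq_continuous[OF Y]
      by (intro set_integral_add set_integrable_mult_continuous) (auto simp: locally_integrable_def)
    also have "(LINT x:{p'..q'}|lborel. g x * ?Y 0 x) = (LINT x|lborel. g x * ?Y 0 x)"
      using out' pq' test_seq_continuous[OF Y] by (intro locally_integrable_mult(2)[OF g, symmetric]) auto
    also have "(LINT x:{p'..q'}|lborel. G x * ?Y 1 x) = (LINT x|lborel. G x * ?Y 1 x)"
      using out' pq' test_seq_continuous[OF Y] by (intro locally_integrable_mult(2)[OF Gli, symmetric]) auto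
    finally have "(LINT x|lborel. G x * ?Y 1 x) = - (LINT x|lborel. g x * ?Y 0 x)" by simp
    then have "(LINT x|lborel. f x * ?Y 1 x) - (LINT x|lborel. G x * ?Y 1 x) = 0" using weak[OF ab] by simp
    moreover have "(LINT x|lborel. h x * ?Y 1 x) = (LINT x|lborel. f x * ?Y 1 x) - (LINT x|lborel. G x * ?Y 1 x)"
      unfolding h_def left_diff_distrib
      by (rule Bochner_Integration.integral_diff) (rule locally_integrable_test[OF f Y] locally_integrable_test[OF Gli Y])+
    ultimately show ?thesis by simp
  qed
  have hb: "integrable lborel (\<lambda>x. h x * bump a b N x)" if "0 < a" "a < b" "b < 1" for a b N
    using bump_test_seq[OF that, of N] locally_integrable_test[OF h, of _ 0] by metis
  have hu: "integrable lborel (\<lambda>x. h x * unit_bump x)" unfolding unit_bump_def by (rule hb) auto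
  define c where "c = (LINT x|lborel. h x * unit_bump x) / (LINT x|lborel. unit_bump x)"
  have "AE x in lborel. 0 < x \<and> x < 1 \<longrightarrow> h x - c = 0"
  proof (rule fundamental_lemma)
    show "locally_integrable (\<lambda>x. h x - c)"
      unfolding locally_integrable_def
    proof (intro allI impI set_integral_diff(1))
      show "set_integrable lborel {a..b} h" if "0 < a" "a < b" "b < 1" for a b :: real
        using h that unfolding locally_integrable_def by blast
      show "set_integrable lborel {a..b} (\<lambda>x. c)" for a b :: real
        by (intro borel_integrable_atLeastAtMost' continuous_intros)
    qed
    fix a b :: real and N assume ab: "a \<in> \<rat>" "b \<in> \<rat>" "0 < a" "a < b" "b < 1"
    have "0 = (LINT x|lborel. h x * bump a b N x - bump_ratio a b N * (h x * unit_bump x))"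
      using orth[OF ab, of N] unfolding dipole(2)[OF ab(3-5)] by (simp add: algebra_simps)
    also have "\<dots> = (LINT x|lborel. h x * bump a b N x) - bump_ratio a b N * (LINT x|lborel. h x * unit_bump x)"
      using hb[OF ab(3-5), of N] hu by simp
    finally have "(LINT x|lborel. h x * bump a b N x) = c * (LINT x|lborel. bump a b N x)"
      by (simp add: c_def bump_ratio_def)
    then show "(LINT x|lborel. (h x - c) * bump a b N x) = 0"
      using hb[OF ab(3-5), of N] bump_integrable by (simp add: left_diff_distrib)
  qed
  then have "AE x in lborel. 0 < x \<and> x < 1 \<longrightarrow> f x = c + G x"
    by eventually_elim (auto simp: h_def)
  then show ?thesis unfolding G_def by blast
qed

section \<open>Test functions in cone coordinates\<close>

text \<open>The derivatives of \<open>x X'(x)\<close>; this function appears, with a minus sign, when \<open>X(x/s)\<close> is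
  differentiated by \<open>s d/ds\<close>.\<close>

definition euler_seq :: "(nat \<Rightarrow> real \<Rightarrow> real) \<Rightarrow> nat \<Rightarrow> real \<Rightarrow> real" where
  "euler_seq X i x = x * X (Suc i) x + real i * X i x"

lemma test_seq_euler:
  assumes "test_seq X"
  shows "test_seq (euler_seq X)"
proof -
  have "smooth_seq (euler_seq X)"
    using assms unfolding test_seq_def smooth_seq_def euler_seq_def[abs_def]
    by (auto intro!: derivative_eq_intros simp: algebra_simps)
  moreover obtain a b where "0 < a" "a < b" "b < 1" "\<forall>n x. x \<notin> {a..b} \<longrightarrow> X n x = 0"
    using assms unfolding test_seq_def by blast
  ultimately show ?thesis by (intro test_seqI[of _ a b]) (auto simp: euler_seq_def)
qed

text \<open>The derivatives of \<open>x X(x)\<close>; at \<open>i = 0\<close> the truncated subtraction is harmless because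
  its factor is \<open>0\<close>.\<close>

definition mul_seq :: "(nat \<Rightarrow> real \<Rightarrow> real) \<Rightarrow> nat \<Rightarrow> real \<Rightarrow> real" where
  "mul_seq X i x = x * X i x + real i * X (i - 1) x"

lemma test_seq_mul:
  assumes "test_seq X"
  shows "test_seq (mul_seq X)"
proof -
  have d: "(X n has_real_derivative X (Suc n) x) (at x)" for n x
    using assms unfolding test_seq_def smooth_seq_def by blast
  have "(mul_seq X n has_real_derivative mul_seq X (Suc n) x) (at x)" for n x
    by (cases n) (auto simp: mul_seq_def[abs_def] algebra_simps intro!: derivative_eq_intros d)
  then have "smooth_seq (mul_seq X)" by (simp add: smooth_seq_def)
  moreover obtain a b where "0 < a" "a < b" "b < 1" "\<forall>n x. x \<notin> {a..b} \<longrightarrow> X n x = 0"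
    using assms unfolding test_seq_def by blast
  ultimately show ?thesis by (intro test_seqI[of _ a b]) (auto simp: mul_seq_def)
qed

lemma test_seq_Suc: "test_seq X \<Longrightarrow> test_seq (\<lambda>n. X (Suc n))"
  unfolding test_seq_def smooth_seq_def by blast

text \<open>All partial derivatives, \<open>i\<close> times in \<open>x\<close> and \<open>j\<close> times in \<open>s\<close>, of
  \<open>(x, s) \<mapsto> X(x/s) Y(s) / s ^ m\<close>. Differentiation in \<open>s\<close> produces three functions of the same
  shape, so recursion over the parameters \<open>X\<close>, \<open>Y\<close>, \<open>m\<close> gives the whole array.\<close>

fun cone_partial :: "nat \<Rightarrow> nat \<Rightarrow> (nat \<Rightarrow> real \<Rightarrow> real) \<Rightarrow> (nat \<Rightarrow> real \<Rightarrow> real) \<Rightarrow> nat \<Rightarrow> real \<times> real \<Rightarrow> real" where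
  "cone_partial i 0 X Y m = (\<lambda>p. X i (fst p / snd p) * (Y 0 (snd p) / snd p ^ (m + i)))"
| "cone_partial i (Suc j) X Y m = (\<lambda>p. cone_partial i j X (\<lambda>n. Y (Suc n)) m p - cone_partial i j (euler_seq X) Y (Suc m) p
      - real m * cone_partial i j X Y (Suc m) p)"

lemma cone_deriv:
  assumes "test_seq X" "test_seq Y"
  shows "(cone_partial i j X Y m has_derivative (\<lambda>h. cone_partial (Suc i) j X Y m p * fst h + cone_partial i (Suc j) X Y m p * snd h)) (at p)"
  using assms
proof (induction j arbitrary: X Y m)
  case 0
  obtain x s where p: "p = (x, s)" by (cases p)
  obtain a b where ab: "0 < a" "a < b" "b < 1" "\<And>n x. x \<notin> {a..b} \<Longrightarrow> Y n x = 0"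
    using 0 unfolding test_seq_def by blast
  show ?case
  proof (cases "s < a")
    case True
    have "(cone_partial i 0 X Y m has_derivative (\<lambda>h. 0)) (at p)"
    proof (rule has_derivative_transform_within_open)
      show "((\<lambda>_. 0) has_derivative (\<lambda>h. 0)) (at p)" by simp
      show "open (UNIV \<times> {..<a})" by (intro open_Times) auto
      show "p \<in> UNIV \<times> {..<a}" using True by (simp add: p)
      show "0 = cone_partial i 0 X Y m q" if "q \<in> UNIV \<times> {..<a}" for q using that ab(4)[of "snd q" 0] by auto
    qed
    then show ?thesis using ab(4)[of s] True by (simp add: p)
  next
    case False
    then have s: "s > 0" using ab by auto
    have q: "((\<lambda>p::real\<times>real. fst p / snd p) has_derivative (\<lambda>h. fst h / s - x * snd h / s\<^sup>2)) (at p)"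
      unfolding p using s
      by (auto intro!: derivative_eq_intros simp: field_simps power2_eq_square)
    have X: "(X i has_real_derivative X (Suc i) (x / s)) (at (x / s))"
      and Y: "(Y 0 has_real_derivative Y 1 s) (at s)"
      using 0 by (auto simp: test_seq_def smooth_seq_def)
    have XX: "((\<lambda>p. X i (fst p / snd p)) has_derivative (\<lambda>h. (fst h / s - x * snd h / s\<^sup>2) * X (Suc i) (x / s))) (at p)"
    proof (rule has_derivative_compose[OF q])
      show "(X i has_derivative (\<lambda>t. t * X (Suc i) (x / s))) (at (fst p / snd p))"
        using X by (simp add: p has_field_derivative_def mult_commute_abs)
    qed
    let ?n = "m + i"
    have "((\<lambda>s. Y 0 s / s ^ ?n) has_real_derivative Y 1 s / s ^ ?n - real ?n * Y 0 s / s ^ Suc ?n) (at s)"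
    proof -
      have "((\<lambda>s. Y 0 s / s ^ ?n) has_real_derivative (Y 1 s * s ^ ?n - Y 0 s * (real ?n * s ^ (?n - 1))) / (s ^ ?n * s ^ ?n)) (at s)"
        using s by (auto intro!: derivative_eq_intros Y)
      also have "(Y 1 s * s ^ ?n - Y 0 s * (real ?n * s ^ (?n - 1))) / (s ^ ?n * s ^ ?n) = Y 1 s / s ^ ?n - real ?n * Y 0 s / s ^ Suc ?n"
        using s by (cases ?n) (simp_all add: field_simps)
      finally show ?thesis .
    qed
    then have YY: "((\<lambda>p::real\<times>real. Y 0 (snd p) / snd p ^ ?n) has_derivative (\<lambda>h. snd h * (Y 1 s / s ^ ?n - real ?n * Y 0 s / s ^ Suc ?n))) (at p)"
      using has_derivative_compose[OF has_derivative_snd[OF has_derivative_ident], of "\<lambda>s. Y 0 s / s ^ ?n" "\<lambda>t. t * (Y 1 s / s ^ ?n - real ?n * Y 0 s / s ^ Suc ?n)" p UNIV]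
      by (simp add: p has_field_derivative_def mult_commute_abs)
    have "(cone_partial i 0 X Y m has_derivative (\<lambda>h. X i (x / s) * (snd h * (Y 1 s / s ^ ?n - real ?n * Y 0 s / s ^ Suc ?n))
        + (fst h / s - x * snd h / s\<^sup>2) * X (Suc i) (x / s) * (Y 0 s / s ^ ?n))) (at p)"
      using has_derivative_mult[OF XX YY] by (simp add: p)
    then show ?thesis
      by (rule has_derivative_eq_rhs)
         (use s in \<open>simp add: fun_eq_iff p euler_seq_def power2_eq_square field_simps\<close>)
  qed
next
  case (Suc j)
  note d = Suc.IH[OF Suc.prems(1) test_seq_Suc[OF Suc.prems(2)], of m]
    Suc.IH[OF test_seq_euler[OF Suc.prems(1)] Suc.prems(2), of "Suc m"] Suc.IH[OF Suc.prems, of "Suc m"]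
  have "(cone_partial i (Suc j) X Y m has_derivative (\<lambda>h. 
     (cone_partial (Suc i) j X (\<lambda>n. Y (Suc n)) m p * fst h + cone_partial i (Suc j) X (\<lambda>n. Y (Suc n)) m p * snd h)
     - (cone_partial (Suc i) j (euler_seq X) Y (Suc m) p * fst h + cone_partial i (Suc j) (euler_seq X) Y (Suc m) p * snd h)
     - real m * (cone_partial (Suc i) j X Y (Suc m) p * fst h + cone_partial i (Suc j) X Y (Suc m) p * snd h))) (at p)"
    unfolding cone_partial.simps(2)[of i j X Y m]
    by (intro has_derivative_diff has_derivative_mult_right d)
  then show ?case
    by (rule has_derivative_eq_rhs)
       (simp only: cone_partial.simps(2)[of i "Suc j" X Y m] cone_partial.simps(2)[of "Suc i" j X Y m], simp add: fun_eq_iff algebra_simps del: cone_partial.simps)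
qed

text \<open>A product of a function of the slope and a function of the distance to the vertex. The
  power \<open>m\<close> is free so that the factor \<open>s\<close> of the area element and the factor \<open>1/s\<close> of the
  slope derivative can be compensated.\<close>

definition cone_test :: "(nat \<Rightarrow> real \<Rightarrow> real) \<Rightarrow> (nat \<Rightarrow> real \<Rightarrow> real) \<Rightarrow> nat \<Rightarrow> real \<times> real \<Rightarrow> real" where
  "cone_test X Y m p = X 0 (fst p / (1 - snd p)) * (Y 0 (1 - snd p) / (1 - snd p) ^ m)"

lemma cone_test:
  assumes X: "test_seq X" and Y: "test_seq Y"
  shows "test_function (cone_test X Y m)"
    and "frechet_derivative (cone_test X Y m) (at (x, y)) (1, 0) = X 1 (x / (1 - y)) * (Y 0 (1 - y) / (1 - y) ^ Suc m)"
    and "frechet_derivative (cone_test X Y m) (at (x, y)) (0, 1) =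
      - (X 0 (x / (1 - y)) * (Y 1 (1 - y) / (1 - y) ^ m) - (x / (1 - y)) * X 1 (x / (1 - y)) * (Y 0 (1 - y) / (1 - y) ^ Suc m)
         - real m * X 0 (x / (1 - y)) * (Y 0 (1 - y) / (1 - y) ^ Suc m))"
proof -
  \<comment> \<open>The sign accounts for \<open>s = 1 - y\<close>.\<close>
  define D where "D i j p = (-1) ^ j * cone_partial i j X Y m (fst p, 1 - snd p)" for i j and p :: "real \<times> real"
  have D0: "D 0 0 = cone_test X Y m" by (simp add: fun_eq_iff D_def cone_test_def)
  have D: "(D i j has_derivative (\<lambda>h. D (Suc i) j p * fst h + D i (Suc j) p * snd h)) (at p)" for i j p
  proof -
    have "((\<lambda>p::real\<times>real. (fst p, 1 - snd p)) has_derivative (\<lambda>h. (fst h, - snd h))) (at p)"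
      by (auto intro!: derivative_eq_intros)
    from has_derivative_compose[OF this cone_deriv[OF X Y, of i j m "(fst p, 1 - snd p)"]]
    have "(D i j has_derivative (\<lambda>h. (-1) ^ j * (cone_partial (Suc i) j X Y m (fst p, 1 - snd p) * fst (fst h, - snd h) + cone_partial i (Suc j) X Y m (fst p, 1 - snd p) * snd (fst h, - snd h)))) (at p)"
      unfolding D_def[abs_def] by (rule has_derivative_mult_right)
    then show ?thesis
      by (rule has_derivative_eq_rhs) (simp add: D_def fun_eq_iff algebra_simps del: cone_partial.simps)
  qed
  obtain a b where ab: "0 < a" "a < b" "b < 1" "\<And>n x. x \<notin> {a..b} \<Longrightarrow> X n x = 0"
    using X unfolding test_seq_def by blast
  obtain c d where cd: "0 < c" "c < d" "d < 1" "\<And>n x. x \<notin> {c..d} \<Longrightarrow> Y n x = 0"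
    using Y unfolding test_seq_def by blast
  let ?K = "(\<lambda>(u, s). (u * s, 1 - s)) ` ({a..b} \<times> {c..d})"
  have K: "compact ?K"
    by (intro compact_continuous_image compact_Times) (auto simp: split_beta intro!: continuous_intros)
  have Kt: "?K \<subseteq> triangle"
  proof
    fix p assume "p \<in> ?K"
    then obtain q where q: "q \<in> {a..b} \<times> {c..d}" "p = (\<lambda>(u, s). (u * s, 1 - s)) q" by blast
    obtain u s where "q = (u, s)" by (cases q)
    with q have us: "p = (u * s, 1 - s)" "a \<le> u" "u \<le> b" "c \<le> s" "s \<le> d" by auto
    then have "0 < u" "u < 1" "0 < s" "s < 1" using ab cd by auto
    then show "p \<in> triangle" unfolding us(1) by (auto simp: triangle_def)
  qed
  have "{p. cone_test X Y m p \<noteq> 0} \<subseteq> ?K"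
  proof
    fix p assume "p \<in> {p. cone_test X Y m p \<noteq> 0}"
    then have p: "X 0 (fst p / (1 - snd p)) \<noteq> 0" "Y 0 (1 - snd p) \<noteq> 0" by (auto simp: cone_test_def)
    then have "fst p / (1 - snd p) \<in> {a..b}" "1 - snd p \<in> {c..d}" using ab(4) cd(4) by blast+
    moreover from this have "p = (fst p / (1 - snd p) * (1 - snd p), 1 - (1 - snd p))"
      using cd by (cases p) auto
    ultimately show "p \<in> ?K" by (intro image_eqI[of _ _ "(fst p / (1 - snd p), 1 - snd p)"]) auto
  qed
  then have cl: "closure {p. cone_test X Y m p \<noteq> 0} \<subseteq> ?K"
    using K compact_imp_closed closure_minimal by blast
  show "test_function (cone_test X Y m)"
    unfolding test_function_def smooth2_def
  proof (intro conjI)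
    show "\<exists>D. D 0 0 = cone_test X Y m \<and> (\<forall>i j p. (D i j has_derivative (\<lambda>h. D (Suc i) j p * fst h + D i (Suc j) p * snd h)) (at p))"
      using D0 D by blast
    show "compact (closure {p. cone_test X Y m p \<noteq> 0})"
      using bounded_subset[OF compact_imp_bounded[OF K] cl] by (simp add: compact_eq_bounded_closed)
    show "closure {p. cone_test X Y m p \<noteq> 0} \<subseteq> triangle" using cl Kt by blast
  qed
  have fd: "frechet_derivative (cone_test X Y m) (at p) = (\<lambda>h. D 1 0 p * fst h + D 0 1 p * snd h)" for p
    using frechet_derivative_at[OF D[of 0 0 p]] D0 by simp
  show "frechet_derivative (cone_test X Y m) (at (x, y)) (1, 0) = X 1 (x / (1 - y)) * (Y 0 (1 - y) / (1 - y) ^ Suc m)"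
    unfolding fd by (simp add: D_def)
  show "frechet_derivative (cone_test X Y m) (at (x, y)) (0, 1) =
      - (X 0 (x / (1 - y)) * (Y 1 (1 - y) / (1 - y) ^ m) - (x / (1 - y)) * X 1 (x / (1 - y)) * (Y 0 (1 - y) / (1 - y) ^ Suc m)
         - real m * X 0 (x / (1 - y)) * (Y 0 (1 - y) / (1 - y) ^ Suc m))"
    unfolding fd by (simp add: D_def euler_seq_def)
qed

section \<open>Cone coordinates on the triangle\<close>

text \<open>The area element of the triangle is \<open>s ds du\<close>: the product of these two measures under
  \<open>cone_map\<close>.\<close>

definition radial_measure :: "real measure" where
  "radial_measure = density lborel (\<lambda>s. ennreal (s * indicator {0<..<1} s))"

definition angle_measure :: "real measure" where
  "angle_measure = density lborel (\<lambda>s. ennreal (indicator {0<..<1} s))"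

abbreviation cone_measure :: "(real \<times> real) measure" where
  "cone_measure \<equiv> radial_measure \<Otimes>\<^sub>M angle_measure"

lemma sets_radial [measurable_cong, simp]: "sets radial_measure = sets borel"
  and space_radial [simp]: "space radial_measure = UNIV"
  and sets_angle [measurable_cong, simp]: "sets angle_measure = sets borel"
  and space_angle [simp]: "space angle_measure = UNIV"
  by (auto simp: radial_measure_def angle_measure_def)

lemma sets_cone: "sets cone_measure = sets (borel :: (real \<times> real) measure)"
  by (simp add: borel_prod[symmetric] cong: sets_pair_measure_cong)

lemma emeasure_angle: "emeasure angle_measure UNIV = 1"
  by (simp add: angle_measure_def emeasure_density ennreal_indicator)

interpretation angle: finite_measure angle_measure
  by standard (simp add: emeasure_angle)

lemma measure_angle [simp]: "measure angle_measure UNIV = 1"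
  using emeasure_angle by (simp add: measure_def)

lemma emeasure_radial: "emeasure radial_measure UNIV \<le> 1"
proof -
  have "emeasure radial_measure UNIV = (\<integral>\<^sup>+s. ennreal (s * indicator {0<..<1} s) \<partial>lborel)"
    by (simp add: radial_measure_def emeasure_density)
  also have "\<dots> \<le> (\<integral>\<^sup>+s. indicator {0<..<1::real} s \<partial>lborel)"
    by (intro nn_integral_mono) (auto simp: indicator_def ennreal_le_1)
  finally show ?thesis by simp
qed

interpretation radial: finite_measure radial_measure
proof
  show "emeasure radial_measure (space radial_measure) \<noteq> \<infinity>"
    using emeasure_radial by (auto simp: top_unique)
qed

interpretation cone: pair_sigma_finite radial_measure angle_measure ..

interpretation cone: finite_measure cone_measure
  by (rule finite_measure_pair_measure) unfold_locales

definition cone_map :: "real \<times> real \<Rightarrow> real \<times> real" where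
  "cone_map = (\<lambda>(s, u). (s * u, 1 - s))"

lemma cone_map_measurable [measurable]: "cone_map \<in> borel_measurable borel"
  unfolding cone_map_def by (intro borel_measurable_continuous_onI) (auto simp: split_beta intro!: continuous_intros)

lemma cone_map_measurable' [measurable]: "cone_map \<in> cone_measure \<rightarrow>\<^sub>M borel"
  using cone_map_measurable measurable_cong_sets[OF sets_cone refl] by blast

lemma cone_map_triangle: "cone_map (s, u) \<in> triangle \<longleftrightarrow> 0 < s * u \<and> s < 1 \<and> s * u < s"
  by (auto simp: cone_map_def triangle_def)

lemma cone_map_triangle': "0 < s \<Longrightarrow> s < 1 \<Longrightarrow> 0 < u \<Longrightarrow> u < 1 \<Longrightarrow> cone_map (s, u) \<in> triangle"
  by (simp add: cone_map_triangle)

lemma AE_radialI: "AE s in lborel. 0 < s \<and> s < 1 \<longrightarrow> P s \<Longrightarrow> AE s in radial_measure. P s"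
  unfolding radial_measure_def by (subst AE_density) (auto elim!: eventually_mono split: split_indicator_asm)

lemma AE_radialD: "AE s in radial_measure. P s \<Longrightarrow> AE s in lborel. 0 < s \<and> s < 1 \<longrightarrow> P s"
  unfolding radial_measure_def by (subst (asm) AE_density) (auto elim!: eventually_mono split: split_indicator_asm)

lemma AE_angleI: "AE s in lborel. 0 < s \<and> s < 1 \<longrightarrow> P s \<Longrightarrow> AE s in angle_measure. P s"
  unfolding angle_measure_def by (subst AE_density) (auto elim!: eventually_mono split: split_indicator_asm)

text \<open>Fubini and the substitutions \<open>x = s u\<close> on each slice and \<open>y = 1 - s\<close>.\<close>

lemma cone_distr: "distr cone_measure borel cone_map = density lborel (indicator triangle)"
proof (rule measure_eqI)
  fix A :: "(real \<times> real) set" assume "A \<in> sets (distr cone_measure borel cone_map)"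
  then have A [measurable]: "A \<in> sets borel" by simp
  have [measurable]: "(\<lambda>(s, u). indicator A (s * u, 1 - s) :: ennreal) \<in> borel_measurable (borel \<Otimes>\<^sub>M borel)"
    using measurable_comp[OF cone_map_measurable, of "indicator A" borel]
    by (simp add: comp_def cone_map_def case_prod_unfold borel_prod)
  have [measurable]: "(\<lambda>p. indicator A p :: ennreal) \<in> borel_measurable (borel \<Otimes>\<^sub>M borel)"
    by (simp add: borel_prod)
  have [measurable]: "triangle \<in> sets (borel \<Otimes>\<^sub>M borel)"
    unfolding borel_prod by (rule sets_triangle)
  have sub: "ennreal (s * indicator {0<..<1} s) * (\<integral>\<^sup>+u. indicator A (s * u, 1 - s) \<partial>angle_measure) =
     (\<integral>\<^sup>+x. indicator triangle (x, 1 - s) * indicator A (x, 1 - s) \<partial>lborel)" for s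
  proof (cases "0 < s \<and> s < 1")
    case True
    have "(\<integral>\<^sup>+x. indicator triangle (x, 1 - s) * indicator A (x, 1 - s) \<partial>lborel) =
       ennreal \<bar>s\<bar> * (\<integral>\<^sup>+u. indicator triangle (0 + s * u, 1 - s) * indicator A (0 + s * u, 1 - s) \<partial>lborel)"
      by (rule nn_integral_real_affine) (use True in auto)
    also have "(\<integral>\<^sup>+u. indicator triangle (0 + s * u, 1 - s) * indicator A (0 + s * u, 1 - s) \<partial>lborel) =
       (\<integral>\<^sup>+u. ennreal (indicator {0<..<1} u) * indicator A (s * u, 1 - s) \<partial>lborel)"
      using True by (intro nn_integral_cong) (auto simp: triangle_def indicator_def zero_less_mult_iff)
    also have "\<dots> = (\<integral>\<^sup>+u. indicator A (s * u, 1 - s) \<partial>angle_measure)"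
      unfolding angle_measure_def by (subst nn_integral_density) auto
    finally show ?thesis using True by simp
  next
    case False
    then have "indicator triangle (x, 1 - s) = (0::ennreal)" for x by (auto simp: triangle_def indicator_def)
    then show ?thesis using False by simp
  qed
  have "emeasure (distr cone_measure borel cone_map) A = (\<integral>\<^sup>+p. indicator A p \<partial>distr cone_measure borel cone_map)"
    by simp
  also have "\<dots> = (\<integral>\<^sup>+p. indicator A (cone_map p) \<partial>cone_measure)"
    by (rule nn_integral_distr) auto
  also have "\<dots> = (\<integral>\<^sup>+s. \<integral>\<^sup>+u. indicator A (cone_map (s, u)) \<partial>angle_measure \<partial>radial_measure)"
    by (rule angle.nn_integral_fst[symmetric]) measurable
  also have "\<dots> = (\<integral>\<^sup>+s. ennreal (s * indicator {0<..<1} s) * (\<integral>\<^sup>+u. indicator A (s * u, 1 - s) \<partial>angle_measure) \<partial>lborel)"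
    unfolding radial_measure_def by (subst nn_integral_density) (auto simp: cone_map_def)
  also have "\<dots> = (\<integral>\<^sup>+s. \<integral>\<^sup>+x. indicator triangle (x, 1 - s) * indicator A (x, 1 - s) \<partial>lborel \<partial>lborel)"
    unfolding sub ..
  also have "\<dots> = (\<integral>\<^sup>+y. \<integral>\<^sup>+x. indicator triangle (x, 1 - (1 + (-1) * y)) * indicator A (x, 1 - (1 + (-1) * y)) \<partial>lborel \<partial>lborel)"
    by (subst nn_integral_real_affine[where c = "-1" and t = 1]) auto
  also have "\<dots> = (\<integral>\<^sup>+y. \<integral>\<^sup>+x. indicator triangle (x, y) * indicator A (x, y) \<partial>lborel \<partial>lborel)" by simp
  also have "\<dots> = (\<integral>\<^sup>+p. indicator triangle p * indicator A p \<partial>(lborel \<Otimes>\<^sub>M lborel))"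
    by (rule lborel_pair.nn_integral_snd) measurable
  also have "\<dots> = (\<integral>\<^sup>+p. indicator triangle p * indicator A p \<partial>lborel)" by (simp add: lborel_prod)
  also have "\<dots> = emeasure (density lborel (indicator triangle)) A"
    by (subst emeasure_density) auto
  finally show "emeasure (distr cone_measure borel cone_map) A = emeasure (density lborel (indicator triangle)) A" .
qed simp

text \<open>The indicator turns functions that are measurable on the triangle only into functions
  that are measurable everywhere.\<close>

definition pull :: "(real \<times> real \<Rightarrow> real) \<Rightarrow> real \<times> real \<Rightarrow> real" where
  "pull f p = indicator triangle (cone_map p) * f (cone_map p)"

lemma pull_measurable [measurable]:
  assumes "f \<in> borel_measurable triangle_measure"
  shows "pull f \<in> borel_measurable cone_measure"
proof -
  have "(\<lambda>p. indicator triangle p *\<^sub>R f p) \<in> borel_measurable borel"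
    using assms by (subst (asm) borel_measurable_restrict_space_iff) auto
  from measurable_comp[OF cone_map_measurable' this] show ?thesis
    by (simp add: comp_def pull_def[abs_def])
qed

lemma
  assumes f: "f \<in> borel_measurable triangle_measure"
  shows integrable_pull: "integrable cone_measure (pull f) \<longleftrightarrow> integrable triangle_measure f"
    and integral_pull: "(LINT p|cone_measure. pull f p) = (LINT p|triangle_measure. f p)"
proof -
  let ?g = "\<lambda>p. indicator triangle p *\<^sub>R f p"
  have g [measurable]: "?g \<in> borel_measurable borel"
    using f by (subst (asm) borel_measurable_restrict_space_iff) auto
  have d: "density lborel (indicator triangle) = density lborel (\<lambda>p. ennreal (indicator triangle p))"
    by (intro arg_cong[where f = "density lborel"]) (simp add: fun_eq_iff ennreal_indicator)
  have p: "pull f = (\<lambda>p. ?g (cone_map p))" by (simp add: pull_def[abs_def])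
  have idem: "indicator triangle p *\<^sub>R (indicator triangle p *\<^sub>R f p) = indicator triangle p *\<^sub>R f p"
    and idem2: "indicator triangle p * indicator triangle p = (indicator triangle p :: real)" for p
    by (simp_all add: indicator_def)
  have "integrable cone_measure (pull f) \<longleftrightarrow> integrable (density lborel (indicator triangle)) ?g"
    unfolding p cone_distr[symmetric] by (rule integrable_distr_eq[symmetric]) (use g in simp_all)
  also have "\<dots> \<longleftrightarrow> integrable lborel ?g"
    unfolding d using g by (subst integrable_density) (simp_all add: idem idem2 del: real_scaleR_def)
  also have "\<dots> \<longleftrightarrow> integrable triangle_measure f"
    by (subst integrable_restrict_space) auto
  finally show "integrable cone_measure (pull f) \<longleftrightarrow> integrable triangle_measure f" .
  have "(LINT p|cone_measure. pull f p) = (LINT p|density lborel (indicator triangle). ?g p)"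
    unfolding p cone_distr[symmetric] by (rule integral_distr[symmetric]) (use g in simp_all)
  also have "\<dots> = (LINT p|lborel. ?g p)"
    unfolding d using g by (subst integral_density) (simp_all add: idem idem2 del: real_scaleR_def)
  also have "\<dots> = (LINT p|triangle_measure. f p)"
    by (subst integral_restrict_space) auto
  finally show "(LINT p|cone_measure. pull f p) = (LINT p|triangle_measure. f p)" .
qed

lemma AE_cone_square: "AE p in cone_measure. 0 < fst p \<and> fst p < 1 \<and> 0 < snd p \<and> snd p < 1"
proof (rule cone.AE_pair_measure)
  show "{p \<in> space cone_measure. 0 < fst p \<and> fst p < 1 \<and> 0 < snd p \<and> snd p < 1} \<in> sets cone_measure" by measurable
  have rad: "AE s in radial_measure. 0 < s \<and> s < 1" by (rule AE_radialI) simp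
  have ang: "AE u in angle_measure. 0 < u \<and> u < 1" by (rule AE_angleI) simp
  show "AE s in radial_measure. AE u in angle_measure. 0 < fst (s, u) \<and> fst (s, u) < 1 \<and> 0 < snd (s, u) \<and> snd (s, u) < 1"
    using rad
  proof (rule eventually_mono)
    fix s :: real assume "0 < s \<and> s < 1"
    then show "AE u in angle_measure. 0 < fst (s, u) \<and> fst (s, u) < 1 \<and> 0 < snd (s, u) \<and> snd (s, u) < 1"
      using ang by (auto elim: eventually_mono)
  qed
qed

lemma AE_pull:
  assumes f: "f \<in> borel_measurable triangle_measure" and z: "AE p in cone_measure. pull f p = 0"
  shows "AE p in triangle_measure. f p = 0"
proof -
  have z2: "AE p in cone_measure. pull (\<lambda>p. (f p)\<^sup>2) p = 0" using z by eventually_elim (auto simp: pull_def)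
  have m: "(\<lambda>p. (f p)\<^sup>2) \<in> borel_measurable triangle_measure" using f by measurable
  have "integrable cone_measure (pull (\<lambda>p. (f p)\<^sup>2))"
    by (subst integrable_cong_AE[OF pull_measurable[OF m] borel_measurable_const z2]) simp
  then have i: "integrable triangle_measure (\<lambda>p. (f p)\<^sup>2)" using integrable_pull[OF m] by simp
  have "(LINT p|triangle_measure. (f p)\<^sup>2) = 0"
    unfolding integral_pull[OF m, symmetric] by (rule integral_eq_zero_AE[OF z2])
  then have "AE p in triangle_measure. (f p)\<^sup>2 = 0"
    by (subst (asm) integral_nonneg_eq_0_iff_AE[OF i]) auto
  then show ?thesis by eventually_elim simp
qed

section \<open>Weak derivatives in cone coordinates\<close>

lemma square_integrable_pull:
  assumes "square_integrable f"
  shows "pull f \<in> borel_measurable cone_measure" "integrable cone_measure (\<lambda>p. (pull f p)\<^sup>2)"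
    "integrable cone_measure (pull f)" "(LINT p|cone_measure. (pull f p)\<^sup>2) = (LINT p|triangle_measure. (f p)\<^sup>2)"
    "(LINT p|cone_measure. pull f p) = (LINT p|triangle_measure. f p)"
proof -
  have m: "f \<in> borel_measurable triangle_measure" and i: "integrable triangle_measure (\<lambda>p. (f p)\<^sup>2)"
    using assms by (auto simp: square_integrable_def)
  have m2: "(\<lambda>p. (f p)\<^sup>2) \<in> borel_measurable triangle_measure" using m by measurable
  show mp: "pull f \<in> borel_measurable cone_measure" using m by (rule pull_measurable)
  have eq: "pull (\<lambda>p. (f p)\<^sup>2) = (\<lambda>p. (pull f p)\<^sup>2)" by (auto simp: pull_def fun_eq_iff indicator_def)
  show i2: "integrable cone_measure (\<lambda>p. (pull f p)\<^sup>2)" using integrable_pull[OF m2] i by (simp add: eq)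
  show "(LINT p|cone_measure. (pull f p)\<^sup>2) = (LINT p|triangle_measure. (f p)\<^sup>2)" using integral_pull[OF m2] by (simp add: eq)
  show "(LINT p|cone_measure. pull f p) = (LINT p|triangle_measure. f p)" using integral_pull[OF m] .
  show "integrable cone_measure (pull f)"
  proof (rule Bochner_Integration.integrable_bound)
    show "integrable cone_measure (\<lambda>p. 1 + (pull f p)\<^sup>2)" using i2 by simp
    have "\<bar>x\<bar> \<le> 1 + x\<^sup>2" for x :: real
      using sum_squares_bound[of "\<bar>x\<bar>" 1] by simp
    then show "AE p in cone_measure. norm (pull f p) \<le> norm (1 + (pull f p)\<^sup>2)" by simp
  qed (rule mp)
qed

lemma test_seq_bounded:
  assumes "test_seq X"
  shows "\<exists>B. \<forall>x. \<bar>X n x / x ^ m\<bar> \<le> B"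
proof -
  obtain a b where ab: "0 < a" "a < b" "b < 1" "\<And>n x. x \<notin> {a..b} \<Longrightarrow> X n x = 0"
    using assms unfolding test_seq_def by blast
  have "continuous_on {a..b} (\<lambda>x. X n x / x ^ m)"
    by (intro continuous_intros test_seq_continuous assms) (use ab in auto)
  then have "compact ((\<lambda>x. X n x / x ^ m) ` {a..b})" by (intro compact_continuous_image) auto
  then have "bounded ((\<lambda>x. X n x / x ^ m) ` {a..b})" by (rule compact_imp_bounded)
  then obtain B where "\<forall>y\<in>(\<lambda>x. X n x / x ^ m) ` {a..b}. norm y \<le> B" unfolding bounded_iff by blast
  then have B: "x \<in> {a..b} \<Longrightarrow> norm (X n x / x ^ m) \<le> B" for x by blast
  have "\<bar>X n x / x ^ m\<bar> \<le> max B 0" for x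
    using B[of x] ab(4)[of x n] by (cases "x \<in> {a..b}") auto
  then show ?thesis by (intro exI allI)
qed

lemma test_kernel:
  assumes X: "test_seq X" and Y: "test_seq Y"
  shows "(\<lambda>p. X i (snd p) * (Y j (fst p) / fst p ^ m)) \<in> borel_measurable cone_measure"
    and "F \<in> borel_measurable cone_measure \<Longrightarrow> integrable cone_measure F \<Longrightarrow>
      integrable cone_measure (\<lambda>p. F p * (X i (snd p) * (Y j (fst p) / fst p ^ m)))"
proof -
  note [measurable] = test_seq_measurable[OF X] test_seq_measurable[OF Y]
  show m: "(\<lambda>p. X i (snd p) * (Y j (fst p) / fst p ^ m)) \<in> borel_measurable cone_measure"
    by measurable
  assume F [measurable]: "F \<in> borel_measurable cone_measure" and iF: "integrable cone_measure F"
  obtain B where B: "\<And>x. \<bar>X i x / x ^ 0\<bar> \<le> B" using test_seq_bounded[OF X] by meson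
  obtain C where C: "\<And>x. \<bar>Y j x / x ^ m\<bar> \<le> C" using test_seq_bounded[OF Y] by meson
  show "integrable cone_measure (\<lambda>p. F p * (X i (snd p) * (Y j (fst p) / fst p ^ m)))"
  proof (rule Bochner_Integration.integrable_bound)
    show "integrable cone_measure (\<lambda>p. B * C * F p)" using iF by simp
    show "AE p in cone_measure. norm (F p * (X i (snd p) * (Y j (fst p) / fst p ^ m))) \<le> norm (B * C * F p)"
    proof (rule AE_I2)
      fix p
      have "\<bar>X i (snd p)\<bar> * \<bar>Y j (fst p) / fst p ^ m\<bar> \<le> B * C"
        using B[of "snd p"] C[of "fst p"] by (intro mult_mono) auto
      then have "\<bar>X i (snd p)\<bar> * \<bar>Y j (fst p) / fst p ^ m\<bar> \<le> \<bar>B * C\<bar>" by linarith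
      from mult_left_mono[OF this, of "\<bar>F p\<bar>"]
      show "norm (F p * (X i (snd p) * (Y j (fst p) / fst p ^ m))) \<le> norm (B * C * F p)"
        by (simp add: abs_mult mult_ac)
    qed
  qed (use m in measurable)
qed

lemma pull_test_integral:
  assumes f: "square_integrable f" and \<psi>: "square_integrable \<psi>"
    and K: "K \<in> borel_measurable cone_measure"
    and eq: "\<And>s u. 0 < s \<Longrightarrow> s < 1 \<Longrightarrow> 0 < u \<Longrightarrow> u < 1 \<Longrightarrow> \<psi> (s * u, 1 - s) = K (s, u)"
  shows "(LINT p|triangle_measure. f p * \<psi> p) = (LINT p|cone_measure. pull f p * K p)"
proof -
  have m: "f \<in> borel_measurable triangle_measure" "\<psi> \<in> borel_measurable triangle_measure"
    using f \<psi> by (auto simp: square_integrable_def)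
  then have m2: "(\<lambda>p. f p * \<psi> p) \<in> borel_measurable triangle_measure" by measurable
  have "(LINT p|triangle_measure. f p * \<psi> p) = (LINT p|cone_measure. pull (\<lambda>p. f p * \<psi> p) p)"
    by (rule integral_pull[OF m2, symmetric])
  also have "\<dots> = (LINT p|cone_measure. pull f p * K p)"
  proof (rule integral_cong_AE)
    show "AE p in cone_measure. pull (\<lambda>p. f p * \<psi> p) p = pull f p * K p"
      using AE_cone_square
    proof eventually_elim
      case (elim p)
      then show ?case using eq[of "fst p" "snd p"] by (auto simp: pull_def cone_map_def split_beta)
    qed
  qed (use pull_measurable[OF m2] pull_measurable[OF m(1)] K in measurable)
  finally show ?thesis .
qed

text \<open>In cone coordinates \<open>\<partial>\<^sub>x = (1/s) \<partial>\<^sub>u\<close>, which costs one power of \<open>s\<close>.\<close>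

lemma weak_x:
  assumes f: "square_integrable f" and w: "weak_deriv (1, 0) f p" and X: "test_seq X" and Y: "test_seq Y"
  shows "(LINT q|cone_measure. pull f q * (X 1 (snd q) * (Y 0 (fst q) / fst q ^ Suc m))) =
    - (LINT q|cone_measure. pull p q * (X 0 (snd q) * (Y 0 (fst q) / fst q ^ m)))"
proof -
  let ?\<phi> = "cone_test X Y m"
  note t = cone_test[OF X Y, of m]
  have p: "square_integrable p" using w by (simp add: weak_deriv_def)
  have "(LINT q|triangle_measure. f q * frechet_derivative ?\<phi> (at q) (1, 0)) =
      (LINT q|cone_measure. pull f q * (X 1 (snd q) * (Y 0 (fst q) / fst q ^ Suc m)))"
    by (rule pull_test_integral[OF f square_integrable_test_function(2)[OF t(1)] test_kernel(1)[OF X Y]])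
       (simp add: t(2))
  moreover have "(LINT q|triangle_measure. p q * ?\<phi> q) =
      (LINT q|cone_measure. pull p q * (X 0 (snd q) * (Y 0 (fst q) / fst q ^ m)))"
    by (rule pull_test_integral[OF p square_integrable_test_function(1)[OF t(1)] test_kernel(1)[OF X Y]])
       (simp add: cone_test_def)
  ultimately show ?thesis using w t(1) by (simp add: weak_deriv_def)
qed

text \<open>In cone coordinates \<open>\<partial>\<^sub>y = - \<partial>\<^sub>s + (u/s) \<partial>\<^sub>u\<close>; the first term also hits the power \<open>s ^ m\<close>
  in the denominator.\<close>

lemma weak_y:
  assumes f: "square_integrable f" and w: "weak_deriv (0, 1) f p" and X: "test_seq X" and Y: "test_seq Y"
  shows "(LINT q|cone_measure. pull f q * (X 0 (snd q) * (Y 1 (fst q) / fst q ^ m)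
       - mul_seq (\<lambda>n. X (Suc n)) 0 (snd q) * (Y 0 (fst q) / fst q ^ Suc m) - real m * (X 0 (snd q) * (Y 0 (fst q) / fst q ^ Suc m)))) =
    (LINT q|cone_measure. pull p q * (X 0 (snd q) * (Y 0 (fst q) / fst q ^ m)))"
proof -
  let ?\<phi> = "cone_test X Y m"
  note t = cone_test[OF X Y, of m]
  have p: "square_integrable p" using w by (simp add: weak_deriv_def)
  let ?K = "\<lambda>q. X 0 (snd q) * (Y 1 (fst q) / fst q ^ m)
       - mul_seq (\<lambda>n. X (Suc n)) 0 (snd q) * (Y 0 (fst q) / fst q ^ Suc m) - real m * (X 0 (snd q) * (Y 0 (fst q) / fst q ^ Suc m))"
  have K: "?K \<in> borel_measurable cone_measure"
    by (intro borel_measurable_diff borel_measurable_times borel_measurable_const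
        test_kernel(1)[OF X Y] test_kernel(1)[OF test_seq_mul[OF test_seq_Suc[OF X]] Y])
  then have K': "(\<lambda>q. - ?K q) \<in> borel_measurable cone_measure" by measurable
  have "(LINT q|triangle_measure. f q * frechet_derivative ?\<phi> (at q) (0, 1)) = (LINT q|cone_measure. pull f q * (- ?K q))"
    by (rule pull_test_integral[OF f square_integrable_test_function(2)[OF t(1)] K'])
       (simp add: t(3) mul_seq_def)
  moreover have "(LINT q|triangle_measure. p q * ?\<phi> q) =
      (LINT q|cone_measure. pull p q * (X 0 (snd q) * (Y 0 (fst q) / fst q ^ m)))"
    by (rule pull_test_integral[OF p square_integrable_test_function(1)[OF t(1)] test_kernel(1)[OF X Y]])
       (simp add: cone_test_def)
  moreover have "(LINT q|cone_measure. pull f q * (- ?K q)) = - (LINT q|cone_measure. pull f q * ?K q)"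
    by (simp only: mult_minus_right Bochner_Integration.integral_minus)
  moreover have "(LINT q|triangle_measure. f q * frechet_derivative ?\<phi> (at q) (0, 1)) = - (LINT q|triangle_measure. p q * ?\<phi> q)"
    using w t(1) unfolding weak_deriv_def by blast
  ultimately show ?thesis by linarith
qed

text \<open>Along a ray \<open>\<partial>\<^sub>s = u \<partial>\<^sub>x - \<partial>\<^sub>y\<close>. The exponent \<open>m = 1\<close> cancels the area factor \<open>s\<close>. In
  \<open>weak_y\<close> the terms without radial derivative are \<open>u X'(u) + X(u) = (u X(u))'\<close>, and \<open>weak_x\<close>
  for the test function \<open>u X(u)\<close> turns them into \<open>u P\<close>. What remains is a weak derivative in
  \<open>s\<close> alone, which needs no condition on \<open>v\<close> at the ends \<open>u = 0\<close> and \<open>u = 1\<close> of a slice.\<close>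

lemma weak_radial:
  assumes f: "square_integrable f" and px: "weak_deriv (1, 0) f p" and py: "weak_deriv (0, 1) f q"
    and X: "test_seq X" and Y: "test_seq Y"
  shows "(LINT r|cone_measure. pull f r * (X 0 (snd r) * (Y 1 (fst r) / fst r))) =
    - (LINT r|cone_measure. (snd r * pull p r - pull q r) * (X 0 (snd r) * (Y 0 (fst r) / fst r)))"
proof -
  have "square_integrable p" "square_integrable q" using px py by (auto simp: weak_deriv_def)
  note P = square_integrable_pull[OF this(1)] and Q = square_integrable_pull[OF this(2)]
  note F = square_integrable_pull[OF f]
  let ?A = "\<lambda>r. pull f r * (X 0 (snd r) * (Y 1 (fst r) / fst r ^ 1))"
  let ?B = "\<lambda>r. pull f r * (mul_seq (\<lambda>n. X (Suc n)) 0 (snd r) * (Y 0 (fst r) / fst r ^ 2))"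
  let ?C = "\<lambda>r. pull f r * (X 0 (snd r) * (Y 0 (fst r) / fst r ^ 2))"
  have i: "integrable cone_measure ?A" "integrable cone_measure ?B" "integrable cone_measure ?C"
    by (rule test_kernel(2)[OF X Y F(1,3)] test_kernel(2)[OF test_seq_mul[OF test_seq_Suc[OF X]] Y F(1,3)])+
  have "(LINT r|cone_measure. ?A r) - (LINT r|cone_measure. ?B r) - (LINT r|cone_measure. ?C r) = (LINT r|cone_measure. ?A r - ?B r - ?C r)"
    using i by simp
  also have "\<dots> = (LINT r|cone_measure. pull q r * (X 0 (snd r) * (Y 0 (fst r) / fst r ^ 1)))"
    unfolding weak_y[OF f py X Y, of 1, symmetric]
    by (rule Bochner_Integration.integral_cong) (simp_all add: right_diff_distrib numeral_2_eq_2)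
  finally have 1: "(LINT r|cone_measure. ?A r) - (LINT r|cone_measure. ?B r) - (LINT r|cone_measure. ?C r) =
     (LINT r|cone_measure. pull q r * (X 0 (snd r) * (Y 0 (fst r) / fst r ^ 1)))" .
  have "(LINT r|cone_measure. ?B r) + (LINT r|cone_measure. ?C r) = (LINT r|cone_measure. ?B r + ?C r)"
    using i by simp
  also have "\<dots> = (LINT r|cone_measure. pull f r * (mul_seq X 1 (snd r) * (Y 0 (fst r) / fst r ^ Suc 1)))"
    by (rule Bochner_Integration.integral_cong) (simp_all add: mul_seq_def distrib_left distrib_right add_divide_distrib numeral_2_eq_2)
  also have "\<dots> = - (LINT r|cone_measure. pull p r * (mul_seq X 0 (snd r) * (Y 0 (fst r) / fst r ^ 1)))"
    by (rule weak_x[OF f px test_seq_mul[OF X] Y])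
  also have "(LINT r|cone_measure. pull p r * (mul_seq X 0 (snd r) * (Y 0 (fst r) / fst r ^ 1))) =
     (LINT r|cone_measure. snd r * pull p r * (X 0 (snd r) * (Y 0 (fst r) / fst r ^ 1)))"
    by (rule Bochner_Integration.integral_cong) (simp_all add: mul_seq_def)
  finally have 2: "(LINT r|cone_measure. ?B r) + (LINT r|cone_measure. ?C r) =
     - (LINT r|cone_measure. snd r * pull p r * (X 0 (snd r) * (Y 0 (fst r) / fst r ^ 1)))" .
  have "integrable cone_measure (\<lambda>r. pull p r * (mul_seq X 0 (snd r) * (Y 0 (fst r) / fst r ^ 1)))"
    by (rule test_kernel(2)[OF test_seq_mul[OF X] Y P(1,3)])
  then have i2: "integrable cone_measure (\<lambda>r. snd r * pull p r * (X 0 (snd r) * (Y 0 (fst r) / fst r ^ 1)))"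
    by (rule Bochner_Integration.integrable_cong[THEN iffD1, rotated 2]) (simp_all add: mul_seq_def)
  have "integrable cone_measure (\<lambda>r. pull q r * (X 0 (snd r) * (Y 0 (fst r) / fst r ^ 1)))"
    by (rule test_kernel(2)[OF X Y Q(1,3)])
  with i2 have "(LINT r|cone_measure. (snd r * pull p r - pull q r) * (X 0 (snd r) * (Y 0 (fst r) / fst r ^ 1))) =
     (LINT r|cone_measure. snd r * pull p r * (X 0 (snd r) * (Y 0 (fst r) / fst r ^ 1))) - (LINT r|cone_measure. pull q r * (X 0 (snd r) * (Y 0 (fst r) / fst r ^ 1)))"
    unfolding left_diff_distrib by (rule Bochner_Integration.integral_diff)
  with 1 2 show ?thesis by simp
qed

lemma radial_integral: 
  fixes h :: "real \<Rightarrow> real"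
  assumes "h \<in> borel_measurable borel"
  shows "(LINT s|radial_measure. h s) = (LINT s|lborel. s * indicator {0<..<1} s * h s)"
    and "integrable radial_measure h \<longleftrightarrow> integrable lborel (\<lambda>s. s * indicator {0<..<1} s * h s)"
  unfolding radial_measure_def using assms
  by (auto simp: integral_real_density integrable_real_density indicator_def)

lemma angle_integral: 
  fixes h :: "real \<Rightarrow> real"
  assumes "h \<in> borel_measurable borel"
  shows "(LINT s|angle_measure. h s) = (LINT s|lborel. indicator {0<..<1} s * h s)"
    and "integrable angle_measure h \<longleftrightarrow> integrable lborel (\<lambda>s. indicator {0<..<1} s * h s)"
proof -
  show "(LINT s|angle_measure. h s) = (LINT s|lborel. indicator {0<..<1} s * h s)"
    unfolding angle_measure_def by (rule integral_real_density) (use assms in auto)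
  show "integrable angle_measure h \<longleftrightarrow> integrable lborel (\<lambda>s. indicator {0<..<1} s * h s)"
    unfolding angle_measure_def by (rule integrable_real_density) (use assms in auto)
qed

lemma locally_integrable_radial:
  assumes m: "h \<in> borel_measurable borel" and h: "integrable radial_measure h"
  shows "locally_integrable h"
  unfolding locally_integrable_def
proof (intro allI impI)
  fix a b :: real assume ab: "0 < a" "a < b" "b < 1"
  have "set_integrable lborel {a..b} (\<lambda>s. s * indicator {0<..<1} s * h s)"
    using h unfolding radial_integral(2)[OF m] set_integrable_def
    by (rule integrable_mult_indicator[rotated]) simp
  moreover have "continuous_on {a..b} (\<lambda>s. 1 / s)"
    using ab by (auto intro!: continuous_intros)
  ultimately have "set_integrable lborel {a..b} (\<lambda>s. s * indicator {0<..<1} s * h s * (1 / s))"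
    by (rule set_integrable_mult_continuous)
  then show "set_integrable lborel {a..b} h"
    unfolding set_integrable_def
    by (rule Bochner_Integration.integrable_cong[THEN iffD1, rotated 2]) (use ab in \<open>auto simp: indicator_def\<close>)
qed

lemma locally_integrable_angle:
  assumes m: "h \<in> borel_measurable borel" and h: "integrable angle_measure h"
  shows "locally_integrable h"
  unfolding locally_integrable_def
proof (intro allI impI)
  fix a b :: real assume ab: "0 < a" "a < b" "b < 1"
  have "set_integrable lborel {a..b} (\<lambda>s. indicator {0<..<1} s * h s)"
    using h unfolding angle_integral(2)[OF m] set_integrable_def
    by (rule integrable_mult_indicator[rotated]) simp
  then show "set_integrable lborel {a..b} h"
    unfolding set_integrable_def
    by (rule Bochner_Integration.integrable_cong[THEN iffD1, rotated 2]) (use ab in \<open>auto simp: indicator_def\<close>)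
qed

lemma test_seq_radial_integral:
  assumes m: "h \<in> borel_measurable borel" and Y: "test_seq Y"
  shows "(LINT s|radial_measure. h s * (Y n s / s)) = (LINT s|lborel. h s * Y n s)"
proof -
  obtain a b where ab: "0 < a" "a < b" "b < 1" "\<And>n x. x \<notin> {a..b} \<Longrightarrow> Y n x = 0"
    using Y unfolding test_seq_def by blast
  note [measurable] = test_seq_measurable[OF Y] m
  have "(LINT s|radial_measure. h s * (Y n s / s)) = (LINT s|lborel. s * indicator {0<..<1} s * (h s * (Y n s / s)))"
    by (rule radial_integral(1)) measurable
  also have "\<dots> = (LINT s|lborel. h s * Y n s)"
  proof (rule Bochner_Integration.integral_cong)
    fix s show "s * indicator {0<..<1} s * (h s * (Y n s / s)) = h s * Y n s"
      by (cases "s \<in> {a..b}") (use ab in \<open>auto simp: indicator_def\<close>)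
  qed simp
  finally show ?thesis .
qed

lemma test_seq_angle_integral:
  assumes m: "h \<in> borel_measurable borel" and Y: "test_seq Y"
  shows "(LINT s|angle_measure. h s * Y n s) = (LINT s|lborel. h s * Y n s)"
proof -
  obtain a b where ab: "0 < a" "a < b" "b < 1" "\<And>n x. x \<notin> {a..b} \<Longrightarrow> Y n x = 0"
    using Y unfolding test_seq_def by blast
  note [measurable] = test_seq_measurable[OF Y] m
  have "(LINT s|angle_measure. h s * Y n s) = (LINT s|lborel. indicator {0<..<1} s * (h s * Y n s))"
    by (rule angle_integral(1)) measurable
  also have "\<dots> = (LINT s|lborel. h s * Y n s)"
  proof (rule Bochner_Integration.integral_cong)
    fix s show "indicator {0<..<1} s * (h s * Y n s) = h s * Y n s"
      by (cases "s \<in> {a..b}") (use ab in \<open>auto simp: indicator_def\<close>)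
  qed simp
  finally show ?thesis .
qed

text \<open>The fundamental lemma in \<open>u\<close>: it permits passing from compactly supported functions of
  the slope to the constant function \<open>1\<close>.\<close>

lemma angular_test:
  assumes F: "integrable cone_measure F" and 0: "\<And>X. test_seq X \<Longrightarrow> (LINT r|cone_measure. F r * X 0 (snd r)) = 0"
  shows "(LINT r|cone_measure. F r) = 0"
proof -
  define H where "H u = (LINT s|radial_measure. F (s, u))" for u
  have F': "integrable (radial_measure \<Otimes>\<^sub>M angle_measure) (case_prod (\<lambda>s u. F (s, u)))" using F by simp
  have iH: "integrable angle_measure H" unfolding H_def by (rule cone.integrable_snd[OF F'])
  then have mH: "H \<in> borel_measurable borel" by auto
  have "AE u in lborel. 0 < u \<and> u < 1 \<longrightarrow> H u = 0"
  proof (rule fundamental_lemma[OF locally_integrable_angle[OF mH iH]])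
    fix a b :: real and N assume ab: "0 < a" "a < b" "b < 1"
    then obtain X where X: "test_seq X" "X 0 = bump a b N" using bump_test_seq by blast
    note [measurable] = test_seq_measurable[OF X(1)] borel_measurable_integrable[OF F]
    obtain B where B: "\<And>x. \<bar>X 0 x / x ^ 0\<bar> \<le> B" using test_seq_bounded[OF X(1)] by meson
    have iFX: "integrable cone_measure (\<lambda>r. F r * X 0 (snd r))"
    proof (rule Bochner_Integration.integrable_bound)
      show "integrable cone_measure (\<lambda>r. B * F r)" using F by simp
      show "AE r in cone_measure. norm (F r * X 0 (snd r)) \<le> norm (B * F r)"
      proof (rule AE_I2)
        fix r show "norm (F r * X 0 (snd r)) \<le> norm (B * F r)"
          using mult_left_mono[OF order_trans[OF B[of "snd r"] abs_ge_self], of "\<bar>F r\<bar>"] by (simp add: abs_mult mult_ac)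
      qed
    qed measurable
    then have iFX': "integrable (radial_measure \<Otimes>\<^sub>M angle_measure) (case_prod (\<lambda>s u. F (s, u) * X 0 u))"
      by (simp add: case_prod_unfold)
    have "(LINT u|lborel. H u * bump a b N u) = (LINT u|angle_measure. H u * X 0 u)"
      using test_seq_angle_integral[OF mH X(1), of 0] unfolding X(2) by simp
    also have "\<dots> = (LINT u|angle_measure. LINT s|radial_measure. F (s, u) * X 0 u)"
      by (simp add: H_def)
    also have "\<dots> = (LINT r|cone_measure. F r * X 0 (snd r))"
      using cone.integral_snd[OF iFX'] by (simp add: case_prod_unfold)
    finally show "(LINT u|lborel. H u * bump a b N u) = 0" using 0[OF X(1)] by simp
  qed
  then have "AE u in angle_measure. H u = 0" by (rule AE_angleI)
  then have "(LINT u|angle_measure. H u) = 0" by (rule integral_eq_zero_AE)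
  then show ?thesis using cone.integral_snd[OF F'] by (simp add: H_def)
qed

text \<open>The fundamental lemma in \<open>s\<close>: an identity tested with functions of \<open>s\<close> holds on almost
  every slice.\<close>

lemma radial_test:
  assumes F: "integrable cone_measure F" and 0: "\<And>Y. test_seq Y \<Longrightarrow> (LINT r|cone_measure. F r * (Y 0 (fst r) / fst r)) = 0"
  shows "AE s in radial_measure. (LINT u|angle_measure. F (s, u)) = 0"
proof -
  define H where "H s = (LINT u|angle_measure. F (s, u))" for s
  have F': "integrable (radial_measure \<Otimes>\<^sub>M angle_measure) (case_prod (\<lambda>s u. F (s, u)))" using F by simp
  have iH: "integrable radial_measure H" unfolding H_def by (rule cone.integrable_fst[OF F'])
  then have mH: "H \<in> borel_measurable borel" by auto
  have "AE s in lborel. 0 < s \<and> s < 1 \<longrightarrow> H s = 0"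
  proof (rule fundamental_lemma[OF locally_integrable_radial[OF mH iH]])
    fix a b :: real and N assume ab: "0 < a" "a < b" "b < 1"
    then obtain X where X: "test_seq X" "X 0 = bump a b N" using bump_test_seq by blast
    note [measurable] = test_seq_measurable[OF X(1)] borel_measurable_integrable[OF F]
    obtain B where B: "\<And>x. \<bar>X 0 x / x ^ 1\<bar> \<le> B" using test_seq_bounded[OF X(1)] by meson
    have iFX: "integrable cone_measure (\<lambda>r. F r * (X 0 (fst r) / fst r))"
    proof (rule Bochner_Integration.integrable_bound)
      show "integrable cone_measure (\<lambda>r. B * F r)" using F by simp
      show "AE r in cone_measure. norm (F r * (X 0 (fst r) / fst r)) \<le> norm (B * F r)"
      proof (rule AE_I2)
        fix r show "norm (F r * (X 0 (fst r) / fst r)) \<le> norm (B * F r)"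
          using mult_left_mono[OF order_trans[OF B[of "fst r"] abs_ge_self], of "\<bar>F r\<bar>"] by (simp add: abs_mult mult_ac)
      qed
    qed measurable
    then have iFX': "integrable (radial_measure \<Otimes>\<^sub>M angle_measure) (case_prod (\<lambda>s u. F (s, u) * (X 0 s / s)))"
      by (simp add: case_prod_unfold)
    have "(LINT s|lborel. H s * bump a b N s) = (LINT s|radial_measure. H s * (X 0 s / s))"
      using test_seq_radial_integral[OF mH X(1), of 0] unfolding X(2) by simp
    also have "\<dots> = (LINT s|radial_measure. LINT u|angle_measure. F (s, u) * (X 0 s / s))"
      by (simp add: H_def)
    also have "\<dots> = (LINT r|cone_measure. F r * (X 0 (fst r) / fst r))"
      using cone.integral_fst[OF iFX'] by (simp add: case_prod_unfold)
    finally show "(LINT s|lborel. H s * bump a b N s) = 0" using 0[OF X(1)] by simp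
  qed
  then show ?thesis unfolding H_def by (rule AE_radialI)
qed

section \<open>Slice means and slices\<close>

lemma integrable_mult_bounded:
  fixes F K :: "'a \<Rightarrow> real"
  assumes "integrable M F" "K \<in> borel_measurable M" "\<And>x. \<bar>K x\<bar> \<le> B"
  shows "integrable M (\<lambda>x. F x * K x)"
proof (rule Bochner_Integration.integrable_bound)
  show "integrable M (\<lambda>x. B * F x)" using assms by simp
  show "AE x in M. norm (F x * K x) \<le> norm (B * F x)"
  proof (rule AE_I2)
    fix x show "norm (F x * K x) \<le> norm (B * F x)"
      using mult_left_mono[OF order_trans[OF assms(3)[of x] abs_ge_self], of "\<bar>F x\<bar>"] by (simp add: abs_mult mult_ac)
  qed
qed (use assms in measurable)

lemma cone_section:
  fixes F :: "real \<times> real \<Rightarrow> real"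
  assumes F: "integrable cone_measure F"
  shows "AE s in radial_measure. integrable angle_measure (\<lambda>u. F (s, u))"
    and "integrable radial_measure (\<lambda>s. LINT u|angle_measure. F (s, u))"
    and "(LINT s|radial_measure. LINT u|angle_measure. F (s, u)) = (LINT r|cone_measure. F r)"
  using cone.AE_integrable_fst'[OF F] cone.integrable_fst'[OF F] cone.integral_fst'[OF F] by auto

definition slice_mean :: "(real \<times> real \<Rightarrow> real) \<Rightarrow> real \<Rightarrow> real" where
  "slice_mean F s = (LINT u|angle_measure. F (s, u))"

lemma radial_derivative_integrable:
  assumes p: "square_integrable p" and q: "square_integrable q"
  shows "integrable cone_measure (\<lambda>r. snd r * pull p r - pull q r)"
    "(\<lambda>r. snd r * pull p r - pull q r) \<in> borel_measurable cone_measure"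
    "integrable cone_measure (\<lambda>r. snd r * pull p r)"
proof -
  note P = square_integrable_pull[OF p] and Q = square_integrable_pull[OF q]
  note [measurable] = P(1) Q(1)
  show i: "integrable cone_measure (\<lambda>r. snd r * pull p r)"
  proof (rule Bochner_Integration.integrable_bound[OF P(3)])
    show "AE r in cone_measure. norm (snd r * pull p r) \<le> norm (pull p r)"
      using AE_cone_square by eventually_elim (auto simp: abs_mult intro!: mult_left_le_one_le)
  qed measurable
  show "integrable cone_measure (\<lambda>r. snd r * pull p r - pull q r)" using i Q(3) by simp
  show "(\<lambda>r. snd r * pull p r - pull q r) \<in> borel_measurable cone_measure" by measurable
qed

text \<open>The radial identity \<open>weak_radial\<close>, freed from the angular test function by
  \<open>angular_test\<close>, says that \<open>g\<close> is the weak derivative of the slice mean.\<close>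

lemma slice_mean_primitive:
  assumes f: "square_integrable f" and px: "weak_deriv (1, 0) f p" and qy: "weak_deriv (0, 1) f q"
  defines "g \<equiv> slice_mean (\<lambda>r. snd r * pull p r - pull q r)"
  shows "\<exists>c. AE s in lborel. 0 < s \<and> s < 1 \<longrightarrow> slice_mean (pull f) s = c + antideriv g s"
    and "locally_integrable g"
proof -
  have p: "square_integrable p" and q: "square_integrable q" using px qy by (auto simp: weak_deriv_def)
  note F = square_integrable_pull[OF f] and G = radial_derivative_integrable[OF p q]
  have ia: "integrable radial_measure (slice_mean (pull f))" and ig: "integrable radial_measure g"
    using cone_section(2)[OF F(3)] cone_section(2)[OF G(1)] by (auto simp: slice_mean_def[abs_def] g_def)
  have ma: "slice_mean (pull f) \<in> borel_measurable borel" and mg: "g \<in> borel_measurable borel"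
    using borel_measurable_integrable[OF ia] borel_measurable_integrable[OF ig] by auto
  show lg: "locally_integrable g" by (rule locally_integrable_radial[OF mg ig])
  have la: "locally_integrable (slice_mean (pull f))" by (rule locally_integrable_radial[OF ma ia])
  have key: "(LINT s|lborel. slice_mean (pull f) s * Y 1 s) = - (LINT s|lborel. g s * Y 0 s)" if Y: "test_seq Y" for Y
  proof -
    note [measurable] = test_seq_measurable[OF Y] F(1) G(2)
    let ?K = "\<lambda>j r. Y j (fst r) / fst r"
    have bK: "\<exists>B. \<forall>x. \<bar>Y j x / x\<bar> \<le> B" for j using test_seq_bounded[OF Y, of j 1] by simp
    have i1: "integrable cone_measure (\<lambda>r. pull f r * ?K 1 r)"
    proof -
      obtain B where "\<And>x. \<bar>Y 1 x / x\<bar> \<le> B" using bK by blast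
      then show ?thesis by (intro integrable_mult_bounded[OF F(3), of _ B]) auto
    qed
    have i2: "integrable cone_measure (\<lambda>r. (snd r * pull p r - pull q r) * ?K 0 r)"
    proof -
      obtain B where "\<And>x. \<bar>Y 0 x / x\<bar> \<le> B" using bK by blast
      then show ?thesis by (intro integrable_mult_bounded[OF G(1), of _ B]) auto
    qed
    have "(LINT r|cone_measure. pull f r * ?K 1 r + (snd r * pull p r - pull q r) * ?K 0 r) = 0"
    proof (rule angular_test)
      show "integrable cone_measure (\<lambda>r. pull f r * ?K 1 r + (snd r * pull p r - pull q r) * ?K 0 r)"
        using i1 i2 by (rule Bochner_Integration.integrable_add)
      fix X assume X: "test_seq X"
      note k = test_kernel(2)[OF X Y F(1,3), of 0 1 1] test_kernel(2)[OF X Y G(2,1), of 0 0 1]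
      have "(LINT r|cone_measure. (pull f r * ?K 1 r + (snd r * pull p r - pull q r) * ?K 0 r) * X 0 (snd r)) =
         (LINT r|cone_measure. pull f r * (X 0 (snd r) * (Y 1 (fst r) / fst r ^ 1)) + (snd r * pull p r - pull q r) * (X 0 (snd r) * (Y 0 (fst r) / fst r ^ 1)))"
        by (rule Bochner_Integration.integral_cong) (simp_all add: distrib_right distrib_left mult_ac)
      also have "\<dots> = (LINT r|cone_measure. pull f r * (X 0 (snd r) * (Y 1 (fst r) / fst r ^ 1)))
          + (LINT r|cone_measure. (snd r * pull p r - pull q r) * (X 0 (snd r) * (Y 0 (fst r) / fst r ^ 1)))"
        by (rule Bochner_Integration.integral_add[OF k])
      finally show "(LINT r|cone_measure. (pull f r * ?K 1 r + (snd r * pull p r - pull q r) * ?K 0 r) * X 0 (snd r)) = 0"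
        using weak_radial[OF f px qy X Y] by simp
    qed
    then have "(LINT r|cone_measure. pull f r * ?K 1 r) + (LINT r|cone_measure. (snd r * pull p r - pull q r) * ?K 0 r) = 0"
      using i1 i2 by simp
    moreover have "(LINT r|cone_measure. pull f r * ?K 1 r) = (LINT s|lborel. slice_mean (pull f) s * Y 1 s)"
    proof -
      have "(LINT r|cone_measure. pull f r * ?K 1 r) = (LINT s|radial_measure. LINT u|angle_measure. pull f (s, u) * ?K 1 (s, u))"
        by (rule cone_section(3)[OF i1, symmetric])
      also have "\<dots> = (LINT s|radial_measure. slice_mean (pull f) s * (Y 1 s / s))" by (simp add: slice_mean_def)
      finally show ?thesis using test_seq_radial_integral[OF ma Y, of 1] by simp
    qed
    moreover have "(LINT r|cone_measure. (snd r * pull p r - pull q r) * ?K 0 r) = (LINT s|lborel. g s * Y 0 s)"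
    proof -
      have "(LINT r|cone_measure. (snd r * pull p r - pull q r) * ?K 0 r) = (LINT s|radial_measure. LINT u|angle_measure. (snd (s, u) * pull p (s, u) - pull q (s, u)) * ?K 0 (s, u))"
        by (rule cone_section(3)[OF i2, symmetric])
      also have "\<dots> = (LINT s|radial_measure. LINT u|angle_measure. (snd (s, u) * pull p (s, u) - pull q (s, u)) * (Y 0 s / s))" by simp
      also have "\<dots> = (LINT s|radial_measure. g s * (Y 0 s / s))"
        unfolding g_def slice_mean_def by (rule Bochner_Integration.integral_cong[OF refl]) (rule integral_mult_left_zero)
      finally show ?thesis using test_seq_radial_integral[OF mg Y, of 0] by simp
    qed
    ultimately show ?thesis by simp
  qed
  show "\<exists>c. AE s in lborel. 0 < s \<and> s < 1 \<longrightarrow> slice_mean (pull f) s = c + antideriv g s"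
    by (rule du_bois_reymond[OF la lg]) (rule key[OF dipole(1)])
qed

text \<open>The horizontal derivative is inherited by almost every slice. For each single dipole the
  weak identity holds outside a null set of \<open>s\<close>; the dipoles with rational end points are
  countably many, so one null set serves all of them and du Bois-Reymond applies on each
  remaining slice.\<close>

lemma slice_primitive:
  assumes f: "square_integrable f" and px: "weak_deriv (1, 0) f p"
  shows "AE s in radial_measure. \<exists>c. AE u in lborel. 0 < u \<and> u < 1 \<longrightarrow>
    pull f (s, u) = c + antideriv (\<lambda>u. s * pull p (s, u)) u"
proof -
  have p: "square_integrable p" using px by (auto simp: weak_deriv_def)
  note F = square_integrable_pull[OF f] and P = square_integrable_pull[OF p]
  define S where "S = {(a, b, N::nat). a \<in> \<rat> \<and> b \<in> \<rat> \<and> 0 < a \<and> a < b \<and> b < (1::real)}"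
  have cS: "countable S"
    by (rule countable_subset[of _ "\<rat> \<times> \<rat> \<times> UNIV"]) (auto simp: S_def intro!: countable_SIGMA countable_rat)
  have one: "AE s in radial_measure. (LINT u|angle_measure. pull f (s, u) * X 1 u + s * pull p (s, u) * X 0 u) = 0"
    if X: "test_seq X" for X
  proof -
    note [measurable] = test_seq_measurable[OF X] F(1) P(1)
    have bX: "\<exists>B. \<forall>x. \<bar>X j x\<bar> \<le> B" for j using test_seq_bounded[OF X, of j 0] by simp
    have i1: "integrable cone_measure (\<lambda>r. pull f r * X 1 (snd r))"
    proof -
      obtain B where "\<And>x. \<bar>X 1 x\<bar> \<le> B" using bX by blast
      then show ?thesis by (intro integrable_mult_bounded[OF F(3), of _ B]) auto
    qed
    have sP: "integrable cone_measure (\<lambda>r. fst r * pull p r)"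
    proof (rule Bochner_Integration.integrable_bound[OF P(3)])
      show "AE r in cone_measure. norm (fst r * pull p r) \<le> norm (pull p r)"
        using AE_cone_square by eventually_elim (auto simp: abs_mult intro!: mult_left_le_one_le)
    qed measurable
    have i2: "integrable cone_measure (\<lambda>r. fst r * pull p r * X 0 (snd r))"
    proof -
      obtain B where "\<And>x. \<bar>X 0 x\<bar> \<le> B" using bX by blast
      then show ?thesis by (intro integrable_mult_bounded[OF sP, of _ B]) auto
    qed
    have "AE s in radial_measure. (LINT u|angle_measure. (\<lambda>r. pull f r * X 1 (snd r) + fst r * pull p r * X 0 (snd r)) (s, u)) = 0"
    proof (rule radial_test)
      show "integrable cone_measure (\<lambda>r. pull f r * X 1 (snd r) + fst r * pull p r * X 0 (snd r))"
        using i1 i2 by (rule Bochner_Integration.integrable_add)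
      fix Y assume Y: "test_seq Y"
      have k1: "integrable cone_measure (\<lambda>r. pull f r * (X 1 (snd r) * (Y 0 (fst r) / fst r ^ Suc 0)))"
        by (rule test_kernel(2)[OF X Y F(1,3)])
      have k2: "integrable cone_measure (\<lambda>r. pull p r * (X 0 (snd r) * (Y 0 (fst r) / fst r ^ 0)))"
        by (rule test_kernel(2)[OF X Y P(1,3)])
      have "(LINT r|cone_measure. (pull f r * X 1 (snd r) + fst r * pull p r * X 0 (snd r)) * (Y 0 (fst r) / fst r)) =
        (LINT r|cone_measure. pull f r * (X 1 (snd r) * (Y 0 (fst r) / fst r ^ Suc 0)) + pull p r * (X 0 (snd r) * (Y 0 (fst r) / fst r ^ 0)))"
      proof (rule integral_cong_AE)
        show "AE r in cone_measure. (pull f r * X 1 (snd r) + fst r * pull p r * X 0 (snd r)) * (Y 0 (fst r) / fst r) =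
           pull f r * (X 1 (snd r) * (Y 0 (fst r) / fst r ^ Suc 0)) + pull p r * (X 0 (snd r) * (Y 0 (fst r) / fst r ^ 0))"
          using AE_cone_square by eventually_elim (simp add: distrib_right add_divide_distrib)
        note [measurable] = test_seq_measurable[OF Y]
        show "(\<lambda>r. (pull f r * X 1 (snd r) + fst r * pull p r * X 0 (snd r)) * (Y 0 (fst r) / fst r)) \<in> borel_measurable cone_measure"
          by measurable
      qed (intro borel_measurable_add borel_measurable_integrable k1 k2)
      also have "\<dots> = (LINT r|cone_measure. pull f r * (X 1 (snd r) * (Y 0 (fst r) / fst r ^ Suc 0))) + (LINT r|cone_measure. pull p r * (X 0 (snd r) * (Y 0 (fst r) / fst r ^ 0)))"
        by (rule Bochner_Integration.integral_add[OF k1 k2])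
      finally show "(LINT r|cone_measure. (pull f r * X 1 (snd r) + fst r * pull p r * X 0 (snd r)) * (Y 0 (fst r) / fst r)) = 0"
        using weak_x[OF f px X Y, of 0] by simp
    qed
    then show ?thesis by simp
  qed
  have "AE s in radial_measure. \<forall>(a, b, N)\<in>S. (LINT u|angle_measure. pull f (s, u) * dipole a b N 1 u + s * pull p (s, u) * dipole a b N 0 u) = 0"
    by (subst AE_ball_countable[OF cS]) (auto simp: S_def simp del: One_nat_def intro!: one dipole(1))
  moreover have "AE s in radial_measure. 0 < s \<and> s < 1" by (rule AE_radialI) simp
  ultimately show ?thesis using cone_section(1)[OF F(3)] cone_section(1)[OF P(3)]
  proof eventually_elim
    case (elim s)
    have mf: "(\<lambda>u. pull f (s, u)) \<in> borel_measurable borel" and mp: "(\<lambda>u. s * pull p (s, u)) \<in> borel_measurable borel"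
      using borel_measurable_integrable[OF elim(3)] borel_measurable_integrable[OF elim(4)] by auto
    have ip: "integrable angle_measure (\<lambda>u. s * pull p (s, u))" using elim(4) by simp
    show ?case
    proof (rule du_bois_reymond)
      show "locally_integrable (\<lambda>u. pull f (s, u))" by (rule locally_integrable_angle[OF mf elim(3)])
      show "locally_integrable (\<lambda>u. s * pull p (s, u))" by (rule locally_integrable_angle[OF mp ip])
      fix a b :: real and N assume ab: "a \<in> \<rat>" "b \<in> \<rat>" "0 < a" "a < b" "b < 1"
      let ?X = "dipole a b N"
      have X: "test_seq ?X" by (rule dipole(1)[OF ab(3-5)])
      note [measurable] = test_seq_measurable[OF X]
      have b: "\<exists>B. \<forall>x. \<bar>?X j x\<bar> \<le> B" for j using test_seq_bounded[OF X, of j 0] by simp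
      have i1: "integrable angle_measure (\<lambda>u. pull f (s, u) * ?X 1 u)"
        using b[of 1] integrable_mult_bounded[OF elim(3), of "?X 1"] by auto
      have i2: "integrable angle_measure (\<lambda>u. s * pull p (s, u) * ?X 0 u)"
        using b[of 0] integrable_mult_bounded[OF ip, of "?X 0"] by auto
      have "(LINT u|angle_measure. pull f (s, u) * ?X 1 u + s * pull p (s, u) * ?X 0 u) = 0"
        using elim(1) ab by (auto simp: S_def)
      then have "(LINT u|angle_measure. pull f (s, u) * ?X 1 u) + (LINT u|angle_measure. s * pull p (s, u) * ?X 0 u) = 0"
        using i1 i2 by (simp only: Bochner_Integration.integral_add)
      then show "(LINT u|lborel. pull f (s, u) * ?X 1 u) = - (LINT u|lborel. s * pull p (s, u) * ?X 0 u)"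
        unfolding test_seq_angle_integral[OF mf X] test_seq_angle_integral[OF mp X] by simp
    qed
  qed
qed

text \<open>The difference annihilates all products of test functions in cone coordinates.
  Countability of the rational bumps gives vanishing on almost every slice, and Fubini
  finishes.\<close>

lemma weak_deriv_unique:
  assumes g: "weak_deriv e f g" and g': "weak_deriv e f g'"
  shows "AE p in triangle_measure. g p = g' p"
proof -
  define d where "d p = g p + -1 * g' p" for p
  have sg: "square_integrable g" "square_integrable g'" using g g' by (auto simp: weak_deriv_def)
  have d: "square_integrable d" unfolding d_def by (intro square_integrable_add square_integrable_scale sg)
  have 0: "(LINT p|triangle_measure. d p * \<phi> p) = 0" if t: "test_function \<phi>" for \<phi>
  proof -
    have "(LINT p|triangle_measure. d p * \<phi> p) = (LINT p|triangle_measure. g p * \<phi> p - g' p * \<phi> p)"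
      by (simp add: d_def left_diff_distrib)
    also have "\<dots> = (LINT p|triangle_measure. g p * \<phi> p) - (LINT p|triangle_measure. g' p * \<phi> p)"
      by (intro Bochner_Integration.integral_diff square_integrable_mult sg square_integrable_test_function(1)[OF t])
    also have "\<dots> = 0"
    proof -
      have "(LINT p|triangle_measure. f p * frechet_derivative \<phi> (at p) e) = - (LINT p|triangle_measure. g p * \<phi> p)"
        using g t unfolding weak_deriv_def by blast
      moreover have "(LINT p|triangle_measure. f p * frechet_derivative \<phi> (at p) e) = - (LINT p|triangle_measure. g' p * \<phi> p)"
        using g' t unfolding weak_deriv_def by blast
      ultimately show ?thesis by linarith
    qed
    finally show ?thesis .
  qed
  note D = square_integrable_pull[OF d]
  define S where "S = {(a, b, N::nat). a \<in> \<rat> \<and> b \<in> \<rat> \<and> 0 < a \<and> a < b \<and> b < (1::real)}"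
  have cS: "countable S"
    by (rule countable_subset[of _ "\<rat> \<times> \<rat> \<times> UNIV"]) (auto simp: S_def intro!: countable_SIGMA countable_rat)
  have one: "AE s in radial_measure. (LINT u|angle_measure. pull d (s, u) * bump a b N u) = 0"
    if ab: "0 < a" "a < b" "b < 1" for a b N
  proof -
    obtain X where X: "test_seq X" "X 0 = bump a b N" using bump_test_seq[OF ab] by blast
    have "AE s in radial_measure. (LINT u|angle_measure. (\<lambda>r. pull d r * bump a b N (snd r)) (s, u)) = 0"
    proof (rule radial_test)
      show "integrable cone_measure (\<lambda>r. pull d r * bump a b N (snd r))"
        by (rule integrable_mult_bounded[OF D(3), of _ 1]) (use bump_range[of a b N] in auto)
      fix Y assume Y: "test_seq Y"
      note t = cone_test[OF X(1) Y, of 1]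
      have "(LINT p|triangle_measure. d p * cone_test X Y 1 p) = (LINT r|cone_measure. pull d r * (X 0 (snd r) * (Y 0 (fst r) / fst r ^ 1)))"
        by (rule pull_test_integral[OF d square_integrable_test_function(1)[OF t(1)] test_kernel(1)[OF X(1) Y]])
           (simp add: cone_test_def)
      then show "(LINT r|cone_measure. pull d r * bump a b N (snd r) * (Y 0 (fst r) / fst r)) = 0"
        using 0[OF t(1)] X(2) by (simp add: mult.assoc)
    qed
    then show ?thesis by simp
  qed
  have "AE s in radial_measure. \<forall>(a, b, N)\<in>S. (LINT u|angle_measure. pull d (s, u) * bump a b N u) = 0"
    by (subst AE_ball_countable[OF cS]) (auto simp: S_def intro!: one)
  then have "AE s in radial_measure. AE u in angle_measure. pull d (s, u) = 0"
    using cone_section(1)[OF D(3)]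
  proof eventually_elim
    case (elim s)
    have m: "(\<lambda>u. pull d (s, u)) \<in> borel_measurable borel" using borel_measurable_integrable[OF elim(2)] by auto
    show ?case
    proof (rule AE_angleI, rule fundamental_lemma[OF locally_integrable_angle[OF m elim(2)]])
      fix a b :: real and N assume ab: "a \<in> \<rat>" "b \<in> \<rat>" "0 < a" "a < b" "b < 1"
      obtain X where X: "test_seq X" "X 0 = bump a b N" using bump_test_seq[OF ab(3-5)] by blast
      show "(LINT u|lborel. pull d (s, u) * bump a b N u) = 0"
        using elim(1) ab test_seq_angle_integral[OF m X(1), of 0] X(2) by (auto simp: S_def)
    qed
  qed
  moreover have "{p \<in> space cone_measure. pull d p = 0} \<in> sets cone_measure" using D(1) by measurable
  ultimately have "AE p in cone_measure. pull d p = 0" using cone.AE_pair_measure[of "\<lambda>p. pull d p = 0"] by auto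
  then have "AE p in triangle_measure. d p = 0"
    using d by (intro AE_pull) (auto simp: square_integrable_def)
  then show ?thesis by eventually_elim (simp add: d_def)
qed

section \<open>The lower bound for functions with vanishing means at the nodes\<close>

lemma angle_moments: "(LINT u|angle_measure. u) = 1/2" "(LINT u|angle_measure. u\<^sup>2) = 1/3" "(LINT u|angle_measure. u ^ 4) = 1/5"
  "integrable angle_measure (\<lambda>u. u)" "integrable angle_measure (\<lambda>u. u\<^sup>2)" "integrable angle_measure (\<lambda>u. u ^ 4)"
proof -
  have pow: "integrable angle_measure (\<lambda>u. u ^ n)" "(LINT u|angle_measure. u ^ n) = 1 / real (Suc n)" for n
  proof -
    have "(LINT u|lborel. indicator {0..1} u *\<^sub>R (u::real) ^ n) = 1 / real (Suc n)"
      using integral_power[of 0 1 n] by (simp add: mult.commute)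
    moreover have "(LINT u|lborel. indicator {0<..<1} u * u ^ n) = (LINT u|lborel. indicator {0..1} u *\<^sub>R (u::real) ^ n)"
    proof (rule integral_cong_AE)
      show "AE u in lborel. indicator {0<..<1} u * u ^ n = indicator {0..1} u *\<^sub>R (u::real) ^ n"
        using AE_lborel_singleton[of 0] AE_lborel_singleton[of 1] by eventually_elim (auto split: split_indicator)
    qed measurable
    ultimately show "(LINT u|angle_measure. u ^ n) = 1 / real (Suc n)"
      by (subst angle_integral(1)) auto
    have "set_integrable lborel {0..1::real} (\<lambda>u. u ^ n)" by (intro borel_integrable_atLeastAtMost' continuous_intros)
    then have "set_integrable lborel {0<..<1::real} (\<lambda>u. u ^ n)" by (rule set_integrable_subset) auto
    then show "integrable angle_measure (\<lambda>u. u ^ n)" by (subst angle_integral(2)) (auto simp: set_integrable_def)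
  qed
  show "(LINT u|angle_measure. u) = 1/2" "(LINT u|angle_measure. u\<^sup>2) = 1/3" "(LINT u|angle_measure. u ^ 4) = 1/5"
    using pow(2)[of 1] pow(2)[of 2] pow(2)[of 4] by simp_all
  show "integrable angle_measure (\<lambda>u. u)" "integrable angle_measure (\<lambda>u. u\<^sup>2)" "integrable angle_measure (\<lambda>u. u ^ 4)"
    using pow(1)[of 1] pow(1)[of 2] pow(1)[of 4] by simp_all
qed

lemma L2_mult:
  fixes F G :: "'a \<Rightarrow> real"
  assumes "F \<in> borel_measurable M" "G \<in> borel_measurable M" "integrable M (\<lambda>x. (F x)\<^sup>2)" "integrable M (\<lambda>x. (G x)\<^sup>2)"
  shows "integrable M (\<lambda>x. F x * G x)"
proof (rule Bochner_Integration.integrable_bound)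
  show "integrable M (\<lambda>x. (F x)\<^sup>2 + (G x)\<^sup>2)" using assms by simp
  have "\<bar>a * b\<bar> \<le> \<bar>a\<^sup>2 + b\<^sup>2\<bar>" for a b :: real
  proof -
    have "2 * (\<bar>a\<bar> * \<bar>b\<bar>) \<le> a\<^sup>2 + b\<^sup>2"
      using sum_squares_bound[of "\<bar>a\<bar>" "\<bar>b\<bar>"] by (simp add: mult.assoc)
    moreover have "0 \<le> \<bar>a\<bar> * \<bar>b\<bar>" by simp
    ultimately show ?thesis unfolding abs_mult by linarith
  qed
  then show "AE x in M. norm (F x * G x) \<le> norm ((F x)\<^sup>2 + (G x)\<^sup>2)" by simp
qed (use assms in measurable)

text \<open>Nonnegativity of \<open>\<integral>(F - l G)\<^sup>2\<close> at the optimal \<open>l = \<integral>F G / \<integral>G\<^sup>2\<close>.\<close>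

lemma Cauchy_Schwarz_integral:
  fixes F G :: "'a \<Rightarrow> real"
  assumes "F \<in> borel_measurable M" "G \<in> borel_measurable M" "integrable M (\<lambda>x. (F x)\<^sup>2)" "integrable M (\<lambda>x. (G x)\<^sup>2)"
    and G: "(LINT x|M. (G x)\<^sup>2) > 0"
  shows "(LINT x|M. F x * G x)\<^sup>2 \<le> (LINT x|M. (F x)\<^sup>2) * (LINT x|M. (G x)\<^sup>2)"
proof -
  define m where "m = (LINT x|M. F x * G x) / (LINT x|M. (G x)\<^sup>2)"
  note FG = L2_mult[OF assms(1-4)]
  have "0 \<le> (LINT x|M. (F x - m * G x)\<^sup>2)" by simp
  also have "\<dots> = (LINT x|M. (F x)\<^sup>2 - 2 * m * (F x * G x) + m\<^sup>2 * (G x)\<^sup>2)"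
    by (rule Bochner_Integration.integral_cong) (simp_all add: power2_eq_square algebra_simps)
  also have "\<dots> = (LINT x|M. (F x)\<^sup>2) - 2 * m * (LINT x|M. F x * G x) + m\<^sup>2 * (LINT x|M. (G x)\<^sup>2)"
    using assms FG by simp
  also have "\<dots> = (LINT x|M. (F x)\<^sup>2) - (LINT x|M. F x * G x)\<^sup>2 / (LINT x|M. (G x)\<^sup>2)"
    using G by (simp add: m_def power2_eq_square field_simps)
  finally show ?thesis using G by (simp add: field_simps)
qed

lemma angle_mean_square:
  fixes F :: "real \<Rightarrow> real"
  assumes "F \<in> borel_measurable borel" "integrable angle_measure (\<lambda>u. (F u)\<^sup>2)"
  shows "(LINT u|angle_measure. F u)\<^sup>2 \<le> (LINT u|angle_measure. (F u)\<^sup>2)"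
  using Cauchy_Schwarz_integral[of F angle_measure "\<lambda>_. 1"] assms by simp

text \<open>The variance is at most the mean square deviation from the midpoint value, to which
  \<open>poincare_interval\<close> applies.\<close>

lemma slice_poincare:
  assumes V: "V \<in> borel_measurable borel" "integrable angle_measure (\<lambda>u. (V u)\<^sup>2)" "integrable angle_measure V"
    and P: "P \<in> borel_measurable borel" "integrable angle_measure (\<lambda>u. (P u)\<^sup>2)" "integrable angle_measure P"
    and prim: "AE u in lborel. 0 < u \<and> u < 1 \<longrightarrow> V u = c + antideriv P u"
  shows "pi\<^sup>2 * ((LINT u|angle_measure. (V u)\<^sup>2) - (LINT u|angle_measure. V u)\<^sup>2) \<le> (LINT u|angle_measure. (P u)\<^sup>2)"
proof -
  \<comment> \<open>Extended by \<open>0\<close>, so that it is integrable over the closed interval.\<close>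
  define P' where "P' u = indicator {0<..<1} u * P u" for u
  have cong: "AE u in lborel. indicator {0..1} u * h (P' u) = indicator {0<..<1} u * h (P u)" for h :: "real \<Rightarrow> real"
    using AE_lborel_singleton[of 0] AE_lborel_singleton[of 1]
    by eventually_elim (auto simp: P'_def split: split_indicator)
  have mP' [measurable]: "P' \<in> borel_measurable borel" using P(1) unfolding P'_def[abs_def] by measurable
  have conv: "integrable lborel (\<lambda>u. indicator {0..1} u * h (P' u)) \<longleftrightarrow> integrable lborel (\<lambda>u. indicator {0<..<1} u * h (P u))"
    "(LINT u|lborel. indicator {0..1} u * h (P' u)) = (LINT u|lborel. indicator {0<..<1} u * h (P u))"
    if [measurable]: "h \<in> borel_measurable borel" for h :: "real \<Rightarrow> real"
  proof -
    note [measurable] = P(1)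
    have m: "(\<lambda>u. indicator {0..1} u * h (P' u)) \<in> borel_measurable lborel" "(\<lambda>u. indicator {0<..<1} u * h (P u)) \<in> borel_measurable lborel"
      by measurable
    show "integrable lborel (\<lambda>u. indicator {0..1} u * h (P' u)) \<longleftrightarrow> integrable lborel (\<lambda>u. indicator {0<..<1} u * h (P u))"
      by (rule integrable_cong_AE[OF m cong])
    show "(LINT u|lborel. indicator {0..1} u * h (P' u)) = (LINT u|lborel. indicator {0<..<1} u * h (P u))"
      by (rule integral_cong_AE[OF m cong])
  qed
  have P2m: "(\<lambda>u. (P u)\<^sup>2) \<in> borel_measurable borel" using P(1) by measurable
  have iP': "set_integrable lborel {0..1} P'"
    using P(3) conv(1)[of "\<lambda>x. x"] unfolding angle_integral(2)[OF P(1)] set_integrable_def by simp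
  have iP2: "set_integrable lborel {0..1} (\<lambda>u. (P' u)\<^sup>2)"
    using P(2) conv(1)[of "\<lambda>x. x\<^sup>2"] unfolding angle_integral(2)[OF P2m] set_integrable_def by simp
  have eP2: "(LINT u:{0..1}|lborel. (P' u)\<^sup>2) = (LINT u|angle_measure. (P u)\<^sup>2)"
    using conv(2)[of "\<lambda>x. x\<^sup>2"] unfolding angle_integral(1)[OF P2m] set_lebesgue_integral_def by simp
  define A where "A u = c + antideriv P' u" for u
  have antiP: "antideriv P' u = antideriv P u" if "0 < u" "u < 1" for u
    using that by (auto simp: antideriv_def set_lebesgue_integral_def P'_def intro!: Bochner_Integration.integral_cong split: split_indicator)
  then have VA: "AE u in lborel. 0 < u \<and> u < 1 \<longrightarrow> V u = A u"
    using prim by eventually_elim (auto simp: A_def antiP)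
  have prA: "primitive 0 1 A P'"
    using primitive_antideriv[OF iP'] by (auto simp: A_def primitive_def)
  have mA: "set_integrable lborel {0..1} (\<lambda>u. (A u - A (1/2))\<^sup>2)"
    by (intro borel_integrable_atLeastAtMost' continuous_intros primitive_continuous[OF prA])
  have VA2m: "(\<lambda>u. (V u - A (1/2))\<^sup>2) \<in> borel_measurable borel" using V(1) by measurable
  have "(LINT u|angle_measure. (V u)\<^sup>2) - (LINT u|angle_measure. V u)\<^sup>2 \<le> (LINT u|angle_measure. (V u - A (1/2))\<^sup>2)"
  proof -
    have "(LINT u|angle_measure. (V u - A (1/2))\<^sup>2) = (LINT u|angle_measure. (V u)\<^sup>2 - 2 * A (1/2) * V u + (A (1/2))\<^sup>2)"
      by (rule Bochner_Integration.integral_cong) (simp_all add: power2_eq_square algebra_simps)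
    also have "\<dots> = (LINT u|angle_measure. (V u)\<^sup>2) - 2 * A (1/2) * (LINT u|angle_measure. V u) + (A (1/2))\<^sup>2"
      using V by simp
    finally have "(LINT u|angle_measure. (V u - A (1/2))\<^sup>2) - ((LINT u|angle_measure. (V u)\<^sup>2) - (LINT u|angle_measure. V u)\<^sup>2)
       = ((LINT u|angle_measure. V u) - A (1/2))\<^sup>2" by (simp add: power2_eq_square algebra_simps)
    then show ?thesis by (smt (verit) zero_le_power2)
  qed
  also have "(LINT u|angle_measure. (V u - A (1/2))\<^sup>2) = (LINT u:{0..1}|lborel. (A u - A (1/2))\<^sup>2)"
    unfolding angle_integral(1)[OF VA2m] set_lebesgue_integral_def
  proof (rule integral_cong_AE)
    show "(\<lambda>u. indicator {0..1} u *\<^sub>R (A u - A (1/2))\<^sup>2) \<in> borel_measurable lborel"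
      using mA unfolding set_integrable_def by auto
    show "AE u in lborel. indicator {0<..<1} u * (V u - A (1/2))\<^sup>2 = indicator {0..1} u *\<^sub>R (A u - A (1/2))\<^sup>2"
      using VA AE_lborel_singleton[of 0] AE_lborel_singleton[of 1] by eventually_elim (auto split: split_indicator)
  qed (use V(1) in measurable)
  finally have "pi\<^sup>2 * ((LINT u|angle_measure. (V u)\<^sup>2) - (LINT u|angle_measure. V u)\<^sup>2) \<le> pi\<^sup>2 * (LINT u:{0..1}|lborel. (A u - A (1/2))\<^sup>2)"
    by (rule mult_left_mono) simp
  also have "\<dots> \<le> (LINT u:{0..1}|lborel. (P' u)\<^sup>2)" by (rule poincare_interval[OF prA iP2])
  finally show ?thesis using eP2 by simp
qed

text \<open>The inequality holds on \<open>[d, 1]\<close> for all small \<open>d\<close> by \<open>radial_nodal\<close>; both integrals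
  converge as \<open>d\<close> tends to \<open>0\<close>. The cut-off is needed because \<open>g\<close> is only integrable with the
  weight \<open>s\<close>.\<close>

lemma radial_inequality:
  assumes z: "z > 0" "bessel_J 1 z = 0"
    and a: "a \<in> borel_measurable borel" "integrable radial_measure (\<lambda>s. (a s)\<^sup>2)"
    and g: "g \<in> borel_measurable borel" "locally_integrable g" "integrable radial_measure (\<lambda>s. (g s)\<^sup>2)"
      "integrable radial_measure g"
    and ag: "AE s in lborel. 0 < s \<and> s < 1 \<longrightarrow> a s = c + antideriv g s"
    and nodes: "\<And>s. s \<in> nodes z \<Longrightarrow> c + antideriv g s = 0"
  shows "z\<^sup>2 * (LINT s|radial_measure. (a s)\<^sup>2) \<le> (LINT s|radial_measure. (g s)\<^sup>2)"
proof -
  \<comment> \<open>Extended by \<open>0\<close>, so that it is integrable up to the closed end \<open>s = 1\<close>.\<close>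
  define g' where "g' s = indicator {0<..<1} s * g s" for s
  define A where "A s = c + antideriv g' s" for s
  have eqA: "A s = c + antideriv g s" if "0 < s" "s < 1" for s
    using that by (auto simp: A_def antideriv_def set_lebesgue_integral_def g'_def intro!: Bochner_Integration.integral_cong split: split_indicator)
  have m [measurable]: "g' \<in> borel_measurable borel" "a \<in> borel_measurable borel" "g \<in> borel_measurable borel"
    using g(1) a(1) unfolding g'_def[abs_def] by measurable
  have loc: "set_integrable lborel {d..1} (\<lambda>s. h (g' s))"
    if d: "0 < d" "d < 1" and h: "integrable radial_measure (\<lambda>s. h (g s))" "h 0 = 0" "h \<in> borel_measurable borel" for d and h :: "real \<Rightarrow> real"
  proof -
    have hm: "(\<lambda>s. h (g s)) \<in> borel_measurable borel" using h(3) by measurable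
    have "set_integrable lborel {d..1} (\<lambda>s. s * indicator {0<..<1} s * h (g s))"
      using h(1) unfolding radial_integral(2)[OF hm] set_integrable_def
      by (rule integrable_mult_indicator[rotated]) simp
    moreover have "continuous_on {d..1} (\<lambda>s. 1 / s)" using d by (auto intro!: continuous_intros)
    ultimately have "set_integrable lborel {d..1} (\<lambda>s. s * indicator {0<..<1} s * h (g s) * (1 / s))"
      by (rule set_integrable_mult_continuous)
    then show ?thesis
      unfolding set_integrable_def
      by (rule Bochner_Integration.integrable_cong[THEN iffD1, rotated 2]) (use d h in \<open>auto simp: g'_def split: split_indicator\<close>)
  qed
  have g'i: "set_integrable lborel {d..1} g'" "set_integrable lborel {d..1} (\<lambda>s. (g' s)\<^sup>2)" if "0 < d" "d < 1" for d
    using loc[OF that, of "\<lambda>x. x"] loc[OF that, of "\<lambda>x. x\<^sup>2"] g by auto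
  have prim: "primitive d 1 A g'" if d: "0 < d" "d < 1" for d
  proof -
    have "primitive (min d (1/2)) 1 A g'"
      using primitive_antideriv[OF g'i(1)[of "min d (1/2)"]] d by (auto simp: A_def primitive_def)
    then show ?thesis by (rule primitive_subinterval) (use d in auto)
  qed
  have rad1: "rad1 z 1 = 0" using z bessel_J_rad(2)[of z 1] by simp
  obtain e where e: "e > 0" "\<And>d. 0 < d \<Longrightarrow> d < e \<Longrightarrow> 0 \<le> (LINT s:{d..1}|lborel. s * (g' s)\<^sup>2 - z\<^sup>2 * (s * (A s)\<^sup>2))"
    using radial_nodal[OF z(1) rad1 prim g'i(2)] nodes eqA card_nodes(1)[OF z] by (force simp: nodes_def)
  define W where "W s = s * indicator {0<..<1} s * ((g s)\<^sup>2 - z\<^sup>2 * (a s)\<^sup>2)" for s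
  have m2: "(\<lambda>s. (g s)\<^sup>2 - z\<^sup>2 * (a s)\<^sup>2) \<in> borel_measurable borel" by measurable
  have iW: "integrable lborel W"
    using radial_integral(2)[OF m2] a g by (simp add: W_def[abs_def])
  have mW [measurable]: "W \<in> borel_measurable borel" using iW by auto
  have nonneg: "0 \<le> (LINT s|lborel. indicator {1 / real (n + 2)..1} s * W s)" if n: "1 / real (n + 2) < e" for n
  proof -
    have d: "0 < 1 / real (n + 2)" "1 / real (n + 2) < 1" by auto
    have mA: "continuous_on {1 / real (n + 2)..1} A" using primitive_continuous[OF prim[OF d]] .
    have "(LINT s|lborel. indicator {1 / real (n + 2)..1} s * W s) = (LINT s:{1 / real (n + 2)..1}|lborel. s * (g' s)\<^sup>2 - z\<^sup>2 * (s * (A s)\<^sup>2))"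
      unfolding set_lebesgue_integral_def
    proof (rule integral_cong_AE)
      have "(\<lambda>s. indicator {1 / real (n + 2)..1} s *\<^sub>R A s) \<in> borel_measurable borel"
        by (intro borel_measurable_continuous_on_indicator mA) auto
      then have "(\<lambda>s. indicator {1 / real (n + 2)..1} s * (s * (g' s)\<^sup>2) - z\<^sup>2 * (s * (indicator {1 / real (n + 2)..1} s *\<^sub>R A s)\<^sup>2)) \<in> borel_measurable borel"
        by measurable
      moreover have "(\<lambda>s. indicator {1 / real (n + 2)..1} s * (s * (g' s)\<^sup>2) - z\<^sup>2 * (s * (indicator {1 / real (n + 2)..1} s *\<^sub>R A s)\<^sup>2)) =
          (\<lambda>s. indicator {1 / real (n + 2)..1} s *\<^sub>R (s * (g' s)\<^sup>2 - z\<^sup>2 * (s * (A s)\<^sup>2)))"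
        by (rule ext) (auto split: split_indicator)
      ultimately show "(\<lambda>s. indicator {1 / real (n + 2)..1} s *\<^sub>R (s * (g' s)\<^sup>2 - z\<^sup>2 * (s * (A s)\<^sup>2))) \<in> borel_measurable lborel"
        by simp
      show "AE s in lborel. indicator {1 / real (n + 2)..1} s * W s = indicator {1 / real (n + 2)..1} s *\<^sub>R (s * (g' s)\<^sup>2 - z\<^sup>2 * (s * (A s)\<^sup>2))"
        using ag AE_lborel_singleton[of 1]
      proof eventually_elim
        case (elim s)
        show ?case
        proof (cases "s \<in> {1 / real (n + 2)..1}")
          case True
          then have "0 < s" using d(1) by (meson atLeastAtMost_iff less_le_trans)
          moreover have "s < 1" using True elim by auto
          ultimately show ?thesis using elim eqA[of s] by (simp add: W_def g'_def algebra_simps)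
        qed simp
      qed
    qed measurable
    then show ?thesis using e(2)[OF d(1) n] by simp
  qed
  have "(\<lambda>n. LINT s|lborel. indicator {1 / real (n + 2)..1} s * W s) \<longlonglongrightarrow> (LINT s|lborel. W s)"
  proof (rule integral_dominated_convergence[where w = "\<lambda>s. norm (W s)"])
    show "AE s in lborel. (\<lambda>n. indicator {1 / real (n + 2)..1} s * W s) \<longlonglongrightarrow> W s"
    proof (rule AE_I2)
      fix s :: real
      show "(\<lambda>n. indicator {1 / real (n + 2)..1} s * W s) \<longlonglongrightarrow> W s"
      proof (cases "0 < s \<and> s < 1")
        case True
        have "(\<lambda>n. 1 / real (n + 2)) \<longlonglongrightarrow> 0" by (rule LIMSEQ_ignore_initial_segment[OF lim_1_over_n])
        then have "eventually (\<lambda>n. 1 / real (n + 2) < s) sequentially" by (rule order_tendstoD(2)) (use True in simp)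
        then have "eventually (\<lambda>n. indicator {1 / real (n + 2)..1} s * W s = W s) sequentially"
          by eventually_elim (use True in auto)
        then show ?thesis by (rule tendsto_eventually)
      next
        case False
        then have "W s = 0" by (auto simp: W_def)
        then show ?thesis by simp
      qed
    qed
    show "AE s in lborel. norm (indicator {1 / real (n + 2)..1} s * W s) \<le> norm (W s)" for n
      by (rule AE_I2) (auto split: split_indicator)
  qed (use iW in auto)
  moreover have "eventually (\<lambda>n. 0 \<le> (LINT s|lborel. indicator {1 / real (n + 2)..1} s * W s)) sequentially"
  proof -
    have "(\<lambda>n. 1 / real (n + 2)) \<longlonglongrightarrow> 0" by (rule LIMSEQ_ignore_initial_segment[OF lim_1_over_n])
    then have "eventually (\<lambda>n. 1 / real (n + 2) < e) sequentially" using e(1) by (rule order_tendstoD(2))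
    then show ?thesis by eventually_elim (rule nonneg)
  qed
  ultimately have "0 \<le> (LINT s|lborel. W s)" by (rule tendsto_lowerbound) simp
  also have "\<dots> = (LINT s|radial_measure. (g s)\<^sup>2 - z\<^sup>2 * (a s)\<^sup>2)"
    using radial_integral(1)[OF m2] by (simp add: W_def[abs_def])
  also have "\<dots> = (LINT s|radial_measure. (g s)\<^sup>2) - z\<^sup>2 * (LINT s|radial_measure. (a s)\<^sup>2)"
    using a g by simp
  finally show ?thesis by simp
qed

text \<open>The letters stand for slice integrals: \<open>p2\<close>, \<open>q2\<close>, \<open>v2\<close> of the squares of the two
  derivatives and the function, \<open>a\<close> of the function, \<open>\<gamma>\<close> of \<open>u P\<close>, and \<open>g\<close> of \<open>u P - Q\<close>. The
  part \<open>mu * p2\<close> pays for the variance, because \<open>L / \<pi>\<^sup>2 \<le> mu\<close>; the rest \<open>(1 - mu) * p2\<close> is at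
  least \<open>m \<gamma>\<^sup>2\<close> with \<open>m = 3 (1 - mu)\<close>, and completing the square gives
  \<open>m \<gamma>\<^sup>2 + t (g - \<gamma>)\<^sup>2 \<ge> (t - t\<^sup>2/m) g\<^sup>2\<close>.\<close>

lemma slice_pointwise_bound:
  fixes p2 q2 v2 a g \<gamma> :: real
  assumes t: "t > 0" and mu: "mu \<le> 1/2" "mu = z\<^sup>2 * t / pi\<^sup>2"
    and L: "L = z\<^sup>2 * (t - t\<^sup>2 / (3 * (1 - mu)))" "L \<ge> 0"
    and h1: "pi\<^sup>2 * (v2 - a\<^sup>2) \<le> p2" and h2: "3 * \<gamma>\<^sup>2 \<le> p2" and h3: "(g - \<gamma>)\<^sup>2 \<le> q2"
  shows "(t - t\<^sup>2 / (3 * (1 - mu))) * g\<^sup>2 - L * a\<^sup>2 \<le> p2 + t * q2 - L * v2"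
proof -
  define m where "m = 3 * (1 - mu)"
  have m: "m > 0" using mu(1) by (simp add: m_def)
  have p2: "p2 \<ge> 0" using h2 by (smt (verit) zero_le_power2)
  have "L \<le> z\<^sup>2 * t"
    unfolding L(1) m_def[symmetric] using m by (intro mult_left_mono) auto
  then have "L / pi\<^sup>2 \<le> mu" unfolding mu(2) by (intro divide_right_mono) auto
  have "L * (v2 - a\<^sup>2) = (L / pi\<^sup>2) * (pi\<^sup>2 * (v2 - a\<^sup>2))" by simp
  also have "\<dots> \<le> (L / pi\<^sup>2) * p2" using L(2) h1 by (intro mult_left_mono) auto
  also have "\<dots> \<le> mu * p2" using \<open>L / pi\<^sup>2 \<le> mu\<close> p2 by (rule mult_right_mono)
  finally have 1: "L * (v2 - a\<^sup>2) \<le> mu * p2" .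
  have "m * \<gamma>\<^sup>2 = (1 - mu) * (3 * \<gamma>\<^sup>2)" by (simp add: m_def)
  also have "\<dots> \<le> (1 - mu) * p2" using mu(1) h2 by (intro mult_left_mono) auto
  finally have 2: "m * \<gamma>\<^sup>2 \<le> (1 - mu) * p2" .
  have 3: "t * (g - \<gamma>)\<^sup>2 \<le> t * q2" using t h3 by (intro mult_left_mono) auto
  \<comment> \<open>The exact minimum over \<open>\<gamma>\<close> is \<open>t m / (m + t) * g\<^sup>2\<close>; its expansion in \<open>t\<close> is bounded below by the first two terms.\<close>
  have "m * \<gamma>\<^sup>2 + t * (g - \<gamma>)\<^sup>2 - (t - t\<^sup>2 / m) * g\<^sup>2 = (m * \<gamma> - t * g)\<^sup>2 / m + t * \<gamma>\<^sup>2"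
    using m by (simp add: power2_eq_square field_simps)
  moreover have "0 \<le> (m * \<gamma> - t * g)\<^sup>2 / m + t * \<gamma>\<^sup>2" using m t by auto
  ultimately have 4: "(t - t\<^sup>2 / m) * g\<^sup>2 \<le> m * \<gamma>\<^sup>2 + t * (g - \<gamma>)\<^sup>2" by linarith
  have "(1 - mu) * p2 = p2 - mu * p2" "L * (v2 - a\<^sup>2) = L * v2 - L * a\<^sup>2" by (simp_all add: algebra_simps)
  with 1 2 3 4 show ?thesis unfolding m_def[symmetric] by linarith
qed

text \<open>Integrate the slice-wise bound over \<open>s\<close> and use \<open>radial_inequality\<close>; the factors match
  because the constant in front of the mass is \<open>z\<^sup>2\<close> times the one in front of \<open>g\<^sup>2\<close>.\<close>

lemma lower_bound_function:
  assumes z: "z > 0" "bessel_J 1 z = 0"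
    and t: "0 < t" "t \<le> 1/2" and mu: "z\<^sup>2 * t / pi\<^sup>2 \<le> 1/2"
    and f: "square_integrable f" and px: "weak_deriv (1, 0) f p" and qy: "weak_deriv (0, 1) f q"
    and c: "AE s in lborel. 0 < s \<and> s < 1 \<longrightarrow> slice_mean (pull f) s = c + antideriv (slice_mean (\<lambda>r. snd r * pull p r - pull q r)) s"
    and nodes: "\<And>s. s \<in> nodes z \<Longrightarrow> c + antideriv (slice_mean (\<lambda>r. snd r * pull p r - pull q r)) s = 0"
  shows "z\<^sup>2 * (t - t\<^sup>2 / (3 * (1 - z\<^sup>2 * t / pi\<^sup>2))) * (LINT r|triangle_measure. (f r)\<^sup>2)
    \<le> (LINT r|triangle_measure. (p r)\<^sup>2) + t * (LINT r|triangle_measure. (q r)\<^sup>2)"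
proof -
  have p: "square_integrable p" and q: "square_integrable q" using px qy by (auto simp: weak_deriv_def)
  note F = square_integrable_pull[OF f] and P = square_integrable_pull[OF p] and Q = square_integrable_pull[OF q]
  note G = radial_derivative_integrable[OF p q]
  define a where "a = slice_mean (pull f)"
  define g where "g = slice_mean (\<lambda>r. snd r * pull p r - pull q r)"
  define \<gamma> where "\<gamma> = slice_mean (\<lambda>r. snd r * pull p r)"
  define v2 where "v2 = slice_mean (\<lambda>r. (pull f r)\<^sup>2)"
  define p2 where "p2 = slice_mean (\<lambda>r. (pull p r)\<^sup>2)"
  define q2 where "q2 = slice_mean (\<lambda>r. (pull q r)\<^sup>2)"
  have int: "integrable radial_measure a" "integrable radial_measure g" "integrable radial_measure v2"
     "integrable radial_measure p2" "integrable radial_measure q2"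
    using cone_section(2)[OF F(3)] cone_section(2)[OF G(1)] cone_section(2)[OF F(2)] cone_section(2)[OF P(2)] cone_section(2)[OF Q(2)]
    by (simp_all add: a_def g_def v2_def p2_def q2_def slice_mean_def[abs_def])
  have meas [measurable]: "a \<in> borel_measurable borel" "g \<in> borel_measurable borel"
    using borel_measurable_integrable[OF int(1)] borel_measurable_integrable[OF int(2)] by auto
  have lg: "locally_integrable g" unfolding g_def by (rule slice_mean_primitive(2)[OF f px qy])
  have tot: "(LINT s|radial_measure. v2 s) = (LINT r|triangle_measure. (f r)\<^sup>2)"
     "(LINT s|radial_measure. p2 s) = (LINT r|triangle_measure. (p r)\<^sup>2)"
     "(LINT s|radial_measure. q2 s) = (LINT r|triangle_measure. (q r)\<^sup>2)"
    using cone_section(3)[OF F(2)] cone_section(3)[OF P(2)] cone_section(3)[OF Q(2)] F(4) P(4) Q(4)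
    by (simp_all add: v2_def p2_def q2_def slice_mean_def)
  have AE: "AE s in radial_measure. (a s)\<^sup>2 \<le> v2 s \<and> pi\<^sup>2 * (v2 s - (a s)\<^sup>2) \<le> p2 s \<and> 3 * (\<gamma> s)\<^sup>2 \<le> p2 s \<and> (g s - \<gamma> s)\<^sup>2 \<le> q2 s"
  proof -
    have "AE s in radial_measure. 0 < s \<and> s < 1" by (rule AE_radialI) simp
    then show ?thesis
      using slice_primitive[OF f px] cone_section(1)[OF F(2)] cone_section(1)[OF P(2)] cone_section(1)[OF Q(2)]
        cone_section(1)[OF F(3)] cone_section(1)[OF P(3)] cone_section(1)[OF Q(3)] cone_section(1)[OF G(3)]
    proof eventually_elim
      case (elim s)
      have m [measurable]: "(\<lambda>u. pull f (s, u)) \<in> borel_measurable borel" "(\<lambda>u. pull p (s, u)) \<in> borel_measurable borel"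
        "(\<lambda>u. pull q (s, u)) \<in> borel_measurable borel"
        using borel_measurable_integrable[OF elim(6)] borel_measurable_integrable[OF elim(7)] borel_measurable_integrable[OF elim(8)] by auto
      obtain c' where c': "AE u in lborel. 0 < u \<and> u < 1 \<longrightarrow> pull f (s, u) = c' + antideriv (\<lambda>u. s * pull p (s, u)) u"
        using elim(2) by blast
      have a2: "(a s)\<^sup>2 \<le> v2 s"
        unfolding a_def v2_def slice_mean_def by (rule angle_mean_square[OF m(1) elim(3)])
      have "pi\<^sup>2 * (v2 s - (a s)\<^sup>2) \<le> (LINT u|angle_measure. (s * pull p (s, u))\<^sup>2)"
        unfolding a_def v2_def slice_mean_def
        by (rule slice_poincare[OF m(1) elim(3,6) _ _ _ c']) (use elim in \<open>auto simp: power_mult_distrib\<close>)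
      also have "\<dots> = s\<^sup>2 * p2 s" by (simp add: p2_def slice_mean_def power_mult_distrib)
      \<comment> \<open>The derivative in \<open>u\<close> is \<open>s P\<close>, and the slice has length \<open>s \<le> 1\<close>.\<close>
      also have "\<dots> \<le> 1 * p2 s"
        using elim(1) by (intro mult_right_mono) (auto simp: p2_def slice_mean_def power_le_one)
      finally have h1: "pi\<^sup>2 * (v2 s - (a s)\<^sup>2) \<le> p2 s" by simp
      have "(LINT u|angle_measure. pull p (s, u) * u)\<^sup>2 \<le> (LINT u|angle_measure. (pull p (s, u))\<^sup>2) * (LINT u|angle_measure. u\<^sup>2)"
        by (rule Cauchy_Schwarz_integral) (use elim angle_moments in auto)
      then have h2: "3 * (\<gamma> s)\<^sup>2 \<le> p2 s"
        by (simp add: \<gamma>_def p2_def slice_mean_def angle_moments mult.commute)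
      have "g s - \<gamma> s = - (LINT u|angle_measure. pull q (s, u))"
        using elim(8,9) by (simp add: g_def \<gamma>_def slice_mean_def)
      then have h3: "(g s - \<gamma> s)\<^sup>2 \<le> q2 s"
        using angle_mean_square[OF m(3) elim(5)] by (simp add: q2_def slice_mean_def)
      show ?case using a2 h1 h2 h3 by simp
    qed
  qed
  have a2i: "integrable radial_measure (\<lambda>s. (a s)\<^sup>2)"
  proof (rule Bochner_Integration.integrable_bound[OF int(3)])
    show "AE s in radial_measure. norm ((a s)\<^sup>2) \<le> norm (v2 s)" using AE by eventually_elim auto
  qed measurable
  have g2i: "integrable radial_measure (\<lambda>s. (g s)\<^sup>2)"
  proof (rule Bochner_Integration.integrable_bound)
    show "integrable radial_measure (\<lambda>s. p2 s + 2 * q2 s)" using int by simp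
    show "AE s in radial_measure. norm ((g s)\<^sup>2) \<le> norm (p2 s + 2 * q2 s)" using AE
    proof eventually_elim
      case (elim s)
      have "(g s)\<^sup>2 \<le> 2 * (\<gamma> s)\<^sup>2 + 2 * (g s - \<gamma> s)\<^sup>2"
      proof -
        have "2 * (\<gamma> s)\<^sup>2 + 2 * (g s - \<gamma> s)\<^sup>2 - (g s)\<^sup>2 = (2 * \<gamma> s - g s)\<^sup>2" by (simp add: power2_eq_square algebra_simps)
        then show ?thesis by (smt (verit) zero_le_power2)
      qed
      also have "\<dots> \<le> p2 s + 2 * q2 s"
      proof -
        have "0 \<le> (\<gamma> s)\<^sup>2" by simp
        then show ?thesis using elim by linarith
      qed
      finally show ?case by simp
    qed
  qed measurable
  define \<mu> where "\<mu> = z\<^sup>2 * t / pi\<^sup>2"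
  define \<kappa> where "\<kappa> = t - t\<^sup>2 / (3 * (1 - \<mu>))"
  have "t\<^sup>2 / (3 * (1 - \<mu>)) \<le> t"
  proof -
    have "\<mu> \<le> 1/2" using mu by (simp only: \<mu>_def)
    then have "t * t \<le> (3 * (1 - \<mu>)) * t" using t by (intro mult_right_mono) auto
    then show ?thesis using \<open>\<mu> \<le> 1/2\<close> by (simp add: divide_le_eq power2_eq_square mult.commute)
  qed
  then have \<kappa>: "\<kappa> \<ge> 0" by (simp add: \<kappa>_def)
  have "\<kappa> * (LINT s|radial_measure. (g s)\<^sup>2) - z\<^sup>2 * \<kappa> * (LINT s|radial_measure. (a s)\<^sup>2) = (LINT s|radial_measure. \<kappa> * (g s)\<^sup>2 - z\<^sup>2 * \<kappa> * (a s)\<^sup>2)"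
    using a2i g2i by simp
  also have "\<dots> \<le> (LINT s|radial_measure. p2 s + t * q2 s - z\<^sup>2 * \<kappa> * v2 s)"
  proof (rule integral_mono_AE)
    show "AE s in radial_measure. \<kappa> * (g s)\<^sup>2 - z\<^sup>2 * \<kappa> * (a s)\<^sup>2 \<le> p2 s + t * q2 s - z\<^sup>2 * \<kappa> * v2 s"
      using AE
    proof eventually_elim
      case (elim s)
      show ?case
        unfolding \<kappa>_def by (rule slice_pointwise_bound[where \<gamma> = "\<gamma> s" and L = "z\<^sup>2 * (t - t\<^sup>2 / (3 * (1 - \<mu>)))"])
          (use elim t mu \<kappa> in \<open>auto simp: \<mu>_def \<kappa>_def\<close>)
    qed
  qed (use a2i g2i int in auto)
  also have "\<dots> = (LINT s|radial_measure. p2 s) + t * (LINT s|radial_measure. q2 s) - z\<^sup>2 * \<kappa> * (LINT s|radial_measure. v2 s)"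
    using int by simp
  finally have fin: "\<kappa> * (LINT s|radial_measure. (g s)\<^sup>2) - z\<^sup>2 * \<kappa> * (LINT s|radial_measure. (a s)\<^sup>2) \<le> \<dots>" .
  have "z\<^sup>2 * (LINT s|radial_measure. (a s)\<^sup>2) \<le> (LINT s|radial_measure. (g s)\<^sup>2)"
    by (rule radial_inequality[OF z meas(1) a2i meas(2) lg g2i int(2)]) (use c nodes in \<open>auto simp: a_def g_def\<close>)
  from mult_left_mono[OF this \<kappa>] fin
  have "0 \<le> (LINT s|radial_measure. p2 s) + t * (LINT s|radial_measure. q2 s) - z\<^sup>2 * \<kappa> * (LINT s|radial_measure. v2 s)"
    by (simp add: mult_ac)
  then show ?thesis unfolding tot \<kappa>_def \<mu>_def by simp
qed

section \<open>Weak derivatives of continuously differentiable functions\<close>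

lemma has_derivative_partials_line:
  fixes F :: "real \<times> real \<Rightarrow> real"
  assumes "\<And>p. (F has_derivative (\<lambda>h. Fx p * fst h + Fy p * snd h)) (at p)"
  shows "((\<lambda>x. F (x, y)) has_real_derivative Fx (x, y)) (at x)"
    and "((\<lambda>y. F (x, y)) has_real_derivative Fy (x, y)) (at y)"
proof -
  have "((\<lambda>x. (x, y)) has_derivative (\<lambda>h. (h, 0))) (at x)" by (auto intro!: derivative_eq_intros)
  from has_derivative_compose[OF this assms[of "(x, y)"]]
  show "((\<lambda>x. F (x, y)) has_real_derivative Fx (x, y)) (at x)"
    by (simp add: has_field_derivative_def)
  have "((\<lambda>y. (x, y)) has_derivative (\<lambda>h. (0, h))) (at y)" by (auto intro!: derivative_eq_intros)
  from has_derivative_compose[OF this assms[of "(x, y)"]]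
  show "((\<lambda>y. F (x, y)) has_real_derivative Fy (x, y)) (at y)"
    by (simp add: has_field_derivative_def)
qed

lemma integral_compact_derivative:
  fixes G g :: "real \<Rightarrow> real"
  assumes d: "\<And>x. (G has_real_derivative g x) (at x)" and c: "continuous_on UNIV g"
    and 0: "\<And>x. x \<notin> {0<..<1} \<Longrightarrow> G x = 0" "\<And>x. x \<notin> {0<..<1} \<Longrightarrow> g x = 0"
  shows "(LINT x|lborel. g x) = 0"
proof -
  have "primitive 0 1 G g" by (rule primitive_C1) (use d c in \<open>auto intro: continuous_on_subset\<close>)
  from primitive_increment[OF this, of 0 1] 0(1)[of 0] 0(1)[of 1]
  have "(LINT x:{0..1}|lborel. g x) = 0" by simp
  moreover have "indicator {0..1} x *\<^sub>R g x = g x" for x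
    using 0(2)[of x] by (cases "x \<in> {0<..<1}") auto
  ultimately show ?thesis by (simp only: set_lebesgue_integral_def)
qed

text \<open>The product with a test function has compact support in the triangle, so each of its
  partial derivatives integrates to \<open>0\<close> along every line.\<close>

lemma weak_deriv_C1:
  fixes f :: "real \<times> real \<Rightarrow> real"
  assumes f: "\<And>p. (f has_derivative (\<lambda>h. fx p * fst h + fy p * snd h)) (at p)"
    and c: "continuous_on UNIV fx" "continuous_on UNIV fy"
  shows "square_integrable f" "weak_deriv (1, 0) f fx" "weak_deriv (0, 1) f fy"
proof -
  have cf: "continuous_on UNIV f"
    by (intro continuous_at_imp_continuous_on ballI has_derivative_continuous[OF f])
  show sf: "square_integrable f" by (rule square_integrable_continuous[OF cf])
  have sx: "square_integrable fx" "square_integrable fy" by (auto intro: square_integrable_continuous c)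
  have main: "(LINT p|triangle_measure. f p * frechet_derivative \<phi> (at p) (1, 0)) = - (LINT p|triangle_measure. fx p * \<phi> p) \<and>
     (LINT p|triangle_measure. f p * frechet_derivative \<phi> (at p) (0, 1)) = - (LINT p|triangle_measure. fy p * \<phi> p)"
    if t: "test_function \<phi>" for \<phi>
  proof -
    obtain D :: "nat \<Rightarrow> nat \<Rightarrow> real \<times> real \<Rightarrow> real" where D0: "D 0 0 = \<phi>" and
      D: "\<And>i j p. (D i j has_derivative (\<lambda>h. D (Suc i) j p * fst h + D i (Suc j) p * snd h)) (at p)"
      using t by (auto simp: test_function_def smooth2_def)
    have cD: "continuous_on UNIV (D i j)" for i j
      by (intro continuous_at_imp_continuous_on ballI) (rule has_derivative_continuous[OF D])
    have fd: "frechet_derivative \<phi> (at p) = (\<lambda>h. D 1 0 p * fst h + D 0 1 p * snd h)" for p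
      using frechet_derivative_at[OF D[of 0 0 p]] by (simp add: D0)
    have out: "\<phi> p = 0" "D 1 0 p = 0" "D 0 1 p = 0" if p: "p \<notin> triangle" for p
    proof -
      have pc: "p \<in> - closure {p. \<phi> p \<noteq> 0}" using p t by (auto simp: test_function_def)
      have off: "\<phi> q = 0" if "q \<in> - closure {p. \<phi> p \<noteq> 0}" for q
        using that closure_subset[of "{p. \<phi> p \<noteq> 0}"] by blast
      show "\<phi> p = 0" using off[OF pc] .
      have "(\<phi> has_derivative (\<lambda>h. 0)) (at p)"
      proof (rule has_derivative_transform_within_open)
        show "((\<lambda>_. 0) has_derivative (\<lambda>h. 0)) (at p)" by simp
        show "open (- closure {p. \<phi> p \<noteq> 0})" by auto
        show "0 = \<phi> q" if "q \<in> - closure {p. \<phi> p \<noteq> 0}" for q using off[OF that] by simp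
      qed (rule pc)
      from frechet_derivative_at[OF this] fd[of p]
      have "(\<lambda>h::real\<times>real. D 1 0 p * fst h + D 0 1 p * snd h) = (\<lambda>h. 0)" by simp
      from fun_cong[OF this, of "(1, 0)"] fun_cong[OF this, of "(0, 1)"]
      show "D 1 0 p = 0" "D 0 1 p = 0" by auto
    qed
    define Fx where "Fx p = f p * D 1 0 p + fx p * \<phi> p" for p
    define Fy where "Fy p = f p * D 0 1 p + fy p * \<phi> p" for p
    have F: "((\<lambda>p. f p * \<phi> p) has_derivative (\<lambda>h. Fx p * fst h + Fy p * snd h)) (at p)" for p
      by (rule has_derivative_eq_rhs[OF has_derivative_mult[OF f D[of 0 0 p, unfolded D0]]])
         (simp add: fun_eq_iff Fx_def Fy_def algebra_simps)
    have cF: "continuous_on UNIV Fx" "continuous_on UNIV Fy"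
      unfolding Fx_def[abs_def] Fy_def[abs_def] using cD[of 0 0] cD[of 1 0] cD[of 0 1] D0
      by (auto intro!: continuous_intros c cf)
    have zero: "(LINT p|triangle_measure. H p) = 0"
      if H: "continuous_on UNIV H" "\<And>p. p \<notin> triangle \<Longrightarrow> H p = 0" and
        h: "(\<forall>y. (LINT x|lborel. H (x, y)) = 0) \<or> (\<forall>x. (LINT y|lborel. H (x, y)) = 0)" for H :: "real \<times> real \<Rightarrow> real"
    proof -
      have mH: "H \<in> borel_measurable borel" using H(1) by (rule borel_measurable_continuous_onI)
      have eq: "indicator triangle p *\<^sub>R H p = H p" for p using H(2)[of p] by (auto simp: indicator_def)
      have "integrable triangle_measure (\<lambda>p. H p * 1)"
        by (intro square_integrable_mult square_integrable_continuous H continuous_intros)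
      then have "integrable lborel H" by (simp add: integrable_restrict_space eq del: real_scaleR_def)
      then have i: "integrable (lborel \<Otimes>\<^sub>M lborel) (case_prod (\<lambda>x y. H (x, y)))" by (simp add: lborel_prod)
      have "(LINT p|triangle_measure. H p) = (LINT p|lborel. H p)"
        by (simp add: integral_restrict_space eq del: real_scaleR_def)
      also have "\<dots> = (LINT p|(lborel \<Otimes>\<^sub>M lborel). (case p of (x, y) \<Rightarrow> H (x, y)))" by (simp add: lborel_prod)
      also have "\<dots> = 0" using h
      proof
        assume "\<forall>y. (LINT x|lborel. H (x, y)) = 0"
        then show ?thesis by (subst lborel_pair.integral_snd[OF i, symmetric]) simp
      next
        assume "\<forall>x. (LINT y|lborel. H (x, y)) = 0"
        then show ?thesis by (subst lborel_pair.integral_fst[OF i, symmetric]) simp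
      qed
      finally show ?thesis .
    qed
    have tri: "(x, y) \<notin> triangle" if "x \<notin> {0<..<1} \<or> y \<notin> {0<..<1}" for x y
      using that by (auto simp: triangle_def)
    have "(LINT x|lborel. Fx (x, y)) = 0" for y
    proof (rule integral_compact_derivative)
      show "((\<lambda>x. f (x, y) * \<phi> (x, y)) has_real_derivative Fx (x, y)) (at x)" for x
        by (rule has_derivative_partials_line(1)[OF F])
      show "continuous_on UNIV (\<lambda>x. Fx (x, y))"
        by (rule continuous_on_compose2[OF cF(1)]) (auto intro!: continuous_intros)
    qed (use tri out in \<open>auto simp: Fx_def\<close>)
    then have zx: "(LINT p|triangle_measure. Fx p) = 0" by (intro zero cF) (use out in \<open>auto simp: Fx_def\<close>)
    have "(LINT y|lborel. Fy (x, y)) = 0" for x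
    proof (rule integral_compact_derivative)
      show "((\<lambda>y. f (x, y) * \<phi> (x, y)) has_real_derivative Fy (x, y)) (at y)" for y
        by (rule has_derivative_partials_line(2)[OF F])
      show "continuous_on UNIV (\<lambda>y. Fy (x, y))"
        by (rule continuous_on_compose2[OF cF(2)]) (auto intro!: continuous_intros)
    qed (use tri out in \<open>auto simp: Fy_def\<close>)
    then have zy: "(LINT p|triangle_measure. Fy p) = 0" by (intro zero cF) (use out in \<open>auto simp: Fy_def\<close>)
    have s\<phi>: "square_integrable \<phi>" "square_integrable (D 1 0)" "square_integrable (D 0 1)"
      using cD[of 0 0] cD D0 by (auto intro!: square_integrable_continuous)
    have "(LINT p|triangle_measure. Fx p) = (LINT p|triangle_measure. f p * D 1 0 p) + (LINT p|triangle_measure. fx p * \<phi> p)"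
      unfolding Fx_def by (intro Bochner_Integration.integral_add square_integrable_mult sf s\<phi> sx)
    moreover have "(LINT p|triangle_measure. Fy p) = (LINT p|triangle_measure. f p * D 0 1 p) + (LINT p|triangle_measure. fy p * \<phi> p)"
      unfolding Fy_def by (intro Bochner_Integration.integral_add square_integrable_mult sf s\<phi> sx)
    ultimately show ?thesis using zx zy by (simp add: fd)
  qed
  show "weak_deriv (1, 0) f fx" "weak_deriv (0, 1) f fy"
    using main sx unfolding weak_deriv_def by auto
qed

section \<open>The quadratic forms on the Sobolev space\<close>

lemma ae_eq_rep: "ae_eq (rep_H1 v) (rep_H1 v)"
  using Quotient3_rep_reflp[OF Quotient3_H1] .

lemma sobolev_rep: "sobolev (rep_H1 v)"
  using ae_eq_rep by (simp add: ae_eq_def)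

lemma abs_rep: "abs_H1 (rep_H1 v) = v"
  using Quotient3_abs_rep[OF Quotient3_H1] .

lemma rep_abs: "sobolev f \<Longrightarrow> AE p in triangle_measure. rep_H1 (abs_H1 f) p = f p"
  using Quotient3_rep_abs[OF Quotient3_H1, of f] by (simp add: ae_eq_def)

lemma sobolev_ae_eq: "sobolev f \<Longrightarrow> ae_eq f f"
  by (simp add: ae_eq_def)

lemma abs_add: "sobolev f \<Longrightarrow> sobolev g \<Longrightarrow> abs_H1 f + abs_H1 g = abs_H1 (\<lambda>p. f p + g p)"
  by (simp add: plus_H1.abs_eq sobolev_ae_eq)

lemma abs_scale: "sobolev f \<Longrightarrow> c *\<^sub>R abs_H1 f = abs_H1 (\<lambda>p. c * f p)"
  by (simp add: scaleR_H1.abs_eq sobolev_ae_eq)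

lemma mass_abs: "sobolev f \<Longrightarrow> mass (abs_H1 f) = (LINT p|triangle_measure. (f p)\<^sup>2)"
  by (simp add: mass.abs_eq sobolev_ae_eq)

lemma total_abs: "sobolev f \<Longrightarrow> total (abs_H1 f) = (LINT p|triangle_measure. f p)"
  by (simp add: total.abs_eq sobolev_ae_eq)

text \<open>Independence of the representative and of the chosen derivative, by
  \<open>weak_deriv_unique\<close>.\<close>

lemma energy_abs:
  assumes "sobolev f" "weak_deriv e f g"
  shows "energy e (abs_H1 f) = (LINT p|triangle_measure. (g p)\<^sup>2)"
proof -
  have w: "weak_deriv e f (SOME g. weak_deriv e f g)" using assms(2) by (rule someI[of "weak_deriv e f"])
  have "(LINT p|triangle_measure. ((SOME g. weak_deriv e f g) p)\<^sup>2) = (LINT p|triangle_measure. (g p)\<^sup>2)"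
  proof (rule integral_cong_AE)
    show "AE p in triangle_measure. ((SOME g. weak_deriv e f g) p)\<^sup>2 = (g p)\<^sup>2"
      using weak_deriv_unique[OF w assms(2)] by eventually_elim simp
  qed (use w assms(2) in \<open>auto simp: weak_deriv_def square_integrable_def\<close>)
  then show ?thesis using assms by (simp add: energy.abs_eq sobolev_ae_eq)
qed

lemma weak_deriv_exists:
  assumes "sobolev f" "e = (1, 0) \<or> e = (0, 1)"
  shows "\<exists>g. weak_deriv e f g"
  using assms by (auto simp: sobolev_def)

lemma H1_cases:
  obtains f where "v = abs_H1 f" "sobolev f"
  using abs_rep sobolev_rep by metis

lift_definition ip :: "H1 \<Rightarrow> H1 \<Rightarrow> real" is "\<lambda>f g. LINT p|triangle_measure. f p * g p"
  by (auto simp: ae_eq_def sobolev_def square_integrable_def intro!: integral_cong_AE)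

lemma ip_abs: "sobolev f \<Longrightarrow> sobolev g \<Longrightarrow> ip (abs_H1 f) (abs_H1 g) = (LINT p|triangle_measure. f p * g p)"
  by (simp add: ip.abs_eq sobolev_ae_eq)

lemma sobolev_square: "sobolev f \<Longrightarrow> square_integrable f"
  by (simp add: sobolev_def)

lemma ip_commute: "ip v w = ip w v"
  by (cases v rule: H1_cases, cases w rule: H1_cases) (simp add: ip_abs mult.commute)

lemma ip_add: "ip (v + w) u = ip v u + ip w u"
  by (cases v rule: H1_cases, cases w rule: H1_cases, cases u rule: H1_cases)
     (simp add: abs_add ip_abs sobolev_add distrib_right square_integrable_mult sobolev_square)

lemma ip_scale: "ip (c *\<^sub>R v) u = c * ip v u"
  by (cases v rule: H1_cases, cases u rule: H1_cases) (simp add: abs_scale ip_abs sobolev_scale mult.assoc)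

lemma ip_scale_right: "ip u (c *\<^sub>R v) = c * ip u v"
  using ip_scale[of c v u] by (simp add: ip_commute[of u])

lemma ip_self: "ip v v = mass v"
  by (cases v rule: H1_cases) (simp add: ip_abs mass_abs power2_eq_square)

lemma mass_nonneg: "mass v \<ge> 0"
  by (cases v rule: H1_cases) (simp add: mass_abs)

lemma mass_eq_0: "mass v = 0 \<longleftrightarrow> v = 0"
proof
  obtain f where f: "v = abs_H1 f" "sobolev f" by (rule H1_cases)
  assume "mass v = 0"
  then have "(LINT p|triangle_measure. (f p)\<^sup>2) = 0" using f by (simp add: mass_abs)
  then have "AE p in triangle_measure. (f p)\<^sup>2 = 0"
    by (subst (asm) integral_nonneg_eq_0_iff_AE) (use sobolev_square[OF f(2)] in \<open>auto simp: square_integrable_def\<close>)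
  then have "ae_eq f (\<lambda>p. 0)" using f sobolev_zero by (auto simp: ae_eq_def)
  then show "v = 0" unfolding f(1) zero_H1_def using Quotient3_rel_abs[OF Quotient3_H1] by auto
next
  assume "v = 0"
  then show "mass v = 0" using ip_scale[of 0 0 0] by (simp add: ip_self[symmetric])
qed

lemma energy_add_le:
  assumes e: "e = (1, 0) \<or> e = (0, 1)"
  shows "energy e (v + w) \<le> 2 * energy e v + 2 * energy e w"
proof -
  obtain f where f: "v = abs_H1 f" "sobolev f" by (rule H1_cases)
  obtain g where g: "w = abs_H1 g" "sobolev g" by (rule H1_cases)
  obtain f' g' where w: "weak_deriv e f f'" "weak_deriv e g g'"
    using weak_deriv_exists[OF f(2) e] weak_deriv_exists[OF g(2) e] by blast
  have s: "square_integrable f'" "square_integrable g'" using w by (auto simp: weak_deriv_def)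
  then have i: "integrable triangle_measure (\<lambda>p. (f' p)\<^sup>2)" "integrable triangle_measure (\<lambda>p. (g' p)\<^sup>2)"
    "integrable triangle_measure (\<lambda>p. (f' p + g' p)\<^sup>2)"
    using square_integrable_add[OF s] by (auto simp: square_integrable_def)
  have "energy e (v + w) = (LINT p|triangle_measure. (f' p + g' p)\<^sup>2)"
    unfolding f g abs_add[OF f(2) g(2)]
    by (rule energy_abs[OF sobolev_add[OF f(2) g(2)] weak_deriv_add[OF _ _ w]]) (use f g sobolev_square in auto)
  also have "\<dots> \<le> (LINT p|triangle_measure. 2 * (f' p)\<^sup>2 + 2 * (g' p)\<^sup>2)"
  proof (rule integral_mono)
    show "(f' p + g' p)\<^sup>2 \<le> 2 * (f' p)\<^sup>2 + 2 * (g' p)\<^sup>2" for p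
      using sum_squares_bound[of "f' p" "g' p"] by (simp add: power2_sum)
  qed (use i in auto)
  also have "\<dots> = 2 * energy e v + 2 * energy e w"
    using i energy_abs[OF f(2) w(1)] energy_abs[OF g(2) w(2)] by (simp add: f(1) g(1))
  finally show ?thesis .
qed

lemma energy_scale:
  assumes e: "e = (1, 0) \<or> e = (0, 1)"
  shows "energy e (c *\<^sub>R v) = c\<^sup>2 * energy e v"
proof -
  obtain f where f: "v = abs_H1 f" "sobolev f" by (rule H1_cases)
  obtain f' where w: "weak_deriv e f f'" using weak_deriv_exists[OF f(2) e] by blast
  show ?thesis
    unfolding f(1) abs_scale[OF f(2)] energy_abs[OF f(2) w] energy_abs[OF sobolev_scale[OF f(2)] weak_deriv_scale[OF w]]
    by (simp add: power_mult_distrib)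
qed

lemma energy_nonneg:
  assumes e: "e = (1, 0) \<or> e = (0, 1)"
  shows "energy e v \<ge> 0"
proof -
  obtain f where f: "v = abs_H1 f" "sobolev f" by (rule H1_cases)
  obtain f' where w: "weak_deriv e f f'" using weak_deriv_exists[OF f(2) e] by blast
  show ?thesis unfolding f(1) energy_abs[OF f(2) w] by simp
qed

lemma ip_sum: "ip (\<Sum>x\<in>S. F x) u = (\<Sum>x\<in>S. ip (F x) u)"
  using ip_scale[of 0 0 u] by (induction S rule: infinite_finite_induct) (auto simp: ip_add)

text \<open>Gram-Schmidt for the inner product of square integrable functions.\<close>

lemma orthonormal_basis_exists:
  assumes "finite B"
  shows "\<exists>S. finite S \<and> span S = span B \<and> (\<forall>x\<in>S. \<forall>y\<in>S. ip x y = (if x = y then 1 else 0))"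
  using assms
proof induction
  case empty
  then show ?case by (intro exI[of _ "{}"]) simp
next
  case (insert b B)
  then obtain S where S: "finite S" "span S = span B" "\<And>x y. x \<in> S \<Longrightarrow> y \<in> S \<Longrightarrow> ip x y = (if x = y then 1 else 0)"
    by blast
  define p where "p = (\<Sum>x\<in>S. ip b x *\<^sub>R x)"
  define d where "d = b - p"
  have p: "p \<in> span S" unfolding p_def by (intro span_sum span_scale span_base)
  have ip_minus: "ip (u - w) x = ip u x - ip w x" for u w x
    using ip_add[of u "(-1) *\<^sub>R w" x] ip_scale[of "-1" w x] by simp
  have orth: "ip d x = 0" if x: "x \<in> S" for x
  proof -
    have "ip p x = (\<Sum>y\<in>S. ip b y * ip y x)" by (simp add: p_def ip_sum ip_scale)
    also have "\<dots> = (\<Sum>y\<in>S. if y = x then ip b x else 0)" by (rule sum.cong) (use S(3) x in auto)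
    also have "\<dots> = ip b x" using S(1) x by simp
    finally show ?thesis by (simp add: d_def ip_minus)
  qed
  have sp: "span (insert b B) = span (insert d S)"
  proof -
    have "span (insert b B) = span (insert b S)" using S(2) by (simp add: span_insert)
    also have "\<dots> = span (insert d S)"
      using eq_span_insert_eq[of b d S] p by (simp add: d_def)
    finally show ?thesis .
  qed
  show ?case
  proof (cases "d = 0")
    case True
    then have "span (insert d S) = span S" by (simp add: span_insert_0)
    then show ?thesis using S sp by (intro exI[of _ S]) auto
  next
    case False
    then have md: "mass d > 0" using mass_nonneg[of d] mass_eq_0[of d] by simp
    define n where "n = (1 / sqrt (mass d)) *\<^sub>R d"
    have nn: "ip n n = 1"
    proof -
      have "ip n n = (1 / sqrt (mass d)) * ((1 / sqrt (mass d)) * mass d)"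
        by (simp only: n_def ip_scale ip_scale_right) (simp only: ip_self)
      then show ?thesis using md by (simp add: divide_simps)
    qed
    have no: "ip n x = 0" if "x \<in> S" for x using orth[OF that] by (simp add: n_def ip_scale)
    have no': "ip x n = 0" if "x \<in> S" for x using no[OF that] ip_commute[of x n] by simp
    have nS: "n \<notin> S" using no nn by force
    have "span (insert n S) = span (insert d S)"
    proof -
      have "d = sqrt (mass d) *\<^sub>R n" using md by (simp add: n_def)
      then have "d \<in> span (insert n S)" by (metis insertI1 span_base span_scale)
      moreover have "n \<in> span (insert d S)" unfolding n_def by (intro span_scale span_base) simp
      ultimately show ?thesis
        by (intro subset_antisym span_minimal subspace_span insert_subsetI) (auto intro: span_base)
    qed
    then show ?thesis
      using S sp nn no no' nS by (intro exI[of _ "insert n S"]) auto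
  qed
qed

text \<open>On a finite-dimensional subspace the energy is dominated by the mass: expand in an
  orthonormal basis. Without it the supremum of the Rayleigh quotient would carry no
  information, because a supremum over an unbounded set of reals is an arbitrary value.\<close>

lemma finite_dim_energy_bound:
  assumes B: "finite B" and e: "e = (1, 0) \<or> e = (0, 1)"
  shows "\<exists>C\<ge>0. \<forall>v\<in>span B. energy e v \<le> C * mass v"
proof -
  obtain S where S: "finite S" "span S = span B" "\<And>x y. x \<in> S \<Longrightarrow> y \<in> S \<Longrightarrow> ip x y = (if x = y then 1 else 0)"
    using orthonormal_basis_exists[OF B] by blast
  have e0: "energy e 0 = 0" using energy_scale[OF e, of 0 0] by simp
  \<comment> \<open>The crude factor \<open>2 ^ card T\<close> comes from iterating \<open>(x + y)\<^sup>2 \<le> 2 x\<^sup>2 + 2 y\<^sup>2\<close>; only finiteness matters.\<close>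
  have sumE: "energy e (\<Sum>x\<in>T. F x) \<le> 2 ^ card T * (\<Sum>x\<in>T. energy e (F x))" if "finite T" for T F
    using that
  proof (induction T)
    case (insert x T)
    have E: "energy e (F x) \<ge> 0" "(\<Sum>x\<in>T. energy e (F x)) \<ge> 0" by (auto intro: energy_nonneg[OF e] sum_nonneg)
    have "energy e (\<Sum>x\<in>insert x T. F x) \<le> 2 * energy e (F x) + 2 * energy e (\<Sum>x\<in>T. F x)"
      using insert energy_add_le[OF e] by simp
    also have "\<dots> \<le> 2 * (2 ^ card T * energy e (F x)) + 2 * (2 ^ card T * (\<Sum>x\<in>T. energy e (F x)))"
      using insert E mult_right_mono[of 1 "2 ^ card T" "energy e (F x)"] by (intro add_mono mult_left_mono) auto
    also have "\<dots> = 2 ^ card (insert x T) * (\<Sum>x\<in>insert x T. energy e (F x))"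
      using insert by (simp add: algebra_simps)
    finally show ?case .
  qed (simp add: e0)
  define C where "C = 2 ^ card S * (\<Sum>x\<in>S. energy e x)"
  have C: "C \<ge> 0" unfolding C_def by (auto intro!: mult_nonneg_nonneg sum_nonneg energy_nonneg[OF e])
  have "energy e v \<le> C * mass v" if "v \<in> span B" for v
  proof -
    have "v \<in> span S" using that S(2) by simp
    then obtain c where c: "v = (\<Sum>x\<in>S. c x *\<^sub>R x)" using span_finite[OF S(1)] by auto
    have ipc: "ip v x = c x" if x: "x \<in> S" for x
    proof -
      have "ip v x = (\<Sum>y\<in>S. c y * ip y x)" by (simp add: c ip_sum ip_scale)
      also have "\<dots> = (\<Sum>y\<in>S. if y = x then c x else 0)" by (rule sum.cong) (use S(3) x in auto)
      finally show ?thesis using S(1) x by simp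
    qed
    have m: "mass v = (\<Sum>x\<in>S. (c x)\<^sup>2)"
    proof -
      have "mass v = ip (\<Sum>x\<in>S. c x *\<^sub>R x) v" by (simp only: c[symmetric] ip_self)
      also have "\<dots> = (\<Sum>x\<in>S. c x * ip x v)" by (simp only: ip_sum ip_scale)
      also have "\<dots> = (\<Sum>x\<in>S. (c x)\<^sup>2)"
        by (rule sum.cong) (simp_all add: ipc ip_commute[of _ v] power2_eq_square)
      finally show ?thesis .
    qed
    have "energy e v \<le> 2 ^ card S * (\<Sum>x\<in>S. energy e (c x *\<^sub>R x))" unfolding c by (rule sumE[OF S(1)])
    also have "\<dots> = 2 ^ card S * (\<Sum>x\<in>S. (c x)\<^sup>2 * energy e x)" by (simp add: energy_scale[OF e])
    also have "\<dots> \<le> 2 ^ card S * (\<Sum>x\<in>S. mass v * energy e x)"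
      unfolding m by (intro mult_left_mono sum_mono mult_right_mono energy_nonneg[OF e] member_le_sum S(1)) auto
    also have "\<dots> = C * mass v" by (simp add: C_def sum_distrib_left[symmetric])
    finally show ?thesis .
  qed
  then show ?thesis using C by blast
qed

lemma rayleigh_bdd_above:
  assumes U: "subspace U" "dim U = k" "k \<ge> 1" and t: "t \<ge> 0"
  shows "bdd_above (rayleigh t ` (U - {0}))"
proof -
  obtain B where B: "B \<subseteq> U" "independent B" "U \<subseteq> span B" "card B = dim U" using basis_exists by blast
  have fB: "finite B" using B U by (metis card.infinite not_one_le_zero)
  obtain C D where C: "\<And>v. v \<in> span B \<Longrightarrow> energy_x v \<le> C * mass v" "\<And>v. v \<in> span B \<Longrightarrow> energy_y v \<le> D * mass v"
    using finite_dim_energy_bound[OF fB, of "(1, 0)"] finite_dim_energy_bound[OF fB, of "(0, 1)"] by auto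
  show ?thesis
  proof (rule bdd_aboveI2)
    fix v assume v: "v \<in> U - {0}"
    have m: "mass v > 0" using v mass_nonneg[of v] mass_eq_0[of v] by simp
    have "energy_x v + t * energy_y v \<le> C * mass v + t * (D * mass v)"
      using v B(3) C t by (intro add_mono mult_left_mono) auto
    also have "\<dots> = (C + t * D) * mass v" by (simp add: algebra_simps)
    finally show "rayleigh t v \<le> C + t * D" using m by (simp add: rayleigh_def divide_le_eq)
  qed
qed

text \<open>Gaussian elimination, by induction on the number of equations.\<close>

lemma homogeneous_system:
  fixes M :: "'b \<Rightarrow> 'i \<Rightarrow> real"
  assumes "finite I" "finite B" "card I < card B"
  shows "\<exists>c. (\<exists>b\<in>B. c b \<noteq> 0) \<and> (\<forall>i\<in>I. (\<Sum>b\<in>B. c b * M b i) = 0)"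
  using assms
proof (induction I arbitrary: B M rule: finite_induct)
  case empty
  then obtain b where "b \<in> B" by fastforce
  then show ?case by (intro exI[of _ "\<lambda>_. 1"]) auto
next
  case (insert i I)
  show ?case
  proof (cases "\<forall>b\<in>B. M b i = 0")
    case True
    have "card I < card B" using insert.prems insert.hyps by simp
    from insert.IH[OF insert.prems(1) this, of M] obtain c
      where "\<exists>b\<in>B. c b \<noteq> 0" "\<forall>i\<in>I. (\<Sum>b\<in>B. c b * M b i) = 0" by blast
    then show ?thesis using True by (intro exI[of _ c]) auto
  next
    case False
    then obtain b0 where b0: "b0 \<in> B" "M b0 i \<noteq> 0" by blast
    \<comment> \<open>Eliminate the unknown \<open>b0\<close> with the equation \<open>i\<close>.\<close>
    define N where "N b j = M b j - M b i / M b0 i * M b0 j" for b j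
    have "card I < card (B - {b0})" using insert.prems insert.hyps b0 by simp
    then obtain c where c: "\<exists>b\<in>B - {b0}. c b \<noteq> 0" "\<And>j. j \<in> I \<Longrightarrow> (\<Sum>b\<in>B - {b0}. c b * N b j) = 0"
      using insert.IH[of "B - {b0}" N] insert.prems(1) by auto
    define c' where "c' b = (if b = b0 then - (\<Sum>b\<in>B - {b0}. c b * (M b i / M b0 i)) else c b)" for b
    have sum: "(\<Sum>b\<in>B. c' b * M b j) = (\<Sum>b\<in>B - {b0}. c b * N b j)" for j
    proof -
      have "(\<Sum>b\<in>B. c' b * M b j) = c' b0 * M b0 j + (\<Sum>b\<in>B - {b0}. c' b * M b j)"
        using insert.prems(1) b0 by (subst sum.remove[of B b0]) auto
      also have "(\<Sum>b\<in>B - {b0}. c' b * M b j) = (\<Sum>b\<in>B - {b0}. c b * M b j)"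
        by (rule sum.cong) (auto simp: c'_def)
      also have "c' b0 * M b0 j = - (\<Sum>b\<in>B - {b0}. c b * (M b i / M b0 i * M b0 j))"
        by (simp add: c'_def sum_distrib_right mult.assoc)
      finally show ?thesis by (simp add: N_def right_diff_distrib sum_subtractf)
    qed
    have "(\<Sum>b\<in>B. c' b * M b j) = 0" if "j \<in> insert i I" for j
    proof (cases "j = i")
      case True
      then show ?thesis unfolding sum using b0 by (simp add: N_def)
    next
      case False
      then show ?thesis unfolding sum using that c by simp
    qed
    moreover have "\<exists>b\<in>B. c' b \<noteq> 0" using c(1) by (auto simp: c'_def)
    ultimately show ?thesis by blast
  qed
qed

section \<open>The lower bound in the min-max formula\<close>

lemma slice_mean_cong:
  assumes f: "square_integrable f" and f': "square_integrable f'" and eq: "AE p in triangle_measure. f p = f' p"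
  shows "AE s in radial_measure. slice_mean (pull f) s = slice_mean (pull f') s"
proof -
  define d where "d p = f p + -1 * f' p" for p
  have d: "square_integrable d" unfolding d_def by (intro square_integrable_add square_integrable_scale f f')
  have "AE p in triangle_measure. (d p)\<^sup>2 = 0" using eq by eventually_elim (simp add: d_def)
  then have "(LINT p|triangle_measure. (d p)\<^sup>2) = 0" by (rule integral_eq_zero_AE)
  then have "(LINT r|cone_measure. (pull d r)\<^sup>2) = 0" using square_integrable_pull(4)[OF d] by simp
  then have "AE r in cone_measure. (pull d r)\<^sup>2 = 0"
    by (subst (asm) integral_nonneg_eq_0_iff_AE[OF square_integrable_pull(2)[OF d]]) auto
  then have "AE r in cone_measure. pull f r = pull f' r"
    by eventually_elim (auto simp: pull_def d_def)
  then have "AE s in radial_measure. AE u in angle_measure. pull f (s, u) = pull f' (s, u)"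
    by (rule cone.AE_pair)
  then show ?thesis
    using cone_section(1)[OF square_integrable_pull(3)[OF f]] cone_section(1)[OF square_integrable_pull(3)[OF f']]
  proof eventually_elim
    case (elim s)
    show ?case unfolding slice_mean_def
      by (rule integral_cong_AE) (use elim in \<open>auto intro: borel_measurable_integrable\<close>)
  qed
qed

lemma slice_mean_add:
  assumes f: "square_integrable f" and g: "square_integrable g"
  shows "AE s in radial_measure. slice_mean (pull (\<lambda>p. f p + g p)) s = slice_mean (pull f) s + slice_mean (pull g) s"
  using cone_section(1)[OF square_integrable_pull(3)[OF f]] cone_section(1)[OF square_integrable_pull(3)[OF g]]
proof eventually_elim
  case (elim s)
  have "slice_mean (pull (\<lambda>p. f p + g p)) s = (LINT u|angle_measure. pull f (s, u) + pull g (s, u))"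
    unfolding slice_mean_def by (rule Bochner_Integration.integral_cong) (simp_all add: pull_def distrib_left)
  then show ?case using elim by (simp add: slice_mean_def)
qed

lemma slice_mean_scale: "slice_mean (pull (\<lambda>p. c * f p)) s = c * slice_mean (pull f) s"
proof -
  have "pull (\<lambda>p. c * f p) (s, u) = c * pull f (s, u)" for u by (simp add: pull_def)
  then show ?thesis by (simp add: slice_mean_def)
qed

text \<open>The slice mean is defined only almost everywhere; point values at the nodes refer to its
  unique continuous representative.\<close>

definition mean_rep :: "H1 \<Rightarrow> (real \<Rightarrow> real) \<Rightarrow> bool" where
  "mean_rep v A \<longleftrightarrow> continuous_on {0<..<1} A \<and> (AE s in radial_measure. slice_mean (pull (rep_H1 v)) s = A s)"

lemma mean_rep_abs:
  assumes f: "sobolev f" and A: "continuous_on {0<..<1} A" "AE s in radial_measure. slice_mean (pull f) s = A s"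
  shows "mean_rep (abs_H1 f) A"
  unfolding mean_rep_def
proof (intro conjI A(1))
  show "AE s in radial_measure. slice_mean (pull (rep_H1 (abs_H1 f))) s = A s"
    using slice_mean_cong[OF sobolev_square[OF sobolev_rep] sobolev_square[OF f] rep_abs[OF f]] A(2)
    by eventually_elim simp
qed

lemma mean_rep_unique:
  assumes "mean_rep v A" "mean_rep v B" "0 < s" "s < 1"
  shows "A s = B s"
proof (rule ccontr)
  assume ne: "A s \<noteq> B s"
  have "continuous_on {0<..<1} (\<lambda>s. A s - B s)" using assms unfolding mean_rep_def by (intro continuous_intros) auto
  then have "isCont (\<lambda>s. A s - B s) s" using assms by (simp add: continuous_on_eq_continuous_at)
  then have "((\<lambda>s. A s - B s) \<longlongrightarrow> A s - B s) (nhds s)" by (simp add: continuous_at tendsto_nhds_iff isCont_def)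
  then have "eventually (\<lambda>x. A x - B x \<noteq> 0) (nhds s)" using ne by (intro tendsto_imp_eventually_ne) auto
  then obtain e where e: "e > 0" "\<And>x. \<bar>x - s\<bar> < e \<Longrightarrow> A x - B x \<noteq> 0"
    by (auto simp: eventually_nhds_metric dist_real_def)
  define d where "d = min e (min s (1 - s))"
  have d: "d > 0" "d \<le> e" "d \<le> s" "d \<le> 1 - s" using e assms by (auto simp: d_def)
  have "AE x in radial_measure. A x = B x" using assms unfolding mean_rep_def by (auto elim: eventually_elim2)
  then have "AE x in lborel. 0 < x \<and> x < 1 \<longrightarrow> A x = B x" by (rule AE_radialD)
  then have "AE x in lborel. x \<notin> {s - d<..<s + d}"
    by eventually_elim (use e d in \<open>force simp: abs_less_iff\<close>)
  then have "{s - d<..<s + d} \<in> null_sets lborel" by (subst AE_iff_null_sets) auto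
  then show False using d by (auto simp: null_sets_def)
qed

lemma continuous_on_antideriv:
  assumes "locally_integrable g"
  shows "continuous_on {0<..<1} (antideriv g)"
proof (intro continuous_at_imp_continuous_on ballI)
  fix x :: real assume x: "x \<in> {0<..<1}"
  \<comment> \<open>A compact neighbourhood of \<open>x\<close> that contains the base point \<open>1/2\<close>.\<close>
  define a where "a = min (x / 2) (1/4)"
  define b where "b = max ((x + 1) / 2) (3/4)"
  have ab: "0 < a" "a < b" "b < 1" "a < x" "x < b" "a \<le> 1/2" "1/2 \<le> b"
    using x by (auto simp: a_def b_def min_def max_def)
  have "primitive a b (antideriv g) g"
    by (rule primitive_antideriv) (use assms ab in \<open>auto simp: locally_integrable_def\<close>)
  then have "continuous_on {a..b} (antideriv g)" by (rule primitive_continuous)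
  then show "isCont (antideriv g) x" using ab by (intro continuous_on_interior[of "{a..b}"]) auto
qed

text \<open>An indefinite integral is continuous, and \<open>slice_mean_primitive\<close> represents the slice
  mean as one.\<close>

lemma mean_rep_exists: "\<exists>A. mean_rep v A"
proof -
  obtain p q where w: "weak_deriv (1, 0) (rep_H1 v) p" "weak_deriv (0, 1) (rep_H1 v) q"
    using sobolev_rep[of v] by (auto simp: sobolev_def)
  note m = slice_mean_primitive[OF sobolev_square[OF sobolev_rep] w]
  obtain c where "AE s in lborel. 0 < s \<and> s < 1 \<longrightarrow> slice_mean (pull (rep_H1 v)) s = c + antideriv (slice_mean (\<lambda>r. snd r * pull p r - pull q r)) s"
    using m(1) by blast
  from AE_radialI[OF this] continuous_on_antideriv[OF m(2)] show ?thesis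
    unfolding mean_rep_def by (intro exI[of _ "\<lambda>s. c + antideriv (slice_mean (\<lambda>r. snd r * pull p r - pull q r)) s"]) (auto intro!: continuous_intros)
qed

definition mean_at :: "real \<Rightarrow> H1 \<Rightarrow> real" where
  "mean_at s v = (SOME A. mean_rep v A) s"

lemma mean_at_eq:
  assumes "mean_rep v A" "0 < s" "s < 1"
  shows "mean_at s v = A s"
  unfolding mean_at_def by (rule mean_rep_unique[OF someI[of "mean_rep v"] assms(1)]) (use assms in auto)

text \<open>Linearity turns vanishing at the nodes into linear equations. Sums and multiples of
  continuous representatives are again continuous representatives, so this follows from
  uniqueness.\<close>

lemma mean_at_linear:
  assumes s: "0 < s" "s < 1"
  shows "linear (mean_at s)"
proof (rule linearI)
  fix v w
  obtain A B where A: "mean_rep v A" and B: "mean_rep w B" using mean_rep_exists by blast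
  let ?f = "rep_H1 v" and ?g = "rep_H1 w"
  have eq: "v + w = abs_H1 (\<lambda>p. ?f p + ?g p)"
    using abs_add[OF sobolev_rep[of v] sobolev_rep[of w]] by (simp add: abs_rep)
  have "mean_rep (v + w) (\<lambda>s. A s + B s)"
    unfolding eq
  proof (rule mean_rep_abs[OF sobolev_add[OF sobolev_rep sobolev_rep]])
    show "continuous_on {0<..<1} (\<lambda>s. A s + B s)" using A B unfolding mean_rep_def by (intro continuous_intros) auto
    have "AE s in radial_measure. slice_mean (pull ?f) s = A s" "AE s in radial_measure. slice_mean (pull ?g) s = B s"
      using A B by (auto simp: mean_rep_def)
    then show "AE s in radial_measure. slice_mean (pull (\<lambda>p. ?f p + ?g p)) s = A s + B s"
      using slice_mean_add[OF sobolev_square[OF sobolev_rep[of v]] sobolev_square[OF sobolev_rep[of w]]]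
      by eventually_elim simp
  qed
  then show "mean_at s (v + w) = mean_at s v + mean_at s w"
    using mean_at_eq[OF A s] mean_at_eq[OF B s] mean_at_eq[OF _ s] by simp
next
  fix c :: real and v
  obtain A where A: "mean_rep v A" using mean_rep_exists by blast
  have eq: "c *\<^sub>R v = abs_H1 (\<lambda>p. c * rep_H1 v p)"
    using abs_scale[OF sobolev_rep[of v]] by (simp add: abs_rep)
  have "mean_rep (c *\<^sub>R v) (\<lambda>s. c * A s)"
    unfolding eq
  proof (rule mean_rep_abs[OF sobolev_scale[OF sobolev_rep]])
    show "continuous_on {0<..<1} (\<lambda>s. c * A s)" using A unfolding mean_rep_def by (intro continuous_intros) auto
    have "AE s in radial_measure. slice_mean (pull (rep_H1 v)) s = A s" using A by (auto simp: mean_rep_def)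
    then show "AE s in radial_measure. slice_mean (pull (\<lambda>p. c * rep_H1 v p)) s = c * A s"
      by eventually_elim (simp add: slice_mean_scale)
  qed
  then show "mean_at s (c *\<^sub>R v) = c *\<^sub>R mean_at s v"
    using mean_at_eq[OF A s] mean_at_eq[OF _ s] by simp
qed

lemma lower_bound_H1:
  assumes z: "z > 0" "bessel_J 1 z = 0"
    and t: "0 < t" "t \<le> 1/2" and mu: "z\<^sup>2 * t / pi\<^sup>2 \<le> 1/2"
    and nodes: "\<And>s. s \<in> nodes z \<Longrightarrow> mean_at s v = 0"
  shows "z\<^sup>2 * (t - t\<^sup>2 / (3 * (1 - z\<^sup>2 * t / pi\<^sup>2))) * mass v \<le> energy_x v + t * energy_y v"
proof -
  let ?f = "rep_H1 v"
  obtain p q where w: "weak_deriv (1, 0) ?f p" "weak_deriv (0, 1) ?f q"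
    using sobolev_rep[of v] by (auto simp: sobolev_def)
  let ?g = "slice_mean (\<lambda>r. snd r * pull p r - pull q r)"
  have f: "square_integrable ?f" using sobolev_square[OF sobolev_rep] .
  obtain c where c: "AE s in lborel. 0 < s \<and> s < 1 \<longrightarrow> slice_mean (pull ?f) s = c + antideriv ?g s"
    using slice_mean_primitive(1)[OF f w] by blast
  have "mean_rep v (\<lambda>s. c + antideriv ?g s)"
    unfolding mean_rep_def using AE_radialI[OF c] continuous_on_antideriv[OF slice_mean_primitive(2)[OF f w]]
    by (auto intro!: continuous_intros)
  then have n: "c + antideriv ?g s = 0" if "s \<in> nodes z" for s
    using mean_at_eq[of v _ s] nodes[OF that] that by (auto simp: nodes_def)
  have "energy_x v = (LINT r|triangle_measure. (p r)\<^sup>2)" "energy_y v = (LINT r|triangle_measure. (q r)\<^sup>2)"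
    "mass v = (LINT r|triangle_measure. (?f r)\<^sup>2)"
    using energy_abs[OF sobolev_rep w(1)] energy_abs[OF sobolev_rep w(2)] mass_abs[OF sobolev_rep[of v]] by (simp_all add: abs_rep)
  then show ?thesis using lower_bound_function[OF z t mu f w c n] by simp
qed

definition one_H1 :: H1 where "one_H1 = abs_H1 (\<lambda>_. 1)"

lemma const_weak_deriv:
  assumes "e = (1, 0) \<or> e = (0, 1)"
  shows "weak_deriv e (\<lambda>_. c) (\<lambda>_. 0)" "sobolev (\<lambda>_. c)"
proof -
  have "((\<lambda>_. c) has_derivative (\<lambda>h. 0 * fst h + 0 * snd h)) (at p)" for p :: "real \<times> real" by simp
  note C = weak_deriv_C1[of "\<lambda>_. c" "\<lambda>_. 0" "\<lambda>_. 0", OF this]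
  show "weak_deriv e (\<lambda>_. c) (\<lambda>_. 0)" using assms C by auto
  show "sobolev (\<lambda>_. c)" using C by (auto simp: sobolev_def)
qed

lemma total_one: "total one_H1 = 1/2" "mass one_H1 = 1/2"
proof -
  have s: "square_integrable (\<lambda>_. 1)" by (intro square_integrable_continuous continuous_intros)
  have "(LINT p|triangle_measure. 1) = (LINT r|cone_measure. pull (\<lambda>_. 1) r)"
    using square_integrable_pull(5)[OF s] by simp
  also have "\<dots> = (LINT r|cone_measure. 1)"
  proof (rule integral_cong_AE)
    show "AE r in cone_measure. pull (\<lambda>_. 1) r = 1"
      using AE_cone_square
    proof eventually_elim
      case (elim r) then show ?case using cone_map_triangle'[of "fst r" "snd r"] by (simp add: pull_def)
    qed
  qed (use square_integrable_pull(1)[OF s] in auto)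
  also have "\<dots> = (LINT s|radial_measure. LINT u|angle_measure. 1)"
    by (rule cone_section(3)[symmetric]) simp
  also have "\<dots> = (LINT s|radial_measure. 1)" by simp
  also have "\<dots> = (LINT s|angle_measure. s)"
    by (subst radial_integral(1), simp, subst angle_integral(1), simp, simp add: mult.commute)
  finally have 1: "(LINT p|triangle_measure. 1) = (1/2::real)" using angle_moments(1) by simp
  then show "total one_H1 = 1/2" "mass one_H1 = 1/2"
    unfolding one_H1_def using const_weak_deriv(2)[of "(1,0)" 1] by (simp_all add: total_abs mass_abs)
qed

lemma energy_add_one:
  assumes e: "e = (1, 0) \<or> e = (0, 1)"
  shows "energy e (v + c *\<^sub>R one_H1) = energy e v"
proof -
  obtain f where f: "v = abs_H1 f" "sobolev f" by (rule H1_cases)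
  obtain f' where w: "weak_deriv e f f'" using weak_deriv_exists[OF f(2) e] by blast
  note C = const_weak_deriv[OF e, of c]
  have "v + c *\<^sub>R one_H1 = abs_H1 (\<lambda>p. f p + c)"
    unfolding one_H1_def f(1) using abs_scale[OF const_weak_deriv(2)[OF e, of 1], of c] abs_add[OF f(2) C(2)] by simp
  moreover have "weak_deriv e (\<lambda>p. f p + c) f'"
    using weak_deriv_add[OF sobolev_square[OF f(2)] sobolev_square[OF C(2)] w C(1)] by simp
  ultimately show ?thesis
    using energy_abs[OF sobolev_add[OF f(2) C(2)]] energy_abs[OF f(2) w] f(1) by simp
qed

lemma total_ip: "total v = ip v one_H1"
  unfolding one_H1_def
  by (cases v rule: H1_cases) (simp add: total_abs ip_abs const_weak_deriv(2)[of "(1, 0)"])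

text \<open>A mean-zero function is orthogonal to the constants, and the triangle has area \<open>1/2\<close>.\<close>

lemma mass_add_one:
  assumes "total v = 0"
  shows "mass (v + c *\<^sub>R one_H1) = mass v + c\<^sup>2 / 2"
proof -
  have "mass (v + c *\<^sub>R one_H1) = ip v (v + c *\<^sub>R one_H1) + c * ip one_H1 (v + c *\<^sub>R one_H1)"
    by (simp add: ip_self[symmetric] ip_add ip_scale)
  also have "ip v (v + c *\<^sub>R one_H1) = mass v + c * total v"
    by (subst ip_commute) (simp add: ip_add ip_scale ip_self ip_commute[of one_H1 v] total_ip)
  also have "ip one_H1 (v + c *\<^sub>R one_H1) = total v + c / 2"
    by (subst ip_commute) (simp add: ip_add ip_scale ip_self total_ip total_one(2))
  finally show ?thesis using assms by (simp add: power2_eq_square)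
qed

text \<open>There are at most \<open>k\<close> conditions \<open>mean_at s w = 0\<close> and \<open>k + 1\<close> unknown coefficients for
  \<open>w\<close> in the span of \<open>U\<close> and the constants. The component \<open>v\<close> of \<open>w\<close> in \<open>U\<close> is not \<open>0\<close>:
  otherwise \<open>w\<close> would be a nonzero constant of energy \<open>0\<close>, against the lower bound. So \<open>v\<close>
  competes in the supremum.\<close>

lemma minmax_lower_bound:
  assumes k: "k \<ge> 1" and t: "0 < t" "t \<le> t_bound k"
    and U: "subspace U" "U \<subseteq> zero_mean" "dim U = k"
  shows "Lam k * (t - t\<^sup>2 / (3 * (1 - Lam k * t / pi\<^sup>2))) \<le> (SUP v \<in> U - {0}. rayleigh t v)"
proof -
  define z where "z = bessel_zero 1 k"
  note z = bessel_zero_1[OF k, folded z_def]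
  have Lam: "Lam k = z\<^sup>2" by (simp add: Lam_def z_def)
  have z2: "z\<^sup>2 > 0" using z by simp
  have t2: "t \<le> 1/2" "t \<le> pi\<^sup>2 / (2 * z\<^sup>2)" using t by (auto simp: t_bound_def Lam)
  have mu: "z\<^sup>2 * t / pi\<^sup>2 \<le> 1/2"
    using t2(2) z2 by (simp add: field_simps)
  define L where "L = z\<^sup>2 * (t - t\<^sup>2 / (3 * (1 - z\<^sup>2 * t / pi\<^sup>2)))"
  have L: "L > 0"
  proof -
    define m where "m = 3 * (1 - z\<^sup>2 * t / pi\<^sup>2)"
    define x where "x = z\<^sup>2 * t / pi\<^sup>2"
    have "x \<le> 1/2" using mu by (simp only: x_def)
    then have "m \<ge> 3/2" unfolding m_def x_def[symmetric] by simp
    then have "t\<^sup>2 / m < t" using t t2(1) by (simp add: divide_less_eq power2_eq_square)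
    then show ?thesis unfolding L_def m_def[symmetric] using z2 by simp
  qed
  obtain B where B: "B \<subseteq> U" "independent B" "U \<subseteq> span B" "card B = dim U" using basis_exists by blast
  have fB: "finite B" using B U k by (metis card.infinite not_one_le_zero)
  have oneB: "one_H1 \<notin> B" using B(1) U(2) total_one(1) by (auto simp: zero_mean_def)
  \<comment> \<open>More unknowns than equations.\<close>
  have "card (nodes z) < card (insert one_H1 B)"
    using card_nodes[OF z(1,2)] z(3) B(4) U(3) oneB fB by simp
  then obtain c where c: "\<exists>b\<in>insert one_H1 B. c b \<noteq> 0"
    "\<And>s. s \<in> nodes z \<Longrightarrow> (\<Sum>b\<in>insert one_H1 B. c b * mean_at s b) = 0"
    using homogeneous_system[OF card_nodes(1)[OF z(1,2)], of "insert one_H1 B" "\<lambda>b s. mean_at s b"] fB by auto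
  define v where "v = (\<Sum>b\<in>B. c b *\<^sub>R b)"
  define w where "w = v + c one_H1 *\<^sub>R one_H1"
  have vU: "v \<in> U" unfolding v_def using U(1) B(1) by (intro subspace_sum subspace_scale) auto
  then have tv: "total v = 0" using U(2) by (auto simp: zero_mean_def)
  have w: "w = (\<Sum>b\<in>insert one_H1 B. c b *\<^sub>R b)" using oneB fB by (simp add: w_def v_def add.commute)
  have "mean_at s w = 0" if s: "s \<in> nodes z" for s
  proof -
    have lin: "linear (mean_at s)" using s by (intro mean_at_linear) (auto simp: nodes_def)
    show ?thesis unfolding w using c(2)[OF s] by (simp add: linear_sum[OF lin] linear_scale[OF lin])
  qed
  from lower_bound_H1[OF z(1,2) t(1) t2(1) mu this]
  have "L * mass w \<le> energy_x w + t * energy_y w" by (simp add: L_def)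
  then have est: "L * (mass v + (c one_H1)\<^sup>2 / 2) \<le> energy_x v + t * energy_y v"
    unfolding w_def by (simp add: energy_add_one mass_add_one[OF tv])
  have v0: "v \<noteq> 0"
  proof
    assume v0: "v = 0"
    have "c b = 0" if "b \<in> B" for b
      using independentD[OF B(2) fB order_refl, of c b] v0 that by (simp add: v_def)
    then have "c one_H1 \<noteq> 0" using c(1) by auto
    then have "L * ((c one_H1)\<^sup>2 / 2) > 0" using L by simp
    moreover have "energy e 0 = 0" if "e = (1, 0) \<or> e = (0, 1)" for e
      using energy_scale[OF that, of 0 0] by simp
    moreover have "mass 0 = 0" using mass_eq_0 by simp
    ultimately show False using est v0 by simp
  qed
  then have mv: "mass v > 0" using mass_nonneg[of v] mass_eq_0[of v] by simp
  have "L * mass v \<le> L * (mass v + (c one_H1)\<^sup>2 / 2)" using L by (intro mult_left_mono) auto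
  then have "L \<le> rayleigh t v" using est mv by (simp add: rayleigh_def le_divide_eq)
  also have "\<dots> \<le> (SUP v \<in> U - {0}. rayleigh t v)"
    using vU v0 rayleigh_bdd_above[OF U(1,3) k, of t] t by (intro cSUP_upper) auto
  finally show ?thesis unfolding Lam L_def .
qed

section \<open>Combinations of radial eigenfunctions\<close>

lemma FTC_zero:
  fixes G g :: "real \<Rightarrow> real"
  assumes "\<And>x. (G has_real_derivative g x) (at x)" "continuous_on {0..1} g" "G 0 = G 1"
  shows "(LINT s:{0..1}|lborel. g s) = 0"
proof -
  have "primitive 0 1 G g" by (rule primitive_C1) (use assms in auto)
  from primitive_increment[OF this, of 0 1] show ?thesis using assms(3) by simp
qed

definition rad_comb :: "real set \<Rightarrow> (real \<Rightarrow> real) \<Rightarrow> real \<Rightarrow> real" where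
  "rad_comb Z c s = (\<Sum>z\<in>Z. c z * rad z s)"
definition rad1_comb :: "real set \<Rightarrow> (real \<Rightarrow> real) \<Rightarrow> real \<Rightarrow> real" where
  "rad1_comb Z c s = (\<Sum>z\<in>Z. c z * rad1 z s)"
definition rad2_comb :: "real set \<Rightarrow> (real \<Rightarrow> real) \<Rightarrow> real \<Rightarrow> real" where
  "rad2_comb Z c s = (\<Sum>z\<in>Z. c z * rad2 z s)"

lemma rad_comb_deriv: "(rad_comb Z c has_real_derivative s * rad1_comb Z c s) (at s)"
proof -
  have "(rad_comb Z c has_real_derivative (\<Sum>z\<in>Z. c z * (s * rad1 z s))) (at s)"
    unfolding rad_comb_def[abs_def] by (intro DERIV_sum DERIV_cmult rad_deriv)
  then show ?thesis by (simp add: rad1_comb_def sum_distrib_left mult_ac)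
qed

lemma rad1_comb_deriv: "(rad1_comb Z c has_real_derivative s * rad2_comb Z c s) (at s)"
proof -
  have "(rad1_comb Z c has_real_derivative (\<Sum>z\<in>Z. c z * (s * rad2 z s))) (at s)"
    unfolding rad1_comb_def[abs_def] by (intro DERIV_sum DERIV_cmult rad1_deriv)
  then show ?thesis by (simp add: rad2_comb_def sum_distrib_left mult_ac)
qed

lemma rad_comb_continuous: "continuous_on S (rad_comb Z c)" "continuous_on S (rad1_comb Z c)" "continuous_on S (rad2_comb Z c)"
  unfolding rad_comb_def[abs_def] rad1_comb_def[abs_def] rad2_comb_def[abs_def]
  by (intro continuous_intros rad_continuous rad1_continuous rad2_continuous)+

lemma rad_comb_ode: "2 * rad1_comb Z c s + s\<^sup>2 * rad2_comb Z c s = - rad_comb Z (\<lambda>z. z\<^sup>2 * c z) s"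
proof -
  have "2 * rad1_comb Z c s + s\<^sup>2 * rad2_comb Z c s = (\<Sum>z\<in>Z. c z * (2 * rad1 z s + s\<^sup>2 * rad2 z s))"
    by (simp add: rad1_comb_def rad2_comb_def sum_distrib_left sum.distrib[symmetric] algebra_simps)
  then show ?thesis unfolding rad_ode by (simp add: rad_comb_def sum_negf mult_ac)
qed

lemma flux_comb_deriv:
  "((\<lambda>s. s * (s * rad1_comb Z c s)) has_real_derivative - (s * rad_comb Z (\<lambda>z. z\<^sup>2 * c z) s)) (at s)"
proof -
  have "((\<lambda>s. s * (s * rad1_comb Z c s)) has_real_derivative s * (2 * rad1_comb Z c s + s\<^sup>2 * rad2_comb Z c s)) (at s)"
    by (rule derivative_eq_intros rad1_comb_deriv refl)+ (simp add: algebra_simps power2_eq_square)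
  then show ?thesis unfolding rad_comb_ode by simp
qed

text \<open>The Wronskian-type expression \<open>s u\<^sub>z' u\<^sub>w - u\<^sub>z s u\<^sub>w'\<close> vanishes at \<open>0\<close> and, by the Neumann
  condition, at \<open>1\<close>; its derivative is \<open>(w\<^sup>2 - z\<^sup>2) s u\<^sub>z u\<^sub>w\<close>.\<close>

lemma rad_orthogonal:
  assumes "z > 0" "w > 0" "z \<noteq> w" "rad1 z 1 = 0" "rad1 w 1 = 0"
  shows "(LINT s:{0..1}|lborel. s * rad z s * rad w s) = 0"
proof -
  let ?G = "\<lambda>s. (s * (s * rad1 z s)) * rad w s - rad z s * (s * (s * rad1 w s))"
  have "(?G has_real_derivative (w\<^sup>2 - z\<^sup>2) * (s * rad z s * rad w s)) (at s)" for s
    by (rule derivative_eq_intros flux_deriv rad_deriv refl)+ (simp add: algebra_simps power2_eq_square)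
  then have "(LINT s:{0..1}|lborel. (w\<^sup>2 - z\<^sup>2) * (s * rad z s * rad w s)) = 0"
    by (rule FTC_zero) (use assms in \<open>auto intro!: continuous_intros rad_continuous\<close>)
  moreover have "w\<^sup>2 - z\<^sup>2 \<noteq> 0" using assms by (simp add: power2_eq_iff)
  ultimately show ?thesis by simp
qed

definition rad_norm :: "real \<Rightarrow> real" where
  "rad_norm z = (LINT s:{0..1}|lborel. s * rad z s * rad z s)"

lemma rad_norm_pos:
  assumes "z > 0"
  shows "rad_norm z > 0"
proof -
  have i: "set_integrable lborel {0..1} (\<lambda>s. s * rad z s * rad z s)"
    by (intro borel_integrable_atLeastAtMost' continuous_intros rad_continuous)
  have nn: "indicator {0..1} s *\<^sub>R (s * rad z s * rad z s) \<ge> 0" for s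
    by (cases "s \<in> {0..1}") (auto simp: mult.assoc)
  have "rad_norm z \<noteq> 0"
  proof
    assume "rad_norm z = 0"
    then have ae: "AE s in lborel. indicator {0..1} s *\<^sub>R (s * rad z s * rad z s) = 0"
      using i nn unfolding rad_norm_def set_lebesgue_integral_def set_integrable_def
      by (subst (asm) integral_nonneg_eq_0_iff_AE) auto
    obtain d where d: "d > 0" "\<And>s. 0 < s \<Longrightarrow> s < d \<Longrightarrow> rad z s > 0"
      using rad_near_0[of z] assms by auto
    from ae have "AE s in lborel. s \<notin> {0<..<min d 1}"
    proof eventually_elim
      case (elim s)
      show ?case
      proof
        assume s: "s \<in> {0<..<min d 1}"
        then have "rad z s > 0" using d(2) by simp
        then show False using elim s by simp
      qed
    qed
    then have "{0<..<min d 1} \<in> null_sets lborel" by (subst AE_iff_null_sets) auto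
    then show False using d by (auto simp: null_sets_def)
  qed
  moreover have "rad_norm z \<ge> 0"
    unfolding rad_norm_def set_lebesgue_integral_def by (rule integral_nonneg_AE) (use nn in auto)
  ultimately show ?thesis by simp
qed

lemma rad_comb_product:
  assumes Z: "finite Z" "\<And>z. z \<in> Z \<Longrightarrow> z > 0 \<and> rad1 z 1 = 0"
  shows "(LINT s:{0..1}|lborel. s * rad_comb Z a s * rad_comb Z b s) = (\<Sum>z\<in>Z. a z * b z * rad_norm z)"
proof -
  have i: "set_integrable lborel {0..1} (\<lambda>s. s * rad z s * rad w s)" for z w
    by (intro borel_integrable_atLeastAtMost' continuous_intros rad_continuous)
  define H where "H z w s = indicator {0..1} s *\<^sub>R (s * rad z s * rad w s)" for z w s
  have iH: "integrable lborel (H z w)" for z w using i unfolding set_integrable_def H_def[abs_def] .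
  have "(LINT s:{0..1}|lborel. s * rad_comb Z a s * rad_comb Z b s) = (LINT s|lborel. (\<Sum>z\<in>Z. \<Sum>w\<in>Z. a z * b w * H z w s))"
    unfolding set_lebesgue_integral_def
  proof (rule Bochner_Integration.integral_cong)
    fix s
    have "s * rad_comb Z a s * rad_comb Z b s = s * (\<Sum>z\<in>Z. \<Sum>w\<in>Z. (a z * rad z s) * (b w * rad w s))"
      unfolding rad_comb_def by (simp add: sum_product mult.assoc)
    then show "indicator {0..1} s *\<^sub>R (s * rad_comb Z a s * rad_comb Z b s) = (\<Sum>z\<in>Z. \<Sum>w\<in>Z. a z * b w * H z w s)"
      by (simp add: H_def sum_distrib_left mult_ac)
  qed simp
  also have "\<dots> = (\<Sum>z\<in>Z. \<Sum>w\<in>Z. a z * b w * (LINT s|lborel. H z w s))"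
    using iH by simp
  also have "\<dots> = (\<Sum>z\<in>Z. \<Sum>w\<in>Z. a z * b w * (LINT s:{0..1}|lborel. s * rad z s * rad w s))"
    by (simp only: set_lebesgue_integral_def H_def)
  also have "\<dots> = (\<Sum>z\<in>Z. \<Sum>w\<in>Z. if w = z then a z * b z * rad_norm z else 0)"
    using Z rad_orthogonal by (intro sum.cong refl) (auto simp: rad_norm_def)
  also have "\<dots> = (\<Sum>z\<in>Z. a z * b z * rad_norm z)" using Z(1) by simp
  finally show ?thesis .
qed

text \<open>The equation exhibits \<open>s u\<close> as the derivative of a multiple of the flux \<open>s u'\<close>, which
  vanishes at both ends.\<close>

lemma rad_comb_mean:
  assumes Z: "finite Z" "\<And>z. z \<in> Z \<Longrightarrow> z > 0 \<and> rad1 z 1 = 0"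
  shows "(LINT s:{0..1}|lborel. s * rad_comb Z c s) = 0"
proof -
  have "(LINT s:{0..1}|lborel. - (s * rad_comb Z (\<lambda>z. z\<^sup>2 * (c z / z\<^sup>2)) s)) = 0"
    by (rule FTC_zero[OF flux_comb_deriv])
       (use Z in \<open>auto intro!: continuous_intros rad_comb_continuous sum.neutral simp: rad1_comb_def\<close>)
  moreover have "rad_comb Z (\<lambda>z. z\<^sup>2 * (c z / z\<^sup>2)) s = rad_comb Z c s" for s
    unfolding rad_comb_def by (rule sum.cong) (use Z in force)+
  ultimately show ?thesis by (simp add: set_lebesgue_integral_def)
qed

lemma set_integral_continuous_simps:
  fixes f g :: "real \<Rightarrow> real"
  assumes "continuous_on {0..1} f" "continuous_on {0..1} g"
  shows "(LINT s:{0..1}|lborel. f s + g s) = (LINT s:{0..1}|lborel. f s) + (LINT s:{0..1}|lborel. g s)"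
    "(LINT s:{0..1}|lborel. f s - g s) = (LINT s:{0..1}|lborel. f s) - (LINT s:{0..1}|lborel. g s)"
    "(\<And>s. s \<in> {0..1} \<Longrightarrow> f s \<le> g s) \<Longrightarrow> (LINT s:{0..1}|lborel. f s) \<le> (LINT s:{0..1}|lborel. g s)"
  using borel_integrable_atLeastAtMost'[OF assms(1)] borel_integrable_atLeastAtMost'[OF assms(2)]
  by (auto simp: set_integral_add set_integral_diff intro: set_integral_mono)

text \<open>Green's formula: \<open>s U U'\<close> vanishes at both ends.\<close>

lemma dirichlet_identity:
  assumes "rad1_comb Z c 1 = 0"
  shows "(LINT s:{0..1}|lborel. s ^ 3 * (rad1_comb Z c s)\<^sup>2) =
    (LINT s:{0..1}|lborel. s * rad_comb Z c s * rad_comb Z (\<lambda>z. z\<^sup>2 * c z) s)"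
proof -
  let ?G = "\<lambda>s. (s * (s * rad1_comb Z c s)) * rad_comb Z c s"
  have "(?G has_real_derivative s ^ 3 * (rad1_comb Z c s)\<^sup>2 - s * rad_comb Z c s * rad_comb Z (\<lambda>z. z\<^sup>2 * c z) s) (at s)" for s
    by (rule derivative_eq_intros flux_comb_deriv rad_comb_deriv refl)+ (simp add: algebra_simps power2_eq_square power3_eq_cube)
  then have "(LINT s:{0..1}|lborel. s ^ 3 * (rad1_comb Z c s)\<^sup>2 - s * rad_comb Z c s * rad_comb Z (\<lambda>z. z\<^sup>2 * c z) s) = 0"
    by (rule FTC_zero) (use assms in \<open>auto intro!: continuous_intros rad_comb_continuous\<close>)
  then show ?thesis
    by (subst (asm) set_integral_continuous_simps(2)) (auto intro!: continuous_intros rad_comb_continuous)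
qed

text \<open>With \<open>K = U'/s\<close> and \<open>f\<close> the image of \<open>U\<close> under minus the radial Laplacian, the equation
  reads \<open>s\<^sup>2 K\<^sub>2 = - (f + 2 K)\<close>. After squaring, the cross term \<open>s\<^sup>3 f K\<close> is a multiple of the
  derivative of \<open>(s\<^sup>2 K)\<^sup>2\<close> and integrates to \<open>0\<close>; in the other terms the weight \<open>s\<^sup>3\<close> is
  replaced by \<open>s\<close> in front of \<open>f\<^sup>2\<close>.\<close>

lemma rad2_comb_bound:
  assumes "rad1_comb Z c 1 = 0"
  shows "(LINT s:{0..1}|lborel. s ^ 7 * (rad2_comb Z c s)\<^sup>2) \<le>
    (LINT s:{0..1}|lborel. s * rad_comb Z (\<lambda>z. z\<^sup>2 * c z) s * rad_comb Z (\<lambda>z. z\<^sup>2 * c z) s)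
     + 4 * (LINT s:{0..1}|lborel. s ^ 3 * (rad1_comb Z c s)\<^sup>2)"
proof -
  let ?K = "rad1_comb Z c" and ?f = "rad_comb Z (\<lambda>z. z\<^sup>2 * c z)"
  let ?G = "\<lambda>s. (s * (s * ?K s)) * (s * (s * ?K s))"
  note c = continuous_intros rad_comb_continuous
  have "(?G has_real_derivative - 2 * (s ^ 3 * ?f s * ?K s)) (at s)" for s
    by (rule derivative_eq_intros flux_comb_deriv refl)+ (simp add: algebra_simps power2_eq_square power3_eq_cube)
  then have "(LINT s:{0..1}|lborel. - 2 * (s ^ 3 * ?f s * ?K s)) = 0"
    by (rule FTC_zero) (use assms in \<open>auto intro!: c\<close>)
  then have cross: "(LINT s:{0..1}|lborel. s ^ 3 * ?f s * ?K s) = 0"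
    by (simp only: set_integral_mult_right)
  have K2: "s\<^sup>2 * rad2_comb Z c s = - (?f s + 2 * ?K s)" for s using rad_comb_ode[of Z c s] by simp
  have "s ^ 7 * (rad2_comb Z c s)\<^sup>2 = s ^ 3 * (s\<^sup>2 * rad2_comb Z c s)\<^sup>2" for s
    by (simp add: power_mult_distrib power_mult[symmetric] power_add[symmetric] mult.assoc[symmetric])
  then have eq: "s ^ 7 * (rad2_comb Z c s)\<^sup>2 = (s ^ 3 * (?f s)\<^sup>2 + 4 * (s ^ 3 * ?f s * ?K s)) + 4 * (s ^ 3 * (?K s)\<^sup>2)" for s
    unfolding K2 by (simp add: power2_eq_square algebra_simps)
  have "(LINT s:{0..1}|lborel. s ^ 7 * (rad2_comb Z c s)\<^sup>2) =
     (LINT s:{0..1}|lborel. s ^ 3 * (?f s)\<^sup>2) + 4 * (LINT s:{0..1}|lborel. s ^ 3 * ?f s * ?K s) + 4 * (LINT s:{0..1}|lborel. s ^ 3 * (?K s)\<^sup>2)"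
    unfolding eq by (subst set_integral_continuous_simps(1), auto intro!: c)+
  moreover have "(LINT s:{0..1}|lborel. s ^ 3 * (?f s)\<^sup>2) \<le> (LINT s:{0..1}|lborel. s * ?f s * ?f s)"
  proof (rule set_integral_continuous_simps(3))
    fix s :: real assume s: "s \<in> {0..1}"
    then have "s ^ 3 \<le> s" using power_decreasing[of 1 3 s] by simp
    then have "s ^ 3 * (?f s)\<^sup>2 \<le> s * (?f s)\<^sup>2" by (rule mult_right_mono) simp
    then show "s ^ 3 * (?f s)\<^sup>2 \<le> s * ?f s * ?f s" by (simp add: power2_eq_square mult_ac)
  qed (auto intro!: c)
  ultimately show ?thesis using cross by simp
qed

section \<open>Trial functions and the upper bound\<close>

lemma radial_set_integral:
  assumes "continuous_on {0..1} h" "h \<in> borel_measurable borel"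
  shows "(LINT s|radial_measure. h s) = (LINT s:{0..1}|lborel. s * h s)" "integrable radial_measure h"
proof -
  have i: "set_integrable lborel {0..1} (\<lambda>s. s * h s)"
    by (intro borel_integrable_atLeastAtMost' continuous_intros assms)
  have ae: "AE s in lborel. s * indicator {0<..<1} s * h s = indicator {0..1} s *\<^sub>R (s * h s)"
    using AE_lborel_singleton[of 0] AE_lborel_singleton[of 1] by eventually_elim (auto split: split_indicator)
  have m: "(\<lambda>s. s * indicator {0<..<1} s * h s) \<in> borel_measurable lborel" "(\<lambda>s. indicator {0..1} s *\<^sub>R (s * h s)) \<in> borel_measurable lborel"
    using assms(2) by measurable
  show "(LINT s|radial_measure. h s) = (LINT s:{0..1}|lborel. s * h s)"
    unfolding radial_integral(1)[OF assms(2)] set_lebesgue_integral_def by (rule integral_cong_AE[OF m ae])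
  show "integrable radial_measure h"
    unfolding radial_integral(2)[OF assms(2)] using i unfolding set_integrable_def by (simp only: integrable_cong_AE[OF m ae])
qed

text \<open>\<open>G\<close> is the identity for the mean and the square for the mass and the energies.\<close>

lemma slice_integral_continuous:
  fixes G :: "real \<Rightarrow> real"
  assumes h: "h \<in> borel_measurable borel" "continuous_on {0..1} h"
    and G: "G \<in> borel_measurable borel"
    and eq: "\<And>s. 0 < s \<Longrightarrow> s < 1 \<Longrightarrow> (LINT u|angle_measure. G (F (s * u, 1 - s))) = h s"
    and cF: "continuous_on UNIV F" and i: "integrable cone_measure (\<lambda>r. G (pull F r))"
  shows "(LINT r|cone_measure. G (pull F r)) = (LINT s:{0..1}|lborel. s * h s)"
proof -
  have mF: "F \<in> borel_measurable borel" using cF by (rule borel_measurable_continuous_onI)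
  have "(LINT r|cone_measure. G (pull F r)) = (LINT s|radial_measure. LINT u|angle_measure. G (pull F (s, u)))"
    by (rule cone_section(3)[OF i, symmetric])
  also have "\<dots> = (LINT s|radial_measure. h s)"
  proof (rule integral_cong_AE)
    show "(\<lambda>s. LINT u|angle_measure. G (pull F (s, u))) \<in> borel_measurable radial_measure"
      using borel_measurable_integrable[OF cone_section(2)[OF i]] .
    have "AE s in radial_measure. 0 < s \<and> s < 1" by (rule AE_radialI) simp
    then show "AE s in radial_measure. (LINT u|angle_measure. G (pull F (s, u))) = h s"
      using cone_section(1)[OF i]
    proof eventually_elim
      case (elim s)
      have "(LINT u|angle_measure. G (pull F (s, u))) = (LINT u|angle_measure. G (F (s * u, 1 - s)))"
      proof (rule integral_cong_AE)
        show "(\<lambda>u. G (pull F (s, u))) \<in> borel_measurable angle_measure" using elim(2) by auto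
        have "continuous_on UNIV (\<lambda>u. F (s * u, 1 - s))"
          by (rule continuous_on_compose2[OF cF]) (auto intro!: continuous_intros)
        then have "(\<lambda>u. F (s * u, 1 - s)) \<in> borel_measurable borel" by (rule borel_measurable_continuous_onI)
        then show "(\<lambda>u. G (F (s * u, 1 - s))) \<in> borel_measurable angle_measure" using G by simp
        show "AE u in angle_measure. G (pull F (s, u)) = G (F (s * u, 1 - s))"
          by (rule AE_angleI) (use elim(1) cone_map_triangle'[of s] in \<open>auto simp: pull_def\<close>, simp add: cone_map_def)
      qed
      then show ?case using eq elim(1) by simp
    qed
  qed (use h in simp)
  also have "\<dots> = (LINT s:{0..1}|lborel. s * h s)" by (rule radial_set_integral(1)[OF h(2,1)])
  finally show ?thesis .
qed

text \<open>The profile \<open>u\<^sup>2/2 - 1/6\<close> has mean \<open>0\<close> and mean square \<open>1/45\<close>; with \<open>\<integral>u\<^sup>2 = 1/3\<close> this is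
  the origin of the numerical constants of the theorem.\<close>

lemma profile_moments:
  "(LINT u|angle_measure. (a + b * (u\<^sup>2 / 2 - 1 / 6))\<^sup>2) = a\<^sup>2 + b\<^sup>2 / 45"
  "(LINT u|angle_measure. a + b * (u\<^sup>2 / 2 - 1 / 6)) = a"
  "(LINT u|angle_measure. (a * u)\<^sup>2) = a\<^sup>2 / 3"
proof -
  have "(LINT u|angle_measure. (a + b * (u\<^sup>2 / 2 - 1 / 6))\<^sup>2) =
    (LINT u|angle_measure. (a - b / 6)\<^sup>2 + (a - b / 6) * b * u\<^sup>2 + b\<^sup>2 / 4 * u ^ 4)"
    by (rule Bochner_Integration.integral_cong) (simp_all add: power2_eq_square power4_eq_xxxx field_simps)
  also have "\<dots> = (a - b / 6)\<^sup>2 + (a - b / 6) * b * (1/3) + b\<^sup>2 / 4 * (1/5)"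
    by (simp add: angle_moments)
  also have "\<dots> = a\<^sup>2 + b\<^sup>2 / 45" by (simp add: power2_eq_square field_simps)
  finally show "(LINT u|angle_measure. (a + b * (u\<^sup>2 / 2 - 1 / 6))\<^sup>2) = a\<^sup>2 + b\<^sup>2 / 45" .
  have "(LINT u|angle_measure. a + b * (u\<^sup>2 / 2 - 1 / 6)) = (LINT u|angle_measure. (a - b / 6) + b / 2 * u\<^sup>2)"
    by (rule Bochner_Integration.integral_cong) (simp_all add: field_simps)
  also have "\<dots> = (a - b / 6) + b / 2 * (1/3)" by (simp add: angle_moments)
  finally show "(LINT u|angle_measure. a + b * (u\<^sup>2 / 2 - 1 / 6)) = a" by simp
  show "(LINT u|angle_measure. (a * u)\<^sup>2) = a\<^sup>2 / 3" by (simp add: power_mult_distrib angle_moments)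
qed

text \<open>With \<open>U' = s K\<close> the corrector \<open>t (x\<^sup>2/2 - s\<^sup>2/6) K\<close> has \<open>x\<close>-derivative \<open>t U'\<close> at \<open>x = s\<close>
  and \<open>0\<close> at \<open>x = 0\<close>, so that the natural boundary conditions on the hypotenuse
  (\<open>v\<^sub>x + t v\<^sub>y = 0\<close>) and on the vertical side hold to first order in \<open>t\<close>; the term \<open>s\<^sup>2/6\<close>
  removes its slice mean.\<close>

definition trial :: "real \<Rightarrow> real set \<Rightarrow> (real \<Rightarrow> real) \<Rightarrow> real \<times> real \<Rightarrow> real" where
  "trial t Z c p = rad_comb Z c (1 - snd p) + t * ((fst p)\<^sup>2 / 2 - (1 - snd p)\<^sup>2 / 6) * rad1_comb Z c (1 - snd p)"
definition trial_x :: "real \<Rightarrow> real set \<Rightarrow> (real \<Rightarrow> real) \<Rightarrow> real \<times> real \<Rightarrow> real" where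
  "trial_x t Z c p = t * fst p * rad1_comb Z c (1 - snd p)"
definition trial_y :: "real \<Rightarrow> real set \<Rightarrow> (real \<Rightarrow> real) \<Rightarrow> real \<times> real \<Rightarrow> real" where
  "trial_y t Z c p = - ((1 - t / 3) * (1 - snd p) * rad1_comb Z c (1 - snd p) +
      t * ((fst p)\<^sup>2 / 2 - (1 - snd p)\<^sup>2 / 6) * ((1 - snd p) * rad2_comb Z c (1 - snd p)))"

lemma trial_deriv: "(trial t Z c has_derivative (\<lambda>h. trial_x t Z c p * fst h + trial_y t Z c p * snd h)) (at p)"
proof -
  obtain x y where p: "p = (x, y)" by (cases p)
  have s: "((\<lambda>p::real\<times>real. 1 - snd p) has_derivative (\<lambda>h. - snd h)) (at p)" by (auto intro!: derivative_eq_intros)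
  have U: "((\<lambda>p. rad_comb Z c (1 - snd p)) has_derivative (\<lambda>h. - snd h * ((1 - y) * rad1_comb Z c (1 - y)))) (at p)"
    by (rule has_derivative_compose[OF s, of "rad_comb Z c" "\<lambda>t. t * ((1 - y) * rad1_comb Z c (1 - y))"])
       (use rad_comb_deriv[of Z c "1 - y"] in \<open>simp add: p has_field_derivative_def mult_commute_abs\<close>)
  have K: "((\<lambda>p. rad1_comb Z c (1 - snd p)) has_derivative (\<lambda>h. - snd h * ((1 - y) * rad2_comb Z c (1 - y)))) (at p)"
    by (rule has_derivative_compose[OF s, of "rad1_comb Z c" "\<lambda>t. t * ((1 - y) * rad2_comb Z c (1 - y))"])
       (use rad1_comb_deriv[of Z c "1 - y"] in \<open>simp add: p has_field_derivative_def mult_commute_abs\<close>)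
  have q: "((\<lambda>p::real\<times>real. t * ((fst p)\<^sup>2 / 2 - (1 - snd p)\<^sup>2 / 6)) has_derivative (\<lambda>h. t * (x * fst h + (1 - y) / 3 * snd h))) (at p)"
    unfolding p by (auto intro!: derivative_eq_intros simp: fun_eq_iff field_simps)
  from has_derivative_add[OF U has_derivative_mult[OF q K]]
  show ?thesis unfolding trial_def[abs_def]
    by (rule has_derivative_eq_rhs) (simp add: p fun_eq_iff trial_x_def trial_y_def field_simps power2_eq_square)
qed

lemma comb_snd_continuous:
  "continuous_on S (\<lambda>p::real\<times>real. rad_comb Z c (1 - snd p))"
  "continuous_on S (\<lambda>p::real\<times>real. rad1_comb Z c (1 - snd p))"
  "continuous_on S (\<lambda>p::real\<times>real. rad2_comb Z c (1 - snd p))"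
  by (rule continuous_on_compose2[OF rad_comb_continuous(1)] continuous_on_compose2[OF rad_comb_continuous(2)]
    continuous_on_compose2[OF rad_comb_continuous(3)]; auto intro!: continuous_intros)+

lemma trial_continuous:
  "continuous_on UNIV (trial t Z c)" "continuous_on UNIV (trial_x t Z c)" "continuous_on UNIV (trial_y t Z c)"
  unfolding trial_def[abs_def] trial_x_def[abs_def] trial_y_def[abs_def]
  by (intro continuous_intros comb_snd_continuous | simp)+

lemma trial_weak_deriv:
  "square_integrable (trial t Z c)" "weak_deriv (1, 0) (trial t Z c) (trial_x t Z c)"
  "weak_deriv (0, 1) (trial t Z c) (trial_y t Z c)" "sobolev (trial t Z c)"
proof -
  note w = weak_deriv_C1[OF trial_deriv trial_continuous(2,3), of t Z c]
  show "square_integrable (trial t Z c)" "weak_deriv (1, 0) (trial t Z c) (trial_x t Z c)"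
    "weak_deriv (0, 1) (trial t Z c) (trial_y t Z c)" "sobolev (trial t Z c)"
    using w unfolding sobolev_def by blast+
qed

text \<open>On the slice at \<open>s\<close> the trial function and its derivatives are combinations of \<open>1\<close>, \<open>u\<close>
  and the mean-zero profile \<open>u\<^sup>2/2 - 1/6\<close>, so that no mixed terms appear.\<close>

lemma trial_integrals:
  fixes t :: real and Z :: "real set" and c :: "real \<Rightarrow> real"
  defines "U \<equiv> rad_comb Z c" and "K \<equiv> rad1_comb Z c" and "K2 \<equiv> rad2_comb Z c"
  shows "(LINT p|triangle_measure. trial t Z c p) = (LINT s:{0..1}|lborel. s * U s)"
    and "(LINT p|triangle_measure. (trial t Z c p)\<^sup>2) = (LINT s:{0..1}|lborel. s * ((U s)\<^sup>2 + (t * s\<^sup>2 * K s)\<^sup>2 / 45))"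
    and "(LINT p|triangle_measure. (trial_x t Z c p)\<^sup>2) = (LINT s:{0..1}|lborel. s * ((t * s * K s)\<^sup>2 / 3))"
    and "(LINT p|triangle_measure. (trial_y t Z c p)\<^sup>2) = (LINT s:{0..1}|lborel. s * (((1 - t / 3) * s * K s)\<^sup>2 + (t * s ^ 3 * K2 s)\<^sup>2 / 45))"
proof -
  note c = continuous_intros rad_comb_continuous[of _ Z c, folded U_def K_def K2_def]
  note m = borel_measurable_continuous_onI
  have s: "square_integrable (trial t Z c)" "square_integrable (trial_x t Z c)" "square_integrable (trial_y t Z c)"
    by (intro square_integrable_continuous trial_continuous)+
  have e1: "trial t Z c (s * u, 1 - s) = U s + t * s\<^sup>2 * K s * (u\<^sup>2 / 2 - 1 / 6)" for s u
    by (simp add: trial_def U_def K_def power_mult_distrib field_simps)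
  have e2: "trial_x t Z c (s * u, 1 - s) = t * s * K s * u" for s u
    by (simp add: trial_x_def K_def)
  have e3: "trial_y t Z c (s * u, 1 - s) = - ((1 - t / 3) * s * K s + t * s ^ 3 * K2 s * (u\<^sup>2 / 2 - 1 / 6))" for s u
    by (simp add: trial_y_def K_def K2_def power_mult_distrib power2_eq_square power3_eq_cube field_simps)
  have e3': "(trial_y t Z c (s * u, 1 - s))\<^sup>2 = ((1 - t / 3) * s * K s + t * s ^ 3 * K2 s * (u\<^sup>2 / 2 - 1 / 6))\<^sup>2" for s u
    unfolding e3 by (rule power2_minus)
  show "(LINT p|triangle_measure. trial t Z c p) = (LINT s:{0..1}|lborel. s * U s)"
    unfolding square_integrable_pull(5)[OF s(1), symmetric]
    by (rule slice_integral_continuous[OF _ _ _ _ trial_continuous(1), where G = "\<lambda>x. x"])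
       (use square_integrable_pull[OF s(1)] in \<open>auto simp: e1 profile_moments intro!: m c\<close>)
  show "(LINT p|triangle_measure. (trial t Z c p)\<^sup>2) = (LINT s:{0..1}|lborel. s * ((U s)\<^sup>2 + (t * s\<^sup>2 * K s)\<^sup>2 / 45))"
    unfolding square_integrable_pull(4)[OF s(1), symmetric]
    by (rule slice_integral_continuous[OF _ _ _ _ trial_continuous(1), where G = "\<lambda>x. x\<^sup>2"])
       (use square_integrable_pull[OF s(1)] in \<open>auto simp: e1 profile_moments intro!: m c\<close>)
  show "(LINT p|triangle_measure. (trial_x t Z c p)\<^sup>2) = (LINT s:{0..1}|lborel. s * ((t * s * K s)\<^sup>2 / 3))"
    unfolding square_integrable_pull(4)[OF s(2), symmetric]
    by (rule slice_integral_continuous[OF _ _ _ _ trial_continuous(2), where G = "\<lambda>x. x\<^sup>2"])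
       (use square_integrable_pull[OF s(2)] in \<open>auto simp: e2 profile_moments intro!: m c\<close>)
  show "(LINT p|triangle_measure. (trial_y t Z c p)\<^sup>2) = (LINT s:{0..1}|lborel. s * (((1 - t / 3) * s * K s)\<^sup>2 + (t * s ^ 3 * K2 s)\<^sup>2 / 45))"
    unfolding square_integrable_pull(4)[OF s(3), symmetric]
    by (rule slice_integral_continuous[OF _ _ _ _ trial_continuous(3), where G = "\<lambda>x. x\<^sup>2"])
       (use square_integrable_pull[OF s(3)] in \<open>auto simp: e3' profile_moments intro!: m c\<close>)
qed

text \<open>All terms are expressed by \<open>D = \<integral>s\<^sup>3 K\<^sup>2\<close> and \<open>E = \<integral>s\<^sup>7 K\<^sub>2\<^sup>2\<close>, where \<open>K\<close> and \<open>K\<^sub>2\<close> are the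
  combinations of \<open>rad1\<close> and \<open>rad2\<close>. In an orthogonal expansion \<open>D\<close> and the square of the
  radial Laplacian have factors \<open>z\<^sup>2\<close> and \<open>z\<^sup>4\<close>, all at most \<open>R\<^sup>2\<close> and \<open>R\<^sup>4\<close>. The mass of the
  corrector is dropped.\<close>

lemma trial_energy_bound:
  fixes Z :: "real set" and c :: "real \<Rightarrow> real" and R t :: real
  assumes Z: "finite Z" "\<And>z. z \<in> Z \<Longrightarrow> 0 < z \<and> z \<le> R \<and> rad1 z 1 = 0" and t: "0 < t" "t \<le> 1/2"
  defines "w \<equiv> (\<Sum>z\<in>Z. (c z)\<^sup>2 * rad_norm z)"
  shows "w \<le> (LINT p|triangle_measure. (trial t Z c p)\<^sup>2)"
    and "(LINT p|triangle_measure. (trial_x t Z c p)\<^sup>2) + t * (LINT p|triangle_measure. (trial_y t Z c p)\<^sup>2)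
      \<le> (R\<^sup>2 * (t - t\<^sup>2 / 3) + (R\<^sup>2 / 5 + (R\<^sup>2)\<^sup>2 / 45) * t ^ 3) * w"
proof -
  have Z': "\<And>z. z \<in> Z \<Longrightarrow> z > 0 \<and> rad1 z 1 = 0" using Z(2) by blast
  note cc = continuous_intros rad_comb_continuous
  let ?U = "rad_comb Z c" and ?K = "rad1_comb Z c" and ?K2 = "rad2_comb Z c" and ?f = "rad_comb Z (\<lambda>z. z\<^sup>2 * c z)"
  have K1: "?K 1 = 0" unfolding rad1_comb_def using Z' by (intro sum.neutral) auto
  have w: "w = (LINT s:{0..1}|lborel. s * (?U s)\<^sup>2)"
    using rad_comb_product[OF Z(1) Z', of c c] by (simp add: w_def power2_eq_square mult_ac)
  define D where "D = (LINT s:{0..1}|lborel. s ^ 3 * (?K s)\<^sup>2)"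
  define E where "E = (LINT s:{0..1}|lborel. s ^ 7 * (?K2 s)\<^sup>2)"
  have pos: "rad_norm z \<ge> 0" if "z \<in> Z" for z using rad_norm_pos[of z] Z'[OF that] by simp
  have R2: "z\<^sup>2 \<le> R\<^sup>2" if "z \<in> Z" for z using Z(2)[OF that] by (intro power_mono) auto
  have D: "D \<le> R\<^sup>2 * w"
  proof -
    have "D = (\<Sum>z\<in>Z. c z * (z\<^sup>2 * c z) * rad_norm z)"
      unfolding D_def dirichlet_identity[OF K1] by (rule rad_comb_product[OF Z(1) Z'])
    also have "\<dots> = (\<Sum>z\<in>Z. z\<^sup>2 * ((c z)\<^sup>2 * rad_norm z))" by (simp add: power2_eq_square mult_ac)
    also have "\<dots> \<le> (\<Sum>z\<in>Z. R\<^sup>2 * ((c z)\<^sup>2 * rad_norm z))"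
      by (intro sum_mono mult_right_mono R2 mult_nonneg_nonneg pos) auto
    finally show ?thesis by (simp add: w_def sum_distrib_left)
  qed
  have F: "(LINT s:{0..1}|lborel. s * ?f s * ?f s) \<le> (R\<^sup>2)\<^sup>2 * w"
  proof -
    have "(LINT s:{0..1}|lborel. s * ?f s * ?f s) = (\<Sum>z\<in>Z. (z\<^sup>2 * c z) * (z\<^sup>2 * c z) * rad_norm z)"
      by (rule rad_comb_product[OF Z(1) Z'])
    also have "\<dots> = (\<Sum>z\<in>Z. (z\<^sup>2)\<^sup>2 * ((c z)\<^sup>2 * rad_norm z))" by (simp add: power2_eq_square mult_ac)
    also have "\<dots> \<le> (\<Sum>z\<in>Z. (R\<^sup>2)\<^sup>2 * ((c z)\<^sup>2 * rad_norm z))"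
      by (intro sum_mono mult_right_mono power_mono R2 mult_nonneg_nonneg pos) auto
    finally show ?thesis by (simp add: w_def sum_distrib_left)
  qed
  have E: "E \<le> (R\<^sup>2)\<^sup>2 * w + 4 * D"
    using rad2_comb_bound[OF K1] F unfolding E_def D_def by linarith
  have "(LINT p|triangle_measure. (trial t Z c p)\<^sup>2) = (LINT s:{0..1}|lborel. s * (?U s)\<^sup>2 + s * ((t * s\<^sup>2 * ?K s)\<^sup>2 / 45))"
    unfolding trial_integrals(2) by (simp add: distrib_left)
  moreover have "(LINT s:{0..1}|lborel. s * (?U s)\<^sup>2) \<le> (LINT s:{0..1}|lborel. s * (?U s)\<^sup>2 + s * ((t * s\<^sup>2 * ?K s)\<^sup>2 / 45))"
    by (rule set_integral_continuous_simps(3)) (auto intro!: cc)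
  ultimately show "w \<le> (LINT p|triangle_measure. (trial t Z c p)\<^sup>2)" by (simp add: w)
  have X: "(LINT p|triangle_measure. (trial_x t Z c p)\<^sup>2) = t\<^sup>2 / 3 * D"
  proof -
    have "(LINT p|triangle_measure. (trial_x t Z c p)\<^sup>2) = (LINT s:{0..1}|lborel. t\<^sup>2 / 3 * (s ^ 3 * (?K s)\<^sup>2))"
      unfolding trial_integrals(3)
      by (rule arg_cong[where f = "set_lebesgue_integral lborel _"]) (simp add: fun_eq_iff power2_eq_square power3_eq_cube)
    then show ?thesis by (simp only: set_integral_mult_right D_def)
  qed
  have Y: "(LINT p|triangle_measure. (trial_y t Z c p)\<^sup>2) = (1 - t / 3)\<^sup>2 * D + t\<^sup>2 / 45 * E"
  proof -
    have p7: "s * (s ^ 3 * s ^ 3) = s ^ 7" for s :: real by (simp add: power_add[symmetric] power_Suc[symmetric] del: power_Suc)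
    have "(LINT p|triangle_measure. (trial_y t Z c p)\<^sup>2) =
        (LINT s:{0..1}|lborel. (1 - t / 3)\<^sup>2 * (s ^ 3 * (?K s)\<^sup>2) + t\<^sup>2 / 45 * (s ^ 7 * (?K2 s)\<^sup>2))"
      unfolding trial_integrals(4) p7[symmetric]
      by (rule arg_cong[where f = "set_lebesgue_integral lborel _"])
         (simp add: fun_eq_iff power2_eq_square power3_eq_cube distrib_left mult_ac)
    also have "\<dots> = (LINT s:{0..1}|lborel. (1 - t / 3)\<^sup>2 * (s ^ 3 * (?K s)\<^sup>2)) + (LINT s:{0..1}|lborel. t\<^sup>2 / 45 * (s ^ 7 * (?K2 s)\<^sup>2))"
      by (rule set_integral_continuous_simps(1)) (auto intro!: cc)
    finally show ?thesis by (simp only: set_integral_mult_right D_def E_def)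
  qed
  have "(LINT p|triangle_measure. (trial_x t Z c p)\<^sup>2) + t * (LINT p|triangle_measure. (trial_y t Z c p)\<^sup>2)
     = (t - t\<^sup>2 / 3 + t ^ 3 / 9) * D + t ^ 3 / 45 * E"
    unfolding X Y by (simp add: power2_eq_square power3_eq_cube field_simps)
  also have "\<dots> \<le> (t - t\<^sup>2 / 3 + t ^ 3 / 9) * D + t ^ 3 / 45 * ((R\<^sup>2)\<^sup>2 * w + 4 * D)"
    using E t by (intro add_left_mono mult_left_mono) auto
  also have "\<dots> = (t - t\<^sup>2 / 3 + t ^ 3 / 5) * D + t ^ 3 / 45 * (R\<^sup>2)\<^sup>2 * w"
    by (simp add: field_simps)
  also have "\<dots> \<le> (t - t\<^sup>2 / 3 + t ^ 3 / 5) * (R\<^sup>2 * w) + t ^ 3 / 45 * (R\<^sup>2)\<^sup>2 * w"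
  proof -
    have "t\<^sup>2 \<le> t" using t by (simp add: power2_eq_square mult_le_cancel_left1)
    then have "0 \<le> t - t\<^sup>2 / 3 + t ^ 3 / 5" using t zero_le_power[of t 3] by linarith
    then show ?thesis using D by (intro add_right_mono mult_left_mono)
  qed
  also have "\<dots> = (R\<^sup>2 * (t - t\<^sup>2 / 3) + (R\<^sup>2 / 5 + (R\<^sup>2)\<^sup>2 / 45) * t ^ 3) * w"
    by (simp add: field_simps)
  finally show "(LINT p|triangle_measure. (trial_x t Z c p)\<^sup>2) + t * (LINT p|triangle_measure. (trial_y t Z c p)\<^sup>2)
      \<le> (R\<^sup>2 * (t - t\<^sup>2 / 3) + (R\<^sup>2 / 5 + (R\<^sup>2)\<^sup>2 / 45) * t ^ 3) * w" .
qed

definition trial_H1 :: "real \<Rightarrow> real set \<Rightarrow> real \<Rightarrow> H1" where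
  "trial_H1 t Z z = abs_H1 (trial t Z (\<lambda>w. if w = z then 1 else 0))"

text \<open>The trial function depends linearly on the coefficients of \<open>U\<close>.\<close>

lemma trial_H1_sum:
  assumes Z: "finite Z"
  shows "(\<Sum>z\<in>Z. a z *\<^sub>R trial_H1 t Z z) = abs_H1 (trial t Z a)"
proof -
  let ?e = "\<lambda>z w. if w = z then 1 else (0::real)"
  have part: "(\<Sum>z\<in>T. a z *\<^sub>R trial_H1 t Z z) = abs_H1 (\<lambda>p. \<Sum>z\<in>T. a z * trial t Z (?e z) p) \<and>
      sobolev (\<lambda>p. \<Sum>z\<in>T. a z * trial t Z (?e z) p)" if "finite T" for T
    using that
  proof induction
    case empty
    then show ?case by (simp add: sobolev_zero zero_H1_def)
  next
    case (insert z T)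
    have s: "sobolev (\<lambda>p. a z * trial t Z (?e z) p)" by (intro sobolev_scale trial_weak_deriv)
    have "a z *\<^sub>R trial_H1 t Z z = abs_H1 (\<lambda>p. a z * trial t Z (?e z) p)"
      unfolding trial_H1_def by (rule abs_scale[OF trial_weak_deriv(4)])
    then show ?case
      using insert abs_add[OF s conjunct2[OF insert.IH]] sobolev_add[OF s conjunct2[OF insert.IH]] by simp
  qed
  have e: "rad_comb Z (?e z) s = rad z s" "rad1_comb Z (?e z) s = rad1 z s" if "z \<in> Z" for z s
    using that Z by (simp_all add: rad_comb_def rad1_comb_def if_distrib[of "\<lambda>x. x * _"] cong: if_cong)
  have "(\<lambda>p. \<Sum>z\<in>Z. a z * trial t Z (?e z) p) = trial t Z a"
  proof
    fix p
    have "(\<Sum>z\<in>Z. a z * trial t Z (?e z) p) = (\<Sum>z\<in>Z. a z * rad z (1 - snd p) + t * ((fst p)\<^sup>2 / 2 - (1 - snd p)\<^sup>2 / 6) * (a z * rad1 z (1 - snd p)))"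
      by (rule sum.cong) (simp_all add: trial_def e distrib_left)
    then show "(\<Sum>z\<in>Z. a z * trial t Z (?e z) p) = trial t Z a p"
      by (simp add: trial_def rad_comb_def rad1_comb_def sum.distrib sum_distrib_left)
  qed
  then show ?thesis using part[OF Z] by simp
qed

text \<open>The space spanned by the trial functions of the \<open>k\<close> single zeros. The mass of a
  combination dominates a positive definite form in the coefficients, so the dimension is
  indeed \<open>k\<close>; the means vanish because the radial parts have mean \<open>0\<close> and the corrector has
  mean \<open>0\<close> on each slice.\<close>

lemma minmax_upper_bound:
  assumes k: "k \<ge> 1" and t: "0 < t" "t \<le> 1/2"
  shows "\<exists>U. subspace U \<and> U \<subseteq> zero_mean \<and> dim U = k \<and>
    (SUP v \<in> U - {0}. rayleigh t v) \<le> Lam k * (t - t\<^sup>2 / 3) + Cst k * t ^ 3"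
proof -
  define R where "R = bessel_zero 1 k"
  note R = bessel_zero_1[OF k, folded R_def]
  define Z where "Z = J1_zeros R"
  have r1: "rad1 z 1 = 0" if "bessel_J 1 z = 0" for z
    using bessel_J_rad(2)[of z 1] that by simp
  have Z: "finite Z" "card Z = k" "\<And>z. z \<in> Z \<Longrightarrow> 0 < z \<and> z \<le> R \<and> rad1 z 1 = 0"
    using finite_J1_zeros[of R] R r1 by (auto simp: Z_def J1_zeros_def simp del: One_nat_def)
  let ?b = "Lam k * (t - t\<^sup>2 / 3) + Cst k * t ^ 3"
  have b: "?b = R\<^sup>2 * (t - t\<^sup>2 / 3) + (R\<^sup>2 / 5 + (R\<^sup>2)\<^sup>2 / 45) * t ^ 3"
    by (simp add: Lam_def Cst_def R_def)
  have b0: "?b \<ge> 0"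
  proof -
    have "t\<^sup>2 \<le> t" using t by (simp add: power2_eq_square mult_le_cancel_left1)
    then have "0 \<le> t - t\<^sup>2 / 3" using t by linarith
    then show ?thesis unfolding b using t by (intro add_nonneg_nonneg mult_nonneg_nonneg) auto
  qed
  let ?e = "trial_H1 t Z"
  have mass: "(\<Sum>z\<in>Z. (a z)\<^sup>2 * rad_norm z) \<le> mass (\<Sum>z\<in>Z. a z *\<^sub>R ?e z)" for a
    unfolding trial_H1_sum[OF Z(1)] mass_abs[OF trial_weak_deriv(4)] by (rule trial_energy_bound(1)[OF Z(1,3) t])
  have indep: "a z = 0" if "(\<Sum>z\<in>Z. a z *\<^sub>R ?e z) = 0" "z \<in> Z" for a z
  proof -
    have "(\<Sum>z\<in>Z. (a z)\<^sup>2 * rad_norm z) \<le> 0" using mass[of a] that mass_eq_0[of 0] by simp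
    moreover have nn: "0 \<le> (a z)\<^sup>2 * rad_norm z" if "z \<in> Z" for z
      using rad_norm_pos[of z] Z(3)[OF that] by simp
    ultimately have "(\<Sum>z\<in>Z. (a z)\<^sup>2 * rad_norm z) = 0" using sum_nonneg[of Z "\<lambda>z. (a z)\<^sup>2 * rad_norm z"] by force
    then have "(a z)\<^sup>2 * rad_norm z = 0" using sum_nonneg_eq_0_iff[OF Z(1), of "\<lambda>z. (a z)\<^sup>2 * rad_norm z"] nn that by blast
    then show ?thesis using rad_norm_pos[of z] Z(3)[OF that(2)] by auto
  qed
  have inj: "inj_on ?e Z"
  proof (rule inj_onI, rule ccontr)
    fix z w assume zw: "z \<in> Z" "w \<in> Z" "?e z = ?e w" "z \<noteq> w"
    let ?a = "\<lambda>x. (if x = z then 1 else 0) - (if x = w then 1 else (0::real))"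
    have "(\<Sum>x\<in>Z. ?a x *\<^sub>R ?e x) = (\<Sum>x\<in>Z. (if x = z then ?e x else 0) - (if x = w then ?e x else 0))"
      by (rule sum.cong) (auto simp: scaleR_left_diff_distrib)
    also have "\<dots> = ?e z - ?e w" using Z(1) zw by (simp add: sum_subtractf)
    also have "\<dots> = 0" using zw by simp
    finally have "?a z = 0" using zw(1) by (rule indep)
    then show False using zw by simp
  qed
  define B where "B = ?e ` Z"
  have fB: "finite B" using Z(1) by (simp add: B_def)
  have span: "\<exists>a. v = (\<Sum>z\<in>Z. a z *\<^sub>R ?e z)" if v: "v \<in> span B" for v
  proof -
    obtain u where "v = (\<Sum>x\<in>B. u x *\<^sub>R x)" using v unfolding span_finite[OF fB] by blast
    then have "v = (\<Sum>z\<in>Z. u (?e z) *\<^sub>R ?e z)" by (simp add: B_def sum.reindex[OF inj])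
    then show ?thesis by (rule exI[of _ "\<lambda>z. u (?e z)"])
  qed
  have iB: "independent B"
    unfolding independent_explicit_finite_subsets
  proof (intro allI impI ballI)
    fix A u v assume A: "A \<subseteq> B" "finite A" "(\<Sum>v\<in>A. u v *\<^sub>R v) = 0" "v \<in> A"
    obtain z where z: "z \<in> Z" "v = ?e z" using A by (auto simp: B_def)
    let ?a = "\<lambda>z. if ?e z \<in> A then u (?e z) else 0"
    have "(\<Sum>z\<in>Z. ?a z *\<^sub>R ?e z) = (\<Sum>x\<in>B. (if x \<in> A then u x else 0) *\<^sub>R x)"
      by (simp add: B_def sum.reindex[OF inj])
    also have "\<dots> = (\<Sum>x\<in>A. u x *\<^sub>R x)"
      using A(1) fB by (intro sum.mono_neutral_cong_right) auto
    finally have "?a z = 0" using A(3) z(1) by (intro indep) simp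
    then show "u v = 0" using z A by simp
  qed
  have dim: "dim (span B) = k"
    using dim_span_eq_card_independent[OF iB] card_image[OF inj] Z(2) by (simp add: B_def)
  have zm: "span B \<subseteq> zero_mean"
  proof
    fix v assume "v \<in> span B"
    then obtain a where a: "v = (\<Sum>z\<in>Z. a z *\<^sub>R ?e z)" using span by blast
    have "total v = (LINT s:{0..1}|lborel. s * rad_comb Z a s)"
      unfolding a trial_H1_sum[OF Z(1)] total_abs[OF trial_weak_deriv(4)] by (rule trial_integrals(1))
    also have "\<dots> = 0" using rad_comb_mean[OF Z(1), of a] Z(3) by blast
    finally show "v \<in> zero_mean" by (simp add: zero_mean_def)
  qed
  have ray: "rayleigh t v \<le> ?b" if v: "v \<in> span B - {0}" for v
  proof -
    obtain a where a: "v = (\<Sum>z\<in>Z. a z *\<^sub>R ?e z)" using span v by blast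
    have m: "mass v > 0" using v mass_nonneg[of v] mass_eq_0[of v] by simp
    have "energy_x v + t * energy_y v \<le> ?b * (\<Sum>z\<in>Z. (a z)\<^sup>2 * rad_norm z)"
      unfolding a trial_H1_sum[OF Z(1)] energy_abs[OF trial_weak_deriv(4,2)] energy_abs[OF trial_weak_deriv(4,3)] b
      by (rule trial_energy_bound(2)[OF Z(1,3) t])
    also have "\<dots> \<le> ?b * mass v" using mass[of a] b0 unfolding a by (rule mult_left_mono)
    finally show ?thesis using m by (simp add: rayleigh_def divide_le_eq)
  qed
  have ne: "span B - {0} \<noteq> {}"
  proof
    assume "span B - {0} = {}"
    then have "span B = {0}" using span_zero by blast
    then have "dim (span B) = 0" using dim_span_eq_card_independent[of "{}"] independent_empty by simp
    then show False using dim k by simp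
  qed
  have "(SUP v \<in> span B - {0}. rayleigh t v) \<le> ?b"
    using ne ray by (intro cSUP_least)
  then show ?thesis using zm dim by (intro exI[of _ "span B"]) auto
qed

section \<open>Bounds for the eigenvalues\<close>

lemma eigval_bounds:
  assumes k: "k \<ge> 1" and t: "0 < t" "t \<le> t_bound k"
  shows "Lam k * (t - t\<^sup>2 / (3 * (1 - Lam k * t / pi\<^sup>2))) \<le> eigval k t"
    and "eigval k t \<le> Lam k * (t - t\<^sup>2 / 3) + Cst k * t ^ 3"
proof -
  have t2: "t \<le> 1/2" using t by (simp add: t_bound_def)
  obtain U where U: "subspace U" "U \<subseteq> zero_mean" "dim U = k"
    "(SUP v \<in> U - {0}. rayleigh t v) \<le> Lam k * (t - t\<^sup>2 / 3) + Cst k * t ^ 3"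
    using minmax_upper_bound[OF k t(1) t2] by blast
  note low = minmax_lower_bound[OF k t]
  show "Lam k * (t - t\<^sup>2 / (3 * (1 - Lam k * t / pi\<^sup>2))) \<le> eigval k t"
    unfolding eigval_def by (rule cINF_greatest) (use U low in auto)
  have "eigval k t \<le> (SUP v \<in> U - {0}. rayleigh t v)"
    unfolding eigval_def
  proof (rule cINF_lower)
    show "bdd_below ((\<lambda>U. SUP v \<in> U - {0}. rayleigh t v) ` {U. subspace U \<and> U \<subseteq> zero_mean \<and> dim U = k})"
      by (rule bdd_belowI2[where m = "Lam k * (t - t\<^sup>2 / (3 * (1 - Lam k * t / pi\<^sup>2)))"])
        (use low in auto)
  qed (use U in auto)
  with U(4) show "eigval k t \<le> Lam k * (t - t\<^sup>2 / 3) + Cst k * t ^ 3" by linarith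
qed

text \<open>For the asymptotic statement it remains to expand the lower bound: with
  \<open>x = \<Lambda> t / \<pi>\<^sup>2 \<le> 1/2\<close> one has \<open>1 / (1 - x) \<le> 1 + 2 x\<close>, so that the deviation is at most
  \<open>\<Lambda>\<^sup>2 t\<^sup>3\<close>.\<close>

theorem proposition4p1:
  fixes k :: nat
  assumes "k \<ge> 1"
  shows "(\<forall>t::real. 0 < t \<and> t \<le> t_bound k \<longrightarrow>
            Lam k * (t - t\<^sup>2 / (3 * (1 - Lam k * t / pi\<^sup>2))) \<le> eigval k t \<and>
            eigval k t \<le> Lam k * (t - t\<^sup>2 / 3) + Cst k * t ^ 3)
       \<and> (\<lambda>t. eigval k t - (Lam k * t - Lam k * t\<^sup>2 / 3)) \<in> O[at_right 0](\<lambda>t. t ^ 3)"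
proof (intro conjI allI impI)
  note b = eigval_bounds[OF assms]
  show "Lam k * (t - t\<^sup>2 / (3 * (1 - Lam k * t / pi\<^sup>2))) \<le> eigval k t" if "0 < t \<and> t \<le> t_bound k" for t
    using b(1) that by blast
  show "eigval k t \<le> Lam k * (t - t\<^sup>2 / 3) + Cst k * t ^ 3" if "0 < t \<and> t \<le> t_bound k" for t
    using b(2) that by blast
  have L0: "Lam k > 0" using bessel_zero_1(1)[OF assms] by (simp add: Lam_def)
  have tb: "t_bound k > 0" using L0 by (simp add: t_bound_def)
  define C where "C = Cst k + Lam k * Lam k"
  have est: "norm (eigval k t - (Lam k * t - Lam k * t\<^sup>2 / 3)) \<le> C * norm (t ^ 3)" if t: "0 < t" "t \<le> t_bound k" for t
  proof -
    have Cst: "Cst k \<ge> 0" using L0 by (simp add: Cst_def)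
    have t3: "t ^ 3 > 0" using t by simp
    define x where "x = Lam k * t / pi\<^sup>2"
    have x: "0 \<le> x" "x \<le> 1/2"
    proof -
      show "0 \<le> x" using L0 t by (simp add: x_def)
      have "t \<le> pi\<^sup>2 / (2 * Lam k)" using t by (simp add: t_bound_def)
      then show "x \<le> 1/2" using L0 by (simp add: x_def field_simps)
    qed
    have xt: "x \<le> Lam k * t"
    proof -
      have "1 \<le> pi\<^sup>2" using pi_ge_two by (simp add: one_le_power)
      then have "Lam k * t * 1 \<le> Lam k * t * pi\<^sup>2" using L0 t by (intro mult_left_mono) auto
      then show ?thesis by (simp add: x_def divide_le_eq)
    qed
    have "t\<^sup>2 / (3 * (1 - x)) \<le> t\<^sup>2 / 3 + t\<^sup>2 * x"
    proof -
      have "1 \<le> (1 - x) * (1 + 2 * x)"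
      proof -
        have "x * (1 - 2 * x) \<ge> 0" using x by simp
        then show ?thesis by (simp add: algebra_simps)
      qed
      then have "1 / (1 - x) \<le> 1 + 2 * x" using x by (simp add: divide_le_eq mult.commute)
      then have "t\<^sup>2 / 3 * (1 / (1 - x)) \<le> t\<^sup>2 / 3 * (1 + 2 * x)" by (rule mult_left_mono) simp
      also have "\<dots> \<le> t\<^sup>2 / 3 + t\<^sup>2 * x" using x by (simp add: algebra_simps)
      finally show ?thesis by simp
    qed
    also have "t\<^sup>2 * x \<le> t\<^sup>2 * (Lam k * t)" using xt by (rule mult_left_mono) simp
    finally have "Lam k * (t\<^sup>2 / (3 * (1 - x))) \<le> Lam k * (t\<^sup>2 / 3 + t\<^sup>2 * (Lam k * t))"
      using L0 by (intro mult_left_mono) auto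
    then have lo: "- (Lam k * Lam k * t ^ 3) \<le> eigval k t - (Lam k * t - Lam k * t\<^sup>2 / 3)"
      using b(1)[OF t] unfolding x_def[symmetric] by (simp add: algebra_simps power2_eq_square power3_eq_cube)
    have hi: "eigval k t - (Lam k * t - Lam k * t\<^sup>2 / 3) \<le> Cst k * t ^ 3"
      using b(2)[OF t] by (simp add: algebra_simps)
    have "0 \<le> Cst k * t ^ 3" "0 \<le> Lam k * Lam k * t ^ 3" using Cst L0 t3 by auto
    then have "\<bar>eigval k t - (Lam k * t - Lam k * t\<^sup>2 / 3)\<bar> \<le> Cst k * t ^ 3 + Lam k * Lam k * t ^ 3"
      using lo hi by linarith
    then show ?thesis using t3 by (simp add: C_def distrib_right)
  qed
  show "(\<lambda>t. eigval k t - (Lam k * t - Lam k * t\<^sup>2 / 3)) \<in> O[at_right 0](\<lambda>t. t ^ 3)"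
  proof (rule bigoI[where c = C])
    show "eventually (\<lambda>t. norm (eigval k t - (Lam k * t - Lam k * t\<^sup>2 / 3)) \<le> C * norm (t ^ 3)) (at_right 0)"
      unfolding eventually_at_right_field using tb est by (intro exI[of _ "t_bound k"]) auto
  qed
qed

end
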